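(* Let $\Omega=[0,1]$, $T>0$ and $p\in(1,+\infty)$. Let $g,g_n,g_n^0\in L^\infty(\Omega)$ ($n\in\mathbb{N}$), and let $K,K_n:\Omega^2\to\mathbb{R}$ be measurable, symmetric, nonnegative and bounded. Let $u$ be the unique solution in $[0,T]$ of $$u_t(x,t)=-\boldsymbol{\Delta}_p^{K}(u(x,t)),\qquad u(x,0)=g(x),$$ and let $\check u_n$ be the piecewise linear in time interpolation of the forward Euler iterates with kernel $K_n$ and initial datum $g_n^0$, on a partition of $[0,T]$ with maximal step size $\tau$. Then $$\|u-\check u_n\|_{C(0,T;L^p(\Omega))}\le C\left(\|g_n-g_n^0\|_{L^p(\Omega)}+\|g-g_n\|_{L^p(\Omega)}+\|K-K_n\|_{L^p(\Omega^2)}\right)+O(\tau),$$ where the constant $C$ is independent of $n$.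
   Context: For a kernel $K$, $\boldsymbol{\Delta}_p^{K}(u)(x)=-\int_\Omega K(x,y)|u(y)-u(x)|^{p-2}(u(y)-u(x))\,dy$. A solution in $[0,T]$ is a function in $W^{1,1}(0,T;L^1(\Omega))$ satisfying the initial condition a.e. in $\Omega$ and the equation a.e. in $\Omega\times(0,T)$. The function $g_n$ is the initial datum of the time-continuous problem $\partial_t u_n=-\boldsymbol{\Delta}_p^{K_n}(u_n)$, $u_n(\cdot,0)=g_n$. Let $0=t_0<t_1<\dots<t_N=T$ be a (not necessarily uniform) partition, $\tau_{h-1}=|t_h-t_{h-1}|$, $\tau=\max_h\tau_h$. The forward Euler iterates are defined by $u_n^0=g_n^0$ and $$\frac{u_n^h(x)-u_n^{h-1}(x)}{\tau_{h-1}}=-\boldsymbol{\Delta}_p^{K_n}(u_n^{h-1}(x)),\quad x\in\Omega,\ h\in\{1,\dots,N\},$$ and $$\check u_n(x,t)=\frac{t_h-t}{\tau_{h-1}}u_n^{h-1}(x)+\frac{t-t_{h-1}}{\tau_{h-1}}u_n^h(x),\quad t\in(t_{h-1},t_h],\qquad \check u_n(x,0)=g_n^0(x).$$ $\|w\|_{C(0,T;L^p(\Omega))}=\sup_{t\in[0,T]}\|w(\cdot,t)\|_{L^p(\Omega)}$; $O(\tau)$ is understood as $\tau\to0$. *)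

theory Defs
  imports "HOL-Analysis.Analysis"
begin

text \<open>
  Elements of Lebesgue spaces are represented by functions, identified almost everywhere.
  Functions of time and space take the time argument first: \<open>u t x\<close> stands for $u(x,t)$, so that
  \<open>u t\<close> is the spatial slice $u(\cdot,t)$.
\<close>

abbreviation \<Omega> :: "real set" where
  "\<Omega> \<equiv> {0..1}"

definition Linfty :: "'a::euclidean_space set \<Rightarrow> ('a \<Rightarrow> real) \<Rightarrow> bool" where
  "Linfty S f \<longleftrightarrow> f \<in> borel_measurable (lebesgue_on S) \<and> (\<exists>M. AE x in lebesgue_on S. \<bar>f x\<bar> \<le> M)"

text \<open>The value is \<open>top\<close> when \<open>f\<close> is not in $L^p(S)$, so an upper bound includes membership.\<close>

definition Lp_norm :: "real \<Rightarrow> 'a::euclidean_space set \<Rightarrow> ('a \<Rightarrow> real) \<Rightarrow> ennreal" where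
  "Lp_norm p S f =
     (if f \<in> borel_measurable (lebesgue_on S) \<and> integrable (lebesgue_on S) (\<lambda>x. \<bar>f x\<bar> powr p)
      then ennreal ((LINT x|lebesgue_on S. \<bar>f x\<bar> powr p) powr (1 / p)) else top)"

definition C_Lp_norm :: "real \<Rightarrow> real \<Rightarrow> (real \<Rightarrow> real \<Rightarrow> real) \<Rightarrow> ennreal" where
  "C_Lp_norm p T w = (SUP t\<in>{0..T}. Lp_norm p \<Omega> (w t))"

definition kernel :: "(real \<Rightarrow> real \<Rightarrow> real) \<Rightarrow> bool" where
  "kernel K \<longleftrightarrow>
     (\<lambda>(x, y). K x y) \<in> borel_measurable (lebesgue_on (\<Omega> \<times> \<Omega>)) \<and>
     (\<forall>x\<in>\<Omega>. \<forall>y\<in>\<Omega>. K x y = K y x) \<and>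
     (\<forall>x\<in>\<Omega>. \<forall>y\<in>\<Omega>. 0 \<le> K x y) \<and>
     bounded ((\<lambda>(x, y). K x y) ` (\<Omega> \<times> \<Omega>))"

text \<open>Where \<open>u y = u x\<close> the integrand is \<open>0\<close>, also for \<open>p < 2\<close>, as \<open>0 powr (p - 2) = 0\<close>.\<close>

definition p_integrand ::
    "real \<Rightarrow> (real \<Rightarrow> real \<Rightarrow> real) \<Rightarrow> (real \<Rightarrow> real) \<Rightarrow> real \<Rightarrow> real \<Rightarrow> real" where
  "p_integrand p K u x y = K x y * \<bar>u y - u x\<bar> powr (p - 2) * (u y - u x)"

definition p_laplacian ::
    "real \<Rightarrow> (real \<Rightarrow> real \<Rightarrow> real) \<Rightarrow> (real \<Rightarrow> real) \<Rightarrow> real \<Rightarrow> real" where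
  "p_laplacian p K u x = - (LINT y|lebesgue_on \<Omega>. p_integrand p K u x y)"

text \<open>$C_c^\infty(0,T)$, the test functions defining weak derivatives in time.\<close>

definition test_function :: "real \<Rightarrow> (real \<Rightarrow> real) \<Rightarrow> bool" where
  "test_function T \<phi> \<longleftrightarrow>
     (\<forall>k t. (deriv ^^ k) \<phi> field_differentiable (at t)) \<and> closure {t. \<phi> t \<noteq> 0} \<subseteq> {0<..<T}"

text \<open>
  \<open>u\<close> is in $W^{1,1}(0,T;L^1(\Omega))$ with weak time derivative \<open>v\<close>. The space
  $L^1(0,T;L^1(\Omega))$ is identified with $L^1((0,T)\times\Omega)$, and the Bochner integrals
  $\int_0^T \phi'(t) u(t)\,dt = - \int_0^T \phi(t) v(t)\,dt$, which are equal in $L^1(\Omega)$,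
  are evaluated at almost every \<open>x\<close>; the exceptional null set may depend on \<open>\<phi>\<close>.
\<close>

definition W11_with_deriv ::
    "real \<Rightarrow> (real \<Rightarrow> real \<Rightarrow> real) \<Rightarrow> (real \<Rightarrow> real \<Rightarrow> real) \<Rightarrow> bool" where
  "W11_with_deriv T u v \<longleftrightarrow>
     integrable (lebesgue_on ({0<..<T} \<times> \<Omega>)) (\<lambda>(t, x). u t x) \<and>
     integrable (lebesgue_on ({0<..<T} \<times> \<Omega>)) (\<lambda>(t, x). v t x) \<and>
     (\<forall>\<phi>. test_function T \<phi> \<longrightarrow>
        (AE x in lebesgue_on \<Omega>.
           (LINT t|lebesgue_on {0<..<T}. deriv \<phi> t * u t x) =
           - (LINT t|lebesgue_on {0<..<T}. \<phi> t * v t x)))"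

text \<open>
  Every element of $W^{1,1}(0,T;L^1(\Omega))$ has a unique representative in $C([0,T];L^1(\Omega))$,
  and it is through this representative that $u(\cdot,t)$ is defined for each single \<open>t\<close>, in
  particular in the initial condition.
\<close>

definition continuous_in_L1 :: "real \<Rightarrow> (real \<Rightarrow> real \<Rightarrow> real) \<Rightarrow> bool" where
  "continuous_in_L1 T u \<longleftrightarrow>
     (\<forall>t\<in>{0..T}. integrable (lebesgue_on \<Omega>) (u t)) \<and>
     (\<forall>t\<in>{0..T}. ((\<lambda>s. LINT x|lebesgue_on \<Omega>. \<bar>u s x - u t x\<bar>) \<longlongrightarrow> 0) (at t within {0..T}))"

text \<open>
  Integrability is stated explicitly because the integral of a non-integrable function is \<open>0\<close> in
  the library: the equation at \<open>(t, x)\<close> includes that its right-hand side exists.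
\<close>

definition is_solution ::
    "real \<Rightarrow> (real \<Rightarrow> real \<Rightarrow> real) \<Rightarrow> (real \<Rightarrow> real) \<Rightarrow> real \<Rightarrow> (real \<Rightarrow> real \<Rightarrow> real) \<Rightarrow> bool" where
  "is_solution p K g T u \<longleftrightarrow>
     (\<exists>v. W11_with_deriv T u v \<and> continuous_in_L1 T u \<and>
        (AE x in lebesgue_on \<Omega>. u 0 x = g x) \<and>
        (AE (t, x) in lebesgue_on ({0<..<T} \<times> \<Omega>).
           integrable (lebesgue_on \<Omega>) (p_integrand p K (u t) x) \<and>
           v t x = - p_laplacian p K (u t) x))"

definition is_unique_solution ::
    "real \<Rightarrow> (real \<Rightarrow> real \<Rightarrow> real) \<Rightarrow> (real \<Rightarrow> real) \<Rightarrow> real \<Rightarrow> (real \<Rightarrow> real \<Rightarrow> real) \<Rightarrow> bool" where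
  "is_unique_solution p K g T u \<longleftrightarrow>
     is_solution p K g T u \<and>
     (\<forall>v. is_solution p K g T v \<longrightarrow> (\<forall>t\<in>{0..T}. AE x in lebesgue_on \<Omega>. v t x = u t x))"

definition partition :: "real \<Rightarrow> nat \<Rightarrow> (nat \<Rightarrow> real) \<Rightarrow> bool" where
  "partition T N \<theta> \<longleftrightarrow> \<theta> 0 = 0 \<and> \<theta> N = T \<and> (\<forall>h<N. \<theta> h < \<theta> (Suc h))"

definition max_step :: "nat \<Rightarrow> (nat \<Rightarrow> real) \<Rightarrow> real" where
  "max_step N \<theta> = Max ((\<lambda>h. \<bar>\<theta> h - \<theta> (h - 1)\<bar>) ` {1..N})"

primrec euler ::
    "real \<Rightarrow> (real \<Rightarrow> real \<Rightarrow> real) \<Rightarrow> (real \<Rightarrow> real) \<Rightarrow> (nat \<Rightarrow> real) \<Rightarrow> nat \<Rightarrow> real \<Rightarrow> real" where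
  "euler p K g0 \<theta> 0 = g0"
| "euler p K g0 \<theta> (Suc h) =
     (\<lambda>x. euler p K g0 \<theta> h x - \<bar>\<theta> (Suc h) - \<theta> h\<bar> * p_laplacian p K (euler p K g0 \<theta> h) x)"

definition euler_interp ::
    "real \<Rightarrow> (real \<Rightarrow> real \<Rightarrow> real) \<Rightarrow> (real \<Rightarrow> real) \<Rightarrow> nat \<Rightarrow> (nat \<Rightarrow> real) \<Rightarrow> real \<Rightarrow> real \<Rightarrow> real" where
  "euler_interp p K g0 N \<theta> t x =
     (if t = 0 then g0 x
      else let h = (THE h. h \<in> {1..N} \<and> t \<in> {\<theta> (h - 1)<..\<theta> h});
               \<tau> = \<bar>\<theta> h - \<theta> (h - 1)\<bar>
           in (\<theta> h - t) / \<tau> * euler p K g0 \<theta> (h - 1) x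
              + (t - \<theta> (h - 1)) / \<tau> * euler p K g0 \<theta> h x)"

end

theory Submission
  imports Defs "HOL-Probability.Probability"
begin

text \<open>
  Write \<open>\<Psi> s\<close> for the power nonlinearity \<open>\<bar>s\<bar> powr (p - 2) * s\<close>, so that the equation reads
  $u_t(x) = \int k(x,y)\,\Psi(u(y) - u(x))\,dy$. The solution is bounded by the sup norm of its
  initial datum and, for small steps, the Euler iterates by that of theirs plus one. Only
  differences of bounded size therefore matter, and \<open>\<Psi>\<close> may be replaced by a bounded,
  uniformly continuous, odd and nondecreasing \<open>\<theta>\<close> (locale \<open>flux\<close>). For Borel data a bounded
  solution \<open>sol\<close> is constructed as the limit of Euler steps of length \<open>1 / n\<close>; it is differentiable in
  time at every point, so it is a solution in the weak sense (\<open>sol_is_solution\<close>), and the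
  assumed uniqueness identifies it with the given \<open>u\<close>.

  It remains to compare \<open>sol\<close> with the Euler iterates on the grid. In one step the error
  \<open>e\<close> receives the integral of an antisymmetric flux error, which involves the kernel of
  the scheme only (\<open>step_flux\<close>), and a defect from the difference of the kernels, whose
  $L^p$ norm is at most a constant times the step length times the norm of that difference
  (\<open>kernel_defect_lpn\<close>). The constant involves \<open>\<Psi>\<close> only at differences of the exact solution, hence not
  the kernel or the datum of the scheme.

  If $p \ge 2$, then \<open>\<theta>\<close> is Lipschitz. Up to $O(\tau^2)$ a short step then moves the values of \<open>e\<close> at
  \<open>x\<close> and \<open>y\<close> towards each other without letting them pass, which does not increase the $L^p$
  norm (\<open>Lipschitz_step\<close>).

  If $p < 2$, then \<open>\<theta>\<close> is infinitely steep at \<open>0\<close>, and where the iterates are nearly constant the scheme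
  overshoots and chatters for every step length. One overshoot is harmless, being a flux of
  size $O(\tau)$, but the overshoots of all steps must not add up. The error is therefore kept in the form
  \<open>e x = \<psi> x + (\<integral>y. S x y)\<close> with an antisymmetric stored flux \<open>S\<close> of size $b = O(\tau)$, which
  is nearly $b$ times the sign of \<open>\<psi> x - \<psi> y\<close> (\<open>saturated_decomposition\<close>). The
  flux error of a step goes into the store, and only what exceeds \<open>b\<close> spills over to \<open>\<psi>\<close>. Spilling
  happens only in pairs where the flux drives the values of \<open>e\<close> apart, and its effect on a convex
  functional of \<open>\<psi>\<close>, to first and to second order, is controlled by the work done there
  (\<open>saturated_flux_step\<close>). By monotonicity of \<open>\<theta>\<close> this work is at most a quantity that depends on
  the exact solution alone (\<open>theta_three_point\<close>, \<open>wrong_sign_work\<close>). Up to the difference of the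
  kernels it is the integrated dissipation over the step, and since
  the equation is the gradient flow of a convex energy, this is at most
  $2\tau^2$ times the decrease of $\|u_t\|_2^2$ (\<open>step_dissipation\<close>), which telescopes. The
  functional is $\int (\psi^2 + \tau^2)^{p/2}$. Its second derivative is at most $p\tau^{p-2}$, and in
  terms of norms each unit of work then costs $O(1/\tau)$. Besides the terms from the initial data and the kernels,
  the total is $O(\tau)$ (\<open>chatter_error\<close>).
\<close>

section \<open>Antisymmetric fluxes on a probability space\<close>

text \<open>
  All functions below are bounded and measurable on a whole type, so that integrability is automatic and
  no membership conditions arise. Lebesgue measure on the unit interval fits in as a density with
  respect to Borel measure on the line.
\<close>

locale flux_space = prob_space M for M :: "'a measure" +
  assumes space_M: "space M = UNIV"
begin

sublocale sq: pair_prob_space M M ..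

lemma integrable_bounded:
  assumes "f \<in> borel_measurable M" "\<And>x. \<bar>f x\<bar> \<le> (C::real)"
  shows "integrable M f"
  using assms by (intro integrable_const_bound[where B=C]) auto

lemma integrable_sq_bounded:
  assumes "f \<in> borel_measurable (M \<Otimes>\<^sub>M M)" "\<And>x. \<bar>f x\<bar> \<le> (C::real)"
  shows "integrable (M \<Otimes>\<^sub>M M) f"
  using assms by (intro sq.P.integrable_const_bound[where B=C]) auto

lemma abs_integral_le:
  assumes "f \<in> borel_measurable M" "\<And>x. \<bar>f x\<bar> \<le> (C::real)"
  shows "\<bar>LINT x|M. f x\<bar> \<le> C"
proof -
  have i: "integrable M f" using assms by (rule integrable_bounded)
  have "(LINT x|M. f x) \<le> C"
    using assms i by (intro integral_le_const) (auto intro: order_trans[OF abs_ge_self])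
  moreover have "- C \<le> (LINT x|M. f x)"
    using assms i by (intro integral_ge_const) (auto simp: abs_le_iff minus_le_iff)
  ultimately show ?thesis by (auto simp: abs_le_iff)
qed

definition sym_kernel :: "('a \<Rightarrow> 'a \<Rightarrow> real) \<Rightarrow> real \<Rightarrow> bool" where
  "sym_kernel k \<kappa> \<longleftrightarrow> case_prod k \<in> borel_measurable (M \<Otimes>\<^sub>M M) \<and> (\<forall>x y. k x y = k y x) \<and>
     (\<forall>x y. 0 \<le> k x y \<and> k x y \<le> \<kappa>)"

lemma sym_kernel_meas: "sym_kernel k \<kappa> \<Longrightarrow> case_prod k \<in> borel_measurable (M \<Otimes>\<^sub>M M)"
  by (simp add: sym_kernel_def)

lemma sym_kernel_sym: "sym_kernel k \<kappa> \<Longrightarrow> k x y = k y x"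
  unfolding sym_kernel_def by blast

lemma sym_kernel_bounds: "sym_kernel k \<kappa> \<Longrightarrow> 0 \<le> k x y \<and> k x y \<le> \<kappa>"
  by (simp add: sym_kernel_def)

lemma sym_kernel_const: "sym_kernel k \<kappa> \<Longrightarrow> 0 \<le> \<kappa>"
  using sym_kernel_bounds[of k \<kappa>] order_trans by blast

end

text \<open>
  The function \<open>\<theta>\<close> stands for the truncation of $s \mapsto |s|^{p-2}s$. Uniform continuity takes the
  place of a Lipschitz bound, which fails at \<open>0\<close> for $p < 2$.
\<close>

locale flux = flux_space M for M :: "'a measure" +
  fixes \<theta> :: "real \<Rightarrow> real" and B :: real
  assumes theta_ucont: "uniformly_continuous_on UNIV \<theta>"
    and theta_mono: "mono \<theta>"
    and theta_odd: "\<theta> (- s) = - \<theta> s"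
    and theta_bound: "\<bar>\<theta> s\<bar> \<le> B"
begin

lemma theta_zero [simp]: "\<theta> 0 = 0"
  using theta_odd[of 0] by simp

lemma B_nonneg: "0 \<le> B"
  using theta_bound[of 0] by simp

lemma theta_cont: "continuous_on UNIV \<theta>"
  using theta_ucont by (rule uniformly_continuous_imp_continuous)

lemma theta_isCont: "isCont \<theta> s"
  using theta_cont by (simp add: continuous_on_eq_continuous_at)

lemma theta_meas [measurable]: "\<theta> \<in> borel_measurable borel"
  using theta_cont by (rule borel_measurable_continuous_onI)

lemma theta_le: "a \<le> b \<Longrightarrow> \<theta> a \<le> \<theta> b"
  using theta_mono by (auto simp: mono_def)

lemma theta_diff_le: "\<bar>\<theta> a - \<theta> b\<bar> \<le> 2 * B"
  using theta_bound[of a] theta_bound[of b] by linarith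

lemma theta_modulus:
  assumes "\<delta> > 0"
  obtains r where "r > 0" "\<And>a b. \<bar>a - b\<bar> < r \<Longrightarrow> \<bar>\<theta> a - \<theta> b\<bar> \<le> \<delta>"
proof -
  from theta_ucont assms obtain r where "r > 0" "\<And>a b. \<bar>b - a\<bar> < r \<Longrightarrow> \<bar>\<theta> b - \<theta> a\<bar> < \<delta>"
    by (fastforce simp: uniformly_continuous_on_def dist_real_def)
  then show ?thesis by (intro that[of r]) (auto intro: less_imp_le)
qed

text \<open>
  The right-hand side of the evolution equation. When \<open>\<theta>\<close> is the signed power, this is \<open>- p_laplacian\<close>.
\<close>

definition F :: "('a \<Rightarrow> 'a \<Rightarrow> real) \<Rightarrow> ('a \<Rightarrow> real) \<Rightarrow> 'a \<Rightarrow> real" where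
  "F k z x = (LINT y|M. k x y * \<theta> (z y - z x))"

lemma flux_integrand_meas:
  assumes "sym_kernel k \<kappa>" and [measurable]: "z \<in> borel_measurable M"
  shows "(\<lambda>(x, y). k x y * \<theta> (z y - z x)) \<in> borel_measurable (M \<Otimes>\<^sub>M M)"
proof -
  have [measurable]: "case_prod k \<in> borel_measurable (M \<Otimes>\<^sub>M M)"
    using assms by (simp add: sym_kernel_meas)
  show ?thesis by measurable
qed

lemma section_meas:
  assumes "case_prod f \<in> borel_measurable (M \<Otimes>\<^sub>M M)"
  shows "f x \<in> borel_measurable M"
proof -
  have "Pair x \<in> measurable M (M \<Otimes>\<^sub>M M)"
    by (rule measurable_Pair1') (simp add: space_M)
  from measurable_compose[OF this assms] show ?thesis by simp
qed

lemma flux_integrand_bound: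
  assumes "sym_kernel k \<kappa>"
  shows "\<bar>k x y * \<theta> s\<bar> \<le> \<kappa> * B"
  using sym_kernel_bounds[OF assms, of x y] theta_bound[of s]
  by (simp add: abs_mult mult_mono)

lemma flux_integrand_section:
  assumes "sym_kernel k \<kappa>" "z \<in> borel_measurable M"
  shows "integrable M (\<lambda>y. k x y * \<theta> (z y - z x))"
  using section_meas[OF flux_integrand_meas[OF assms], of x] flux_integrand_bound[OF assms(1)]
  by (rule integrable_bounded)

lemma F_meas:
  assumes "sym_kernel k \<kappa>" "z \<in> borel_measurable M"
  shows "F k z \<in> borel_measurable M"
proof -
  note [measurable] = flux_integrand_meas[OF assms]
  show ?thesis unfolding F_def by measurable
qed

lemma F_bound:
  assumes "sym_kernel k \<kappa>" "z \<in> borel_measurable M"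
  shows "\<bar>F k z x\<bar> \<le> \<kappa> * B"
  unfolding F_def
  using section_meas[OF flux_integrand_meas[OF assms], of x] flux_integrand_bound[OF assms(1)]
  by (rule abs_integral_le)

lemma F_zero [simp]: "F k (\<lambda>_. 0) x = 0"
  by (simp add: F_def)

lemma F_close:
  assumes k: "sym_kernel k \<kappa>" and z: "z1 \<in> borel_measurable M" "z2 \<in> borel_measurable M"
    and r: "\<And>a b. \<bar>a - b\<bar> < r \<Longrightarrow> \<bar>\<theta> a - \<theta> b\<bar> \<le> \<delta>"
    and close: "\<And>x. \<bar>z1 x - z2 x\<bar> < r / 2"
  shows "\<bar>F k z1 x - F k z2 x\<bar> \<le> \<kappa> * \<delta>"
proof -
  note i = flux_integrand_section[OF k z(1), of x] flux_integrand_section[OF k z(2), of x]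
  have "F k z1 x - F k z2 x = (LINT y|M. k x y * \<theta> (z1 y - z1 x) - k x y * \<theta> (z2 y - z2 x))"
    unfolding F_def using i by simp
  moreover have "\<bar>k x y * \<theta> (z1 y - z1 x) - k x y * \<theta> (z2 y - z2 x)\<bar> \<le> \<kappa> * \<delta>" for y
  proof -
    have "\<bar>(z1 y - z1 x) - (z2 y - z2 x)\<bar> < r"
      using close[of x] close[of y] by linarith
    then have "\<bar>\<theta> (z1 y - z1 x) - \<theta> (z2 y - z2 x)\<bar> \<le> \<delta>" by (rule r)
    then have "\<bar>k x y * (\<theta> (z1 y - z1 x) - \<theta> (z2 y - z2 x))\<bar> \<le> \<kappa> * \<delta>"
      using sym_kernel_bounds[OF k, of x y] by (simp add: abs_mult mult_mono)
    then show ?thesis by (simp add: algebra_simps)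
  qed
  moreover have "(\<lambda>y. k x y * \<theta> (z1 y - z1 x) - k x y * \<theta> (z2 y - z2 x)) \<in> borel_measurable M"
    using i by measurable
  ultimately show ?thesis by (metis (no_types, lifting) abs_integral_le)
qed

text \<open>
  One explicit step is nearly a contraction in the sup norm, even though \<open>\<theta>\<close> need not be Lipschitz. Pairs in which
  the differences of \<open>z1\<close> and of \<open>z2\<close> are within \<open>r\<close> of each other change the error by at most
  \<open>\<sigma> * \<kappa> * \<delta>\<close>. In all other pairs the step is too short to move the error at \<open>x\<close> beyond
  the error at \<open>y\<close>, and by monotonicity it moves it in that direction.
\<close>

lemma explicit_step_sup:
  assumes k: "sym_kernel k \<kappa>" and z: "z1 \<in> borel_measurable M" "z2 \<in> borel_measurable M"
    and E: "\<And>x. \<bar>z1 x - z2 x\<bar> \<le> E" and \<sigma>: "0 \<le> \<sigma>"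
    and r: "\<And>a b. \<bar>a - b\<bar> < r \<Longrightarrow> \<bar>\<theta> a - \<theta> b\<bar> \<le> \<delta>" and \<delta>: "0 \<le> \<delta>"
    and small: "\<sigma> * \<kappa> * (2 * B) \<le> r"
  shows "\<bar>z1 x - z2 x + \<sigma> * (F k z1 x - F k z2 x)\<bar> \<le> E + \<sigma> * \<kappa> * \<delta>"
proof -
  note i = flux_integrand_section[OF k z(1), of x] flux_integrand_section[OF k z(2), of x]
  define f where "f y = z1 x - z2 x + \<sigma> * (k x y * \<theta> (z1 y - z1 x) - k x y * \<theta> (z2 y - z2 x))" for y
  have "z1 x - z2 x + \<sigma> * (F k z1 x - F k z2 x) = (LINT y|M. f y)"
    unfolding F_def f_def using i by (simp add: prob_space)
  moreover have "\<bar>f y\<bar> \<le> E + \<sigma> * \<kappa> * \<delta>" for y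
  proof -
    define d where "d = \<theta> (z1 y - z1 x) - \<theta> (z2 y - z2 x)"
    define c where "c = \<sigma> * k x y"
    have f: "f y = (z1 x - z2 x) + c * d"
      by (simp add: f_def d_def c_def algebra_simps)
    have c: "0 \<le> c" "c \<le> \<sigma> * \<kappa>" using sym_kernel_bounds[OF k, of x y] \<sigma> by (auto simp: c_def mult_left_mono)
    have cd: "c * \<bar>d\<bar> \<le> \<sigma> * \<kappa> * D" if "\<bar>d\<bar> \<le> D" for D
      using c that by (intro mult_mono) auto
    define g where "g = (z1 y - z2 y) - (z1 x - z2 x)"
    have g: "g = (z1 y - z1 x) - (z2 y - z2 x)" by (simp add: g_def)
    show ?thesis
    proof (cases "\<bar>g\<bar> < r")
      case True
      then have "\<bar>d\<bar> \<le> \<delta>" unfolding g d_def by (rule r)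
      then have "\<bar>c * d\<bar> \<le> \<sigma> * \<kappa> * \<delta>" using cd c by (simp add: abs_mult)
      then show ?thesis using E[of x] f by linarith
    next
      case False
      have "c * \<bar>d\<bar> \<le> r" using cd[OF theta_diff_le[of "z1 y - z1 x" "z2 y - z2 x", folded d_def]] small by linarith
      then have le: "c * \<bar>d\<bar> \<le> \<bar>g\<bar>" using False by linarith
      have "0 \<le> \<sigma> * \<kappa> * \<delta>" using c \<delta> by (metis mult_nonneg_nonneg order_trans)
      moreover have "\<bar>(z1 x - z2 x) + c * d\<bar> \<le> E"
      proof (cases "g \<ge> 0")
        case True
        then have "0 \<le> d" unfolding d_def g using theta_le[of "z2 y - z2 x" "z1 y - z1 x"] by simp
        then have "0 \<le> c * d" "c * d \<le> g" using le c True by (auto simp: abs_of_nonneg)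
        then show ?thesis using E[of x] E[of y] by (auto simp: g_def abs_le_iff)
      next
        case False
        then have "d \<le> 0" unfolding d_def g using theta_le[of "z1 y - z1 x" "z2 y - z2 x"] by simp
        then have "c * d \<le> 0" "g \<le> c * d" using le c False
          by (auto simp: abs_of_nonpos mult_nonneg_nonpos)
        then show ?thesis using E[of x] E[of y] by (auto simp: g_def abs_le_iff)
      qed
      ultimately show ?thesis using f by linarith
    qed
  qed
  moreover have "f \<in> borel_measurable M"
    unfolding f_def using i by measurable
  ultimately show ?thesis by (auto intro: abs_integral_le)
qed

text \<open>
  The scheme of \<open>euler\<close> for a general \<open>\<theta>\<close>, given by its step lengths instead of its grid points.
\<close>

primrec eul :: "('a \<Rightarrow> 'a \<Rightarrow> real) \<Rightarrow> ('a \<Rightarrow> real) \<Rightarrow> (nat \<Rightarrow> real) \<Rightarrow> nat \<Rightarrow> 'a \<Rightarrow> real" where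
  "eul k g \<sigma> 0 = g"
| "eul k g \<sigma> (Suc h) = (\<lambda>x. eul k g \<sigma> h x + \<sigma> h * F k (eul k g \<sigma> h) x)"

lemma eul_meas:
  assumes "sym_kernel k \<kappa>" "g \<in> borel_measurable M"
  shows "eul k g \<sigma> h \<in> borel_measurable M"
proof (induction h)
  case (Suc h)
  note [measurable] = Suc F_meas[OF assms(1) Suc]
  show ?case by simp
qed (simp add: assms)

text \<open>
  The zero function is a stationary state of the scheme, so the comparison \<open>explicit_step_sup\<close> with it bounds
  the iterates.
\<close>

lemma eul_bound:
  assumes k: "sym_kernel k \<kappa>" and g: "g \<in> borel_measurable M" "\<And>x. \<bar>g x\<bar> \<le> G"
    and r: "\<And>a b. \<bar>a - b\<bar> < r \<Longrightarrow> \<bar>\<theta> a - \<theta> b\<bar> \<le> \<delta>" and \<delta>: "0 \<le> \<delta>"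
    and small: "\<And>i. i < h \<Longrightarrow> 0 \<le> \<sigma> i \<and> \<sigma> i * \<kappa> * (2 * B) \<le> r"
  shows "\<bar>eul k g \<sigma> h x\<bar> \<le> G + (\<Sum>i<h. \<sigma> i) * \<kappa> * \<delta>"
  using small
proof (induction h arbitrary: x)
  case (Suc h)
  have "\<bar>eul k g \<sigma> h x - 0 + \<sigma> h * (F k (eul k g \<sigma> h) x - F k (\<lambda>_. 0) x)\<bar>
      \<le> (G + (\<Sum>i<h. \<sigma> i) * \<kappa> * \<delta>) + \<sigma> h * \<kappa> * \<delta>"
    using Suc.prems[of h]
    by (intro explicit_step_sup[OF k eul_meas[OF k g(1)] _ _ _ r \<delta>]) (use Suc in auto)
  then show ?case by (simp add: algebra_simps)
qed (simp add: g)

end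

section \<open>Bounded solutions as limits of explicit Euler steps\<close>

lemma abs_sum_le:
  fixes a b :: real
  shows "\<bar>a\<bar> \<le> A \<Longrightarrow> \<bar>b\<bar> \<le> C \<Longrightarrow> x = a + b \<Longrightarrow> A + C \<le> y \<Longrightarrow> \<bar>x\<bar> \<le> y"
  by linarith

context flux
begin

lemma F_tendsto:
  assumes k: "sym_kernel k \<kappa>" and meas: "\<And>n. Z n \<in> borel_measurable M" "z \<in> borel_measurable M"
    and lim: "\<And>x. (\<lambda>n. Z n x) \<longlonglongrightarrow> z x"
  shows "(\<lambda>n. F k (Z n) x) \<longlonglongrightarrow> F k z x"
  unfolding F_def
proof (rule integral_dominated_convergence[where w="\<lambda>_. \<kappa> * B"])
  show "AE y in M. (\<lambda>n. k x y * \<theta> (Z n y - Z n x)) \<longlonglongrightarrow> k x y * \<theta> (z y - z x)"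
    by (intro AE_I2 tendsto_intros isCont_tendsto_compose[OF theta_isCont] lim)
  show "AE y in M. norm (k x y * \<theta> (Z n y - Z n x)) \<le> \<kappa> * B" for n
    using flux_integrand_bound[OF k] by simp
qed (use flux_integrand_section[OF k meas(1)] flux_integrand_section[OF k meas(2)] in auto)

definition step_fun :: "('a \<Rightarrow> 'a \<Rightarrow> real) \<Rightarrow> ('a \<Rightarrow> real) \<Rightarrow> nat \<Rightarrow> real \<Rightarrow> 'a \<Rightarrow> real" where
  "step_fun k g n t = eul k g (\<lambda>_. 1 / real n) (nat \<lfloor>real n * t\<rfloor>)"

lemma uniform_eul_increment:
  assumes k: "sym_kernel k \<kappa>" and g: "g \<in> borel_measurable M" and "i \<le> j"
  shows "\<bar>eul k g (\<lambda>_. 1 / real n) j x - eul k g (\<lambda>_. 1 / real n) i x\<bar> \<le> \<kappa> * B * (real (j - i) / real n)"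
  using \<open>i \<le> j\<close>
proof (induction j rule: dec_induct)
  case (step j)
  have "\<bar>1 / real n * F k (eul k g (\<lambda>_. 1 / real n) j) x\<bar> \<le> 1 / real n * (\<kappa> * B)"
    using F_bound[OF k eul_meas[OF k g], of "\<lambda>_. 1 / real n" j x]
    unfolding abs_mult by (intro mult_mono) auto
  moreover have "\<kappa> * B * (real (Suc j - i) / real n) = \<kappa> * B * (real (j - i) / real n) + 1 / real n * (\<kappa> * B)"
  proof -
    have "real (Suc j - i) = real (j - i) + 1" using step by (simp add: Suc_diff_le)
    moreover have "\<kappa> * B * ((d + 1) / real n) = \<kappa> * B * (d / real n) + 1 / real n * (\<kappa> * B)" for d
      by (simp add: add_divide_distrib algebra_simps)
    ultimately show ?thesis by (simp only:)
  qed
  ultimately show ?case using step.IH unfolding eul.simps by linarith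
qed simp

text \<open>
  In a short time the iterates hardly move (\<open>uniform_eul_increment\<close>), and neither does the flux. So many
  fine steps amount to nearly one coarse step.
\<close>

lemma uniform_eul_approx:
  assumes k: "sym_kernel k \<kappa>" and g: "g \<in> borel_measurable M" and "i \<le> j"
    and r: "\<And>a b. \<bar>a - b\<bar> < r \<Longrightarrow> \<bar>\<theta> a - \<theta> b\<bar> \<le> \<delta>"
    and small: "2 * \<kappa> * B * (real (j - i) / real n) < r"
  shows "\<bar>eul k g (\<lambda>_. 1 / real n) j x - eul k g (\<lambda>_. 1 / real n) i x
           - real (j - i) / real n * F k (eul k g (\<lambda>_. 1 / real n) i) x\<bar> \<le> \<kappa> * \<delta> * (real (j - i) / real n)"
  using \<open>i \<le> j\<close> small
proof (induction j rule: dec_induct)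
  case (step j)
  let ?e = "eul k g (\<lambda>_. 1 / real n)"
  have le: "2 * \<kappa> * B * (real (j - i) / real n) \<le> 2 * \<kappa> * B * (real (Suc j - i) / real n)"
    using sym_kernel_const[OF k] B_nonneg step by (intro mult_left_mono divide_right_mono) auto
  then have sm: "2 * \<kappa> * B * (real (j - i) / real n) < r" using step.prems by simp
  have "\<bar>F k (?e j) x - F k (?e i) x\<bar> \<le> \<kappa> * \<delta>"
  proof (rule F_close[OF k eul_meas[OF k g] eul_meas[OF k g] r])
    show "\<bar>?e j x - ?e i x\<bar> < r / 2" for x
      using uniform_eul_increment[OF k g, of i j n x] step sm by simp
  qed
  then have inc: "\<bar>1 / real n * (F k (?e j) x - F k (?e i) x)\<bar> \<le> 1 / real n * (\<kappa> * \<delta>)"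
    unfolding abs_mult by (intro mult_mono) auto
  have j: "real (Suc j - i) = real (j - i) + 1" using step by (simp add: Suc_diff_le)
  have eq: "?e (Suc j) x - ?e i x - (d + 1) / real n * F k (?e i) x
      = (?e j x - ?e i x - d / real n * F k (?e i) x) + 1 / real n * (F k (?e j) x - F k (?e i) x)"
    "\<kappa> * \<delta> * ((d + 1) / real n) = \<kappa> * \<delta> * (d / real n) + 1 / real n * (\<kappa> * \<delta>)" for d
    by (simp_all add: algebra_simps add_divide_distrib)
  show ?case unfolding j by (rule abs_sum_le[OF step.IH[OF sm] inc eq(1)]) (simp only: eq(2))
qed simp

lemma floor_gap:
  assumes "n > 0" "0 \<le> s" "s \<le> t"
  defines "i \<equiv> nat \<lfloor>real n * s\<rfloor>" and "j \<equiv> nat \<lfloor>real n * t\<rfloor>"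
  shows "i \<le> j" "\<bar>real (j - i) / real n - (t - s)\<bar> \<le> 1 / real n"
proof -
  show ij: "i \<le> j" using assms by (auto intro!: nat_mono floor_mono mult_left_mono)
  have "real i = of_int \<lfloor>real n * s\<rfloor>" "real j = of_int \<lfloor>real n * t\<rfloor>"
    using assms by (auto simp: i_def j_def)
  then have "real i \<le> real n * s" "real n * s < real i + 1" "real j \<le> real n * t" "real n * t < real j + 1"
    by linarith+
  then have "\<bar>real (j - i) - real n * (t - s)\<bar> \<le> 1"
    using ij by (simp add: of_nat_diff algebra_simps abs_le_iff)
  moreover have "real (j - i) / real n - (t - s) = (real (j - i) - real n * (t - s)) / real n"
    using \<open>n > 0\<close> by (simp add: field_simps)
  ultimately show "\<bar>real (j - i) / real n - (t - s)\<bar> \<le> 1 / real n"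
    using \<open>n > 0\<close> by (simp add: divide_right_mono)
qed

lemma step_fun_meas:
  assumes "sym_kernel k \<kappa>" "g \<in> borel_measurable M"
  shows "step_fun k g n t \<in> borel_measurable M"
  unfolding step_fun_def by (rule eul_meas[OF assms])

lemma step_fun_approx:
  assumes k: "sym_kernel k \<kappa>" and g: "g \<in> borel_measurable M" and n: "n > 0" and st: "0 \<le> s" "s \<le> t"
    and r: "\<And>a b. \<bar>a - b\<bar> < r \<Longrightarrow> \<bar>\<theta> a - \<theta> b\<bar> \<le> \<delta>" and \<delta>: "0 \<le> \<delta>"
    and small: "2 * \<kappa> * B * (t - s + 1 / real n) < r"
  shows "\<bar>step_fun k g n t x - step_fun k g n s x - (t - s) * F k (step_fun k g n s) x\<bar>
     \<le> \<kappa> * \<delta> * (t - s + 1 / real n) + \<kappa> * B / real n"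
proof -
  define i where "i = nat \<lfloor>real n * s\<rfloor>"
  define j where "j = nat \<lfloor>real n * t\<rfloor>"
  define q where "q = real (j - i) / real n"
  have ij: "i \<le> j" and q: "\<bar>q - (t - s)\<bar> \<le> 1 / real n"
    using floor_gap[OF n st] by (auto simp: i_def j_def q_def)
  then have q_le: "q \<le> t - s + 1 / real n" by linarith
  have "2 * \<kappa> * B * q \<le> 2 * \<kappa> * B * (t - s + 1 / real n)"
    using q_le sym_kernel_const[OF k] B_nonneg by (intro mult_left_mono) auto
  then have sm: "2 * \<kappa> * B * q < r" using small by linarith
  let ?f = "F k (step_fun k g n s) x"
  have 1: "\<bar>step_fun k g n t x - step_fun k g n s x - q * ?f\<bar> \<le> \<kappa> * \<delta> * q"
    using uniform_eul_approx[OF k g ij r sm[unfolded q_def], of x]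
    by (simp add: step_fun_def i_def j_def q_def)
  have 2: "\<bar>(q - (t - s)) * ?f\<bar> \<le> 1 / real n * (\<kappa> * B)"
    unfolding abs_mult using q F_bound[OF k step_fun_meas[OF k g]] by (intro mult_mono) auto
  have 3: "\<kappa> * \<delta> * q \<le> \<kappa> * \<delta> * (t - s + 1 / real n)"
    using q_le sym_kernel_const[OF k] \<delta> by (intro mult_left_mono) auto
  have 4: "step_fun k g n t x - step_fun k g n s x - (t - s) * ?f
      = (step_fun k g n t x - step_fun k g n s x - q * ?f) + (q - (t - s)) * ?f"
    by (simp add: algebra_simps)
  show ?thesis by (rule abs_sum_le[OF 1 2 4]) (use 3 in simp)
qed

text \<open>
  Two sequences that nearly follow the same coarse scheme stay close. It is applied to the step functions
  of two different fine schemes, sampled on one coarse grid.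
\<close>

lemma approximate_grid_compare:
  assumes k: "sym_kernel k \<kappa>" and meas: "\<And>m. a m \<in> borel_measurable M" "\<And>m. b m \<in> borel_measurable M"
    and E: "\<And>x. \<bar>a 0 x - b 0 x\<bar> \<le> E"
    and a: "\<And>m x. m < N \<Longrightarrow> \<bar>a (Suc m) x - a m x - \<sigma> * F k (a m) x\<bar> \<le> \<gamma>1"
    and b: "\<And>m x. m < N \<Longrightarrow> \<bar>b (Suc m) x - b m x - \<sigma> * F k (b m) x\<bar> \<le> \<gamma>2"
    and r: "\<And>a b. \<bar>a - b\<bar> < r \<Longrightarrow> \<bar>\<theta> a - \<theta> b\<bar> \<le> \<delta>" and \<delta>: "0 \<le> \<delta>"
    and \<sigma>: "0 \<le> \<sigma>" "\<sigma> * \<kappa> * (2 * B) \<le> r" and "m \<le> N"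
  shows "\<bar>a m x - b m x\<bar> \<le> E + real m * (\<sigma> * \<kappa> * \<delta> + \<gamma>1 + \<gamma>2)"
  using \<open>m \<le> N\<close>
proof (induction m arbitrary: x)
  case (Suc m)
  have "\<bar>a m x - b m x + \<sigma> * (F k (a m) x - F k (b m) x)\<bar>
      \<le> E + real m * (\<sigma> * \<kappa> * \<delta> + \<gamma>1 + \<gamma>2) + \<sigma> * \<kappa> * \<delta>"
    using Suc by (intro explicit_step_sup[OF k meas(1) meas(2) _ \<sigma>(1) r \<delta> \<sigma>(2)]) auto
  then show ?case using a[of m x] b[of m x] Suc.prems by (simp add: algebra_simps abs_le_iff)
qed (simp add: E)

lemma step_fun_nonpos: "t \<le> 0 \<Longrightarrow> step_fun k g n t = g"
proof -
  assume "t \<le> 0"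
  then have "real n * t \<le> 0" by (simp add: mult_nonneg_nonpos)
  then have "nat \<lfloor>real n * t\<rfloor> = 0" by simp
  then show ?thesis by (simp add: step_fun_def)
qed

text \<open>
  A coarse grid of \<open>K\<close> steps of length \<open>\<sigma>\<close> is fixed first, and both fine step functions follow
  the coarse scheme up to an error that vanishes with the fine step. What is left of the
  coarse comparison is \<open>3 * (t * \<kappa> * \<delta>)\<close>, where \<open>\<delta>\<close> can be chosen in advance.
\<close>

lemma step_fun_Cauchy:
  assumes k: "sym_kernel k \<kappa>" and g: "g \<in> borel_measurable M"
  shows "Cauchy (\<lambda>n. step_fun k g n t x)"
proof (cases "t \<le> 0")
  case True
  then show ?thesis by (simp add: step_fun_nonpos Cauchy_def)
next
  case False
  then have t: "t > 0" by simp
  have \<kappa>: "0 \<le> \<kappa>" by (rule sym_kernel_const[OF k])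
  show ?thesis
  proof (rule metric_CauchyI)
    fix \<epsilon> :: real assume "0 < \<epsilon>"
    define P where "P = (\<kappa> + 1) * (t + 1)"
    have P: "P > 0" using \<kappa> t by (simp add: P_def)
    define \<delta> where "\<delta> = \<epsilon> / (8 * P)"
    have \<delta>: "\<delta> > 0" using \<open>0 < \<epsilon>\<close> P by (simp add: \<delta>_def)
    have "t * \<kappa> \<le> P" using \<kappa> t by (simp add: P_def algebra_simps)
    then have "8 * (t * \<kappa> * \<delta>) \<le> 8 * (P * \<delta>)" using \<delta> by simp
    also have "\<dots> = \<epsilon>" using P by (simp add: \<delta>_def)
    finally have \<delta>_small: "8 * (t * \<kappa> * \<delta>) \<le> \<epsilon>" .
    obtain r where "r > 0" and r: "\<And>a b. \<bar>a - b\<bar> < r \<Longrightarrow> \<bar>\<theta> a - \<theta> b\<bar> \<le> \<delta>"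
      using theta_modulus[OF \<delta>] by blast
    obtain K :: nat where K: "real K > t * (2 * \<kappa> * B) / (r / 2)" "K > 0"
      by (metis gr0I of_nat_0_less_iff reals_Archimedean2 dual_order.strict_trans less_le_not_le linorder_not_less max.strict_boundedE)
    define \<sigma> where "\<sigma> = t / real K"
    have \<sigma>: "\<sigma> > 0" using t K by (simp add: \<sigma>_def)
    have \<sigma>_r: "2 * \<kappa> * B * \<sigma> < r / 2"
      using K \<open>r > 0\<close> t by (simp add: \<sigma>_def field_simps)
    \<comment> \<open>For fine steps shorter than \<open>1 / Q\<close>, which depends on the coarse grid, the deviations from the coarse scheme are negligible.\<close>
    define Q where "Q = 2 * \<kappa> * B / (r / 2) + 2 * real K * (\<kappa> * \<delta> + \<kappa> * B) / (\<epsilon> / 4)"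
    have Q: "2 * \<kappa> * B / (r / 2) \<le> Q" "2 * real K * (\<kappa> * \<delta> + \<kappa> * B) / (\<epsilon> / 4) \<le> Q"
      using \<kappa> B_nonneg \<delta> \<open>r > 0\<close> \<open>0 < \<epsilon>\<close> by (simp_all add: Q_def)
    obtain N :: nat where N: "real N > Q" "N > 0"
      by (metis gr0I of_nat_0_less_iff reals_Archimedean2 dual_order.strict_trans less_le_not_le linorder_not_less max.strict_boundedE)
    have big: "2 * \<kappa> * B * (1 / real n) < r / 2" "2 * real K * (\<kappa> * \<delta> + \<kappa> * B) * (1 / real n) < \<epsilon> / 4" "n > 0"
      if "n \<ge> N" for n
    proof -
      have n: "real n > Q" "n > 0" using that N by linarith+
      have lt: "2 * \<kappa> * B / (r / 2) < real n" "2 * real K * (\<kappa> * \<delta> + \<kappa> * B) / (\<epsilon> / 4) < real n"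
        using Q n by linarith+
      show "n > 0" "2 * \<kappa> * B * (1 / real n) < r / 2"
        "2 * real K * (\<kappa> * \<delta> + \<kappa> * B) * (1 / real n) < \<epsilon> / 4"
        using lt n \<open>r > 0\<close> \<open>0 < \<epsilon>\<close> by (simp_all add: divide_less_eq mult.commute)
    qed
    define X where "X n = 2 * real K * (\<kappa> * \<delta> + \<kappa> * B) * (1 / real n)" for n :: nat
    define \<gamma> where "\<gamma> n = \<kappa> * \<delta> * (\<sigma> + 1 / real n) + \<kappa> * B / real n" for n :: nat
    have apx: "\<bar>step_fun k g n (real (Suc m) * \<sigma>) x - step_fun k g n (real m * \<sigma>) x
        - \<sigma> * F k (step_fun k g n (real m * \<sigma>)) x\<bar> \<le> \<gamma> n" if "n \<ge> N" for n m x
    proof -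
      have "2 * \<kappa> * B * (\<sigma> + 1 / real n) < r"
        using big(1)[OF that] \<sigma>_r by (simp add: distrib_left)
      then show ?thesis
        using step_fun_approx[OF k g big(3)[OF that], of "real m * \<sigma>" "real (Suc m) * \<sigma>" r \<delta> x] r \<delta> \<sigma>
        by (simp add: \<gamma>_def algebra_simps)
    qed
    show "\<exists>N. \<forall>m\<ge>N. \<forall>n\<ge>N. dist (step_fun k g m t x) (step_fun k g n t x) < \<epsilon>"
    proof (intro exI allI impI)
      fix n n' assume nn: "n \<ge> N" "n' \<ge> N"
      have Kt: "real K * \<sigma> = t" using K by (simp add: \<sigma>_def)
      have "\<bar>step_fun k g n (real K * \<sigma>) x - step_fun k g n' (real K * \<sigma>) x\<bar>
          \<le> 0 + real K * (\<sigma> * \<kappa> * \<delta> + \<gamma> n + \<gamma> n')"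
      proof (rule approximate_grid_compare[where r=r and N=K, OF k])
        show "\<sigma> * \<kappa> * (2 * B) \<le> r" using \<sigma>_r \<open>r > 0\<close> by (simp add: algebra_simps)
      qed (use apx nn r \<delta> \<sigma> step_fun_meas[OF k g] in \<open>auto simp: step_fun_nonpos\<close>)
      also have "\<dots> = 3 * (t * \<kappa> * \<delta>) + X n / 2 + X n' / 2"
        unfolding \<gamma>_def Kt[symmetric] X_def by (simp add: algebra_simps add_divide_distrib)
      also have "\<dots> < \<epsilon>"
        using \<delta>_small big(2)[OF nn(1), folded X_def] big(2)[OF nn(2), folded X_def] \<open>0 < \<epsilon>\<close> by linarith
      finally show "dist (step_fun k g n t x) (step_fun k g n' t x) < \<epsilon>"
        by (simp add: Kt dist_real_def)
    qed
  qed
qed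

definition sol :: "('a \<Rightarrow> 'a \<Rightarrow> real) \<Rightarrow> ('a \<Rightarrow> real) \<Rightarrow> real \<Rightarrow> 'a \<Rightarrow> real" where
  "sol k g t x = lim (\<lambda>n. step_fun k g n t x)"

lemma sol_LIMSEQ:
  assumes "sym_kernel k \<kappa>" "g \<in> borel_measurable M"
  shows "(\<lambda>n. step_fun k g n t x) \<longlonglongrightarrow> sol k g t x"
  unfolding sol_def using step_fun_Cauchy[OF assms]
  by (simp add: Cauchy_convergent_iff convergent_LIMSEQ_iff)

lemma sol_nonpos: "t \<le> 0 \<Longrightarrow> sol k g t = g"
  by (rule ext) (simp add: sol_def step_fun_nonpos)

lemma sol_meas:
  assumes "sym_kernel k \<kappa>" "g \<in> borel_measurable M"
  shows "sol k g t \<in> borel_measurable M"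
  using sol_LIMSEQ[OF assms] step_fun_meas[OF assms] by (rule borel_measurable_LIMSEQ_real)

lemma sol_joint_meas:
  assumes kg: "sym_kernel k \<kappa>" "g \<in> borel_measurable M"
  shows "(\<lambda>(t, x). sol k g t x) \<in> borel_measurable (borel \<Otimes>\<^sub>M M)"
proof -
  note [measurable] = eul_meas[OF kg]
  have "(\<lambda>p. step_fun k g n (fst p) (snd p)) \<in> borel_measurable (borel \<Otimes>\<^sub>M M)" for n
    unfolding step_fun_def
    by (rule measurable_compose_countable[where f="\<lambda>i p. eul k g (\<lambda>_. 1 / real n) i (snd p)"]) measurable
  then show ?thesis
    unfolding split_beta by (intro borel_measurable_LIMSEQ_real[OF sol_LIMSEQ[OF kg]])
qed

lemma sol_approx:
  assumes k: "sym_kernel k \<kappa>" and g: "g \<in> borel_measurable M" and st: "0 \<le> s" "s \<le> t"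
    and r: "\<And>a b. \<bar>a - b\<bar> < r \<Longrightarrow> \<bar>\<theta> a - \<theta> b\<bar> \<le> \<delta>" and \<delta>: "0 \<le> \<delta>"
    and small: "2 * \<kappa> * B * (t - s) < r"
  shows "\<bar>sol k g t x - sol k g s x - (t - s) * F k (sol k g s) x\<bar> \<le> \<kappa> * \<delta> * (t - s)"
proof (rule LIMSEQ_le)
  show "(\<lambda>n. \<bar>step_fun k g n t x - step_fun k g n s x - (t - s) * F k (step_fun k g n s) x\<bar>)
      \<longlonglongrightarrow> \<bar>sol k g t x - sol k g s x - (t - s) * F k (sol k g s) x\<bar>"
    by (intro tendsto_intros sol_LIMSEQ[OF k g] F_tendsto[OF k] step_fun_meas[OF k g] sol_meas[OF k g])
  have l: "(\<lambda>n. 1 / real n) \<longlonglongrightarrow> 0" by (rule lim_1_over_n)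
  have "(\<lambda>n. \<kappa> * \<delta> * (t - s + 1 / real n) + \<kappa> * B * (1 / real n)) \<longlonglongrightarrow> \<kappa> * \<delta> * (t - s + 0) + \<kappa> * B * 0"
    by (intro tendsto_intros l)
  then show "(\<lambda>n. \<kappa> * \<delta> * (t - s + 1 / real n) + \<kappa> * B / real n) \<longlonglongrightarrow> \<kappa> * \<delta> * (t - s)" by simp
  have "(\<lambda>n. 2 * \<kappa> * B * (t - s + 1 / real n)) \<longlonglongrightarrow> 2 * \<kappa> * B * (t - s + 0)"
    by (intro tendsto_intros l)
  then have "\<forall>\<^sub>F n in sequentially. 2 * \<kappa> * B * (t - s + 1 / real n) < r"
    using small by (intro order_tendstoD) auto
  then have "\<forall>\<^sub>F n in sequentially. 2 * \<kappa> * B * (t - s + 1 / real n) < r \<and> n > 0"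
    using eventually_gt_at_top by (rule eventually_conj)
  then obtain N where "\<And>n. n \<ge> N \<Longrightarrow> 2 * \<kappa> * B * (t - s + 1 / real n) < r \<and> n > 0"
    by (auto simp: eventually_sequentially)
  then show "\<exists>N. \<forall>n\<ge>N. \<bar>step_fun k g n t x - step_fun k g n s x - (t - s) * F k (step_fun k g n s) x\<bar>
      \<le> \<kappa> * \<delta> * (t - s + 1 / real n) + \<kappa> * B / real n"
    using step_fun_approx[OF k g _ st r \<delta>] by blast
qed

text \<open>
  The bound of \<open>eul_bound\<close> for the step functions tends to \<open>G\<close> as \<open>\<delta>\<close> does to \<open>0\<close>.
\<close>

lemma sol_bound:
  assumes k: "sym_kernel k \<kappa>" and g: "g \<in> borel_measurable M" and G: "\<And>x. \<bar>g x\<bar> \<le> G"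
  shows "\<bar>sol k g t x\<bar> \<le> G"
proof (cases "t \<le> 0")
  case True
  then show ?thesis by (simp add: sol_nonpos G)
next
  case False
  have "\<bar>sol k g t x\<bar> \<le> G + t * \<kappa> * \<delta>" if \<delta>: "\<delta> > 0" for \<delta>
  proof -
    obtain r where "r > 0" and r: "\<And>a b. \<bar>a - b\<bar> < r \<Longrightarrow> \<bar>\<theta> a - \<theta> b\<bar> \<le> \<delta>"
      using theta_modulus[OF \<delta>] by blast
    have "(\<lambda>n. 1 / real n * \<kappa> * (2 * B)) \<longlonglongrightarrow> 0 * \<kappa> * (2 * B)"
      by (intro tendsto_intros lim_1_over_n)
    then have "\<forall>\<^sub>F n in sequentially. 1 / real n * \<kappa> * (2 * B) < r"
      using \<open>r > 0\<close> by (intro order_tendstoD) auto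
    then have "\<forall>\<^sub>F n in sequentially. \<bar>step_fun k g n t x\<bar> \<le> G + t * \<kappa> * \<delta>"
      using eventually_gt_at_top[of 0]
    proof eventually_elim
      case (elim n)
      let ?m = "nat \<lfloor>real n * t\<rfloor>"
      have "\<bar>step_fun k g n t x\<bar> \<le> G + (\<Sum>i<?m. 1 / real n) * \<kappa> * \<delta>"
        unfolding step_fun_def
        by (rule eul_bound[OF k g G r]) (use elim \<delta> in auto)
      moreover have "real ?m \<le> real n * t" using False by simp
      then have "(\<Sum>i<?m. 1 / real n) \<le> t" using elim by (simp add: field_simps)
      then have "(\<Sum>i<?m. 1 / real n) * \<kappa> * \<delta> \<le> t * \<kappa> * \<delta>"
        using \<delta> sym_kernel_const[OF k] by (intro mult_right_mono) auto
      ultimately show ?case by linarith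
    qed
    then show ?thesis
      using tendsto_upperbound[OF tendsto_rabs[OF sol_LIMSEQ[OF k g, of t x]]] by simp
  qed
  note le = this
  have "(\<lambda>n. G + t * \<kappa> * (1 / real (Suc n))) \<longlonglongrightarrow> G + t * \<kappa> * 0"
    by (intro tendsto_intros LIMSEQ_Suc[OF lim_1_over_n])
  then show ?thesis
    using le[of "1 / real (Suc _)"] by (intro LIMSEQ_le_const[of _ G "\<bar>sol k g t x\<bar>"]) (simp, auto)
qed

lemma sol_Lipschitz:
  assumes k: "sym_kernel k \<kappa>" and g: "g \<in> borel_measurable M" and st: "0 \<le> s" "s \<le> t"
  shows "\<bar>sol k g t x - sol k g s x\<bar> \<le> \<kappa> * B * (t - s)"
proof (rule LIMSEQ_le)
  show "(\<lambda>n. \<bar>step_fun k g n t x - step_fun k g n s x\<bar>) \<longlonglongrightarrow> \<bar>sol k g t x - sol k g s x\<bar>"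
    by (intro tendsto_intros sol_LIMSEQ[OF k g])
  have "(\<lambda>n. \<kappa> * B * (t - s + 1 / real n)) \<longlonglongrightarrow> \<kappa> * B * (t - s + 0)"
    by (intro tendsto_intros lim_1_over_n)
  then show "(\<lambda>n. \<kappa> * B * (t - s + 1 / real n)) \<longlonglongrightarrow> \<kappa> * B * (t - s)" by simp
  have "\<bar>step_fun k g n t x - step_fun k g n s x\<bar> \<le> \<kappa> * B * (t - s + 1 / real n)" if n: "n > 0" for n
  proof -
    have "\<kappa> * B * (real (nat \<lfloor>real n * t\<rfloor> - nat \<lfloor>real n * s\<rfloor>) / real n) \<le> \<kappa> * B * (t - s + 1 / real n)"
      using floor_gap(2)[OF n st] sym_kernel_const[OF k] B_nonneg
      by (intro mult_left_mono mult_nonneg_nonneg) linarith+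
    then show ?thesis
      using uniform_eul_increment[OF k g floor_gap(1)[OF n st], of n x] unfolding step_fun_def by linarith
  qed
  then show "\<exists>N. \<forall>n\<ge>N. \<bar>step_fun k g n t x - step_fun k g n s x\<bar> \<le> \<kappa> * B * (t - s + 1 / real n)"
    by (intro exI[of _ 1]) auto
qed

text \<open>
  The derivative exists at each single \<open>x\<close>: the remainder in \<open>sol_approx\<close> is \<open>\<kappa> * \<delta>\<close> per unit of time, for
  arbitrary \<open>\<delta>\<close>, and \<open>F\<close> is continuous along the solution.
\<close>

lemma sol_deriv:
  assumes k: "sym_kernel k \<kappa>" and g: "g \<in> borel_measurable M" and t: "0 \<le> t"
  shows "((\<lambda>t. sol k g t x) has_real_derivative F k (sol k g t) x) (at t within {0..})"
  unfolding has_field_derivative_iff tendsto_iff dist_real_def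
proof (intro allI impI)
  fix \<epsilon> :: real assume "0 < \<epsilon>"
  have \<kappa>: "0 \<le> \<kappa>" by (rule sym_kernel_const[OF k])
  define P where "P = \<kappa> + 1"
  have P: "P > 0" "\<kappa> \<le> P" using \<kappa> by (simp_all add: P_def)
  define \<delta> where "\<delta> = \<epsilon> / (4 * P)"
  have \<delta>: "\<delta> > 0" using \<open>0 < \<epsilon>\<close> P by (simp add: \<delta>_def)
  have \<delta>_small: "2 * (\<kappa> * \<delta>) < \<epsilon>"
  proof -
    have "2 * (\<kappa> * \<delta>) \<le> 2 * (P * \<delta>)" using \<delta> P by simp
    also have "\<dots> = \<epsilon> / 2" using P by (simp add: \<delta>_def)
    finally show ?thesis using \<open>0 < \<epsilon>\<close> by simp
  qed
  obtain r where "r > 0" and r: "\<And>a b. \<bar>a - b\<bar> < r \<Longrightarrow> \<bar>\<theta> a - \<theta> b\<bar> \<le> \<delta>"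
    using theta_modulus[OF \<delta>] by blast
  define d where "d = r / (2 * \<kappa> * B + 1)"
  have pos: "0 \<le> 2 * \<kappa> * B" using \<kappa> B_nonneg by simp
  then have pos1: "2 * \<kappa> * B + 1 > 0" by linarith
  then have d0: "d > 0" using \<open>r > 0\<close> unfolding d_def by (rule divide_pos_pos[rotated])
  moreover have "(2 * \<kappa> * B + 1) * d = r" using pos1 unfolding d_def by (metis less_irrefl nonzero_mult_div_cancel_left times_divide_eq_right)
  then have "2 * \<kappa> * B * d < r" using d0 by (simp add: distrib_right)
  ultimately have d: "d > 0" "2 * \<kappa> * B * d < r" by simp_all
  have ap: "\<bar>sol k g s' x - sol k g s x - (s' - s) * F k (sol k g s) x\<bar> \<le> \<kappa> * \<delta> * (s' - s)"
    and Fc: "\<bar>F k (sol k g s') x - F k (sol k g s) x\<bar> \<le> \<kappa> * \<delta>"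
    if s: "0 \<le> s" "s \<le> s'" "s' - s < d" for s s'
  proof -
    have "2 * \<kappa> * B * (s' - s) \<le> 2 * \<kappa> * B * d"
      using s \<kappa> B_nonneg by (intro mult_left_mono) auto
    then have sm: "2 * \<kappa> * B * (s' - s) < r" using d by simp
    then show "\<bar>sol k g s' x - sol k g s x - (s' - s) * F k (sol k g s) x\<bar> \<le> \<kappa> * \<delta> * (s' - s)"
      using s \<delta> by (intro sol_approx[OF k g _ _ r]) auto
    have "\<bar>sol k g s' y - sol k g s y\<bar> < r / 2" for y
      using sol_Lipschitz[OF k g s(1,2), of y] sm by simp
    then show "\<bar>F k (sol k g s') x - F k (sol k g s) x\<bar> \<le> \<kappa> * \<delta>"
      by (intro F_close[OF k sol_meas[OF k g] sol_meas[OF k g] r])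
  qed
  have quot: "\<bar>(sol k g s x - sol k g t x) / (s - t) - F k (sol k g t) x\<bar> < \<epsilon>"
    if s: "s \<ge> 0" "s \<noteq> t" "\<bar>s - t\<bar> < d" for s
  proof -
    have "\<bar>sol k g s x - sol k g t x - (s - t) * F k (sol k g t) x\<bar> \<le> 2 * (\<kappa> * \<delta>) * \<bar>s - t\<bar>"
    proof (cases "s > t")
      case True
      then have "\<bar>sol k g s x - sol k g t x - (s - t) * F k (sol k g t) x\<bar> \<le> \<kappa> * \<delta> * (s - t)"
        using ap[of t s] t s by simp
      moreover have "0 \<le> \<kappa> * \<delta> * (s - t)" using True \<kappa> \<delta> by simp
      ultimately show ?thesis using True by (simp add: algebra_simps)
    next
      case False
      then have st: "s \<le> t" by simp
      have 1: "\<bar>sol k g t x - sol k g s x - (t - s) * F k (sol k g s) x\<bar> \<le> \<kappa> * \<delta> * (t - s)"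
        using ap[of s t] st s by simp
      have "\<bar>(t - s) * (F k (sol k g t) x - F k (sol k g s) x)\<bar> \<le> (t - s) * (\<kappa> * \<delta>)"
        using Fc[of s t] st s unfolding abs_mult by (intro mult_mono) auto
      then show ?thesis using 1 st by (simp add: algebra_simps abs_le_iff)
    qed
    also have "\<dots> < \<epsilon> * \<bar>s - t\<bar>" using \<delta>_small s by simp
    finally have "\<bar>sol k g s x - sol k g t x - (s - t) * F k (sol k g t) x\<bar> / \<bar>s - t\<bar> < \<epsilon>"
      using s by (simp add: divide_less_eq)
    moreover have "(sol k g s x - sol k g t x) / (s - t) - F k (sol k g t) x
        = (sol k g s x - sol k g t x - (s - t) * F k (sol k g t) x) / (s - t)"
      using s by (simp add: field_simps)
    ultimately show ?thesis by simp
  qed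
  show "\<forall>\<^sub>F s in at t within {0..}. \<bar>(sol k g s x - sol k g t x) / (s - t) - F k (sol k g t) x\<bar> < \<epsilon>"
    unfolding eventually_at using d quot by (auto simp: dist_real_def intro!: exI[of _ d])
qed

end

section \<open>Dissipation along the gradient flow\<close>

lemma abs_square_le: "\<bar>x\<bar> \<le> c \<Longrightarrow> \<bar>x\<^sup>2\<bar> \<le> c\<^sup>2" for x :: real
  using power_mono[of "\<bar>x\<bar>" c 2] by simp

abbreviation time_measure :: "real \<Rightarrow> real \<Rightarrow> real measure" where
  "time_measure s t \<equiv> density lborel (indicator {s..t})"

lemma finite_time_measure: "finite_measure (time_measure s t)"
  by (rule finite_measureI) (simp add: emeasure_density emeasure_lborel_Icc_eq)

lemma time_integrable:
  assumes "f \<in> borel_measurable borel" "\<And>r. \<bar>f r\<bar> \<le> (C::real)"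
  shows "integrable (time_measure s t) f"
  using assms by (intro finite_measure.integrable_const_bound[OF finite_time_measure, where B=C]) auto

lemma time_integral:
  assumes f: "f \<in> borel_measurable borel" "\<And>r. \<bar>f r\<bar> \<le> (C::real)"
  shows "f integrable_on {s..t}" "(LINT r|time_measure s t. f r) = integral {s..t} f"
proof -
  have "integrable (density lborel (\<lambda>x. ennreal (indicator {s..t} x))) f"
    using time_integrable[OF f] by (simp add: ennreal_indicator)
  then have "set_integrable lborel {s..t} f"
    unfolding set_integrable_def using f by (subst (asm) integrable_density) auto
  note * = set_borel_integral_eq_integral[OF this]
  show "f integrable_on {s..t}" by (rule *)
  have "(LINT r|density lborel (\<lambda>x. ennreal (indicator {s..t} x)). f r) = (LINT r:{s..t}|lborel. f r)"
    unfolding set_lebesgue_integral_def using f by (subst integral_density) auto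
  then show "(LINT r|time_measure s t. f r) = integral {s..t} f"
    using *(2) by (simp add: ennreal_indicator)
qed

text \<open>
  By the mean value theorem \<open>C\<close> bounds the difference quotients, so dominated convergence applies.
\<close>

lemma (in prob_space) has_derivative_expectation:
  fixes h h' :: "real \<Rightarrow> 'a \<Rightarrow> real"
  assumes meas: "\<And>t. t \<in> S \<Longrightarrow> h t \<in> borel_measurable M" "\<And>t. t \<in> S \<Longrightarrow> h' t \<in> borel_measurable M"
    and int: "\<And>t. t \<in> S \<Longrightarrow> integrable M (h t)"
    and S: "convex S" and t: "t \<in> S"
    and der: "\<And>t x. t \<in> S \<Longrightarrow> ((\<lambda>t. h t x) has_real_derivative h' t x) (at t within S)"
    and bd: "\<And>t x. t \<in> S \<Longrightarrow> \<bar>h' t x\<bar> \<le> C"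
  shows "((\<lambda>t. LINT x|M. h t x) has_real_derivative (LINT x|M. h' t x)) (at t within S)"
  unfolding has_field_derivative_iff tendsto_at_iff_sequentially comp_def
proof (intro allI impI)
  fix X :: "nat \<Rightarrow> real" assume X: "\<forall>i. X i \<in> S - {t}" "X \<longlonglongrightarrow> t"
  have "(\<lambda>n. LINT x|M. (h (X n) x - h t x) / (X n - t)) \<longlonglongrightarrow> (LINT x|M. h' t x)"
  proof (rule integral_dominated_convergence[where w="\<lambda>_. C"])
    show "AE x in M. (\<lambda>n. (h (X n) x - h t x) / (X n - t)) \<longlonglongrightarrow> h' t x"
    proof (rule AE_I2)
      fix x
      have "((\<lambda>s. (h s x - h t x) / (s - t)) \<longlongrightarrow> h' t x) (at t within S)"
        using der[OF t, of x] by (simp add: has_field_derivative_iff)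
      then show "(\<lambda>n. (h (X n) x - h t x) / (X n - t)) \<longlonglongrightarrow> h' t x"
        using X unfolding tendsto_at_iff_sequentially comp_def by blast
    qed
    show "AE x in M. norm ((h (X n) x - h t x) / (X n - t)) \<le> C" for n
    proof (rule AE_I2)
      fix x
      have "norm (h (X n) x - h t x) \<le> C * norm (X n - t)"
        using X t bd by (intro field_differentiable_bound[OF S der]) auto
      then show "norm ((h (X n) x - h t x) / (X n - t)) \<le> C"
        using X by (auto simp: norm_divide divide_le_eq)
    qed
  qed (use meas X t in auto)
  moreover have "(LINT x|M. (h (X n) x - h t x) / (X n - t))
      = ((LINT x|M. h (X n) x) - (LINT x|M. h t x)) / (X n - t)" for n
    using int[of "X n"] int[OF t] X by simp
  ultimately show "(\<lambda>n. ((LINT x|M. h (X n) x) - (LINT x|M. h t x)) / (X n - t)) \<longlonglongrightarrow> (LINT x|M. h' t x)"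
    by (simp only:)
qed

lemma nonincreasing_of_deriv_within:
  fixes f :: "real \<Rightarrow> real"
  assumes "\<And>t. 0 \<le> t \<Longrightarrow> (f has_real_derivative f' t) (at t within {0..})"
    and "\<And>t. a \<le> t \<Longrightarrow> t \<le> b \<Longrightarrow> f' t \<le> 0" and "0 \<le> a" "a \<le> b"
  shows "f b \<le> f a"
proof (rule DERIV_nonpos_imp_decreasing_open[OF \<open>a \<le> b\<close>])
  fix t assume t: "a < t" "t < b"
  then have "at t within {0..} = at t" using assms(3)
    by (intro at_within_interior) (simp add: interior_real_atLeast)
  then show "\<exists>y. (f has_real_derivative y) (at t) \<and> y \<le> 0"
    using assms(1)[of t] assms(2)[of t] assms(3) t by auto
next
  have "continuous_on {0..} f"
    using assms(1) by (intro DERIV_continuous_on) auto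
  then show "continuous_on {a..b} f" by (rule continuous_on_subset) (use assms(3) in auto)
qed

context flux_space
begin

lemma iterated_integral:
  assumes "(\<lambda>p. f (fst p) (snd p)) \<in> borel_measurable (M \<Otimes>\<^sub>M M)" "\<And>x y. \<bar>f x y\<bar> \<le> (C::real)"
  shows "(LINT x|M. LINT y|M. f x y) = (LINT p|(M \<Otimes>\<^sub>M M). f (fst p) (snd p))"
  using sq.integral_fst'[OF integrable_sq_bounded[OF assms(1), of C]] assms(2) by simp

text \<open>
  Exchanging \<open>x\<close> and \<open>y\<close> in half of the double integral. All integrations by parts below are
  instances of this.
\<close>

lemma antisym_flux_integral:
  assumes f: "(\<lambda>p. f (fst p) (snd p)) \<in> borel_measurable (M \<Otimes>\<^sub>M M)" "\<And>x y. \<bar>f x y\<bar> \<le> (C::real)"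
    and anti: "\<And>x y. f y x = - f x y"
    and a: "a \<in> borel_measurable M" "\<And>x. \<bar>a x\<bar> \<le> A"
  shows "(LINT x|M. a x * (LINT y|M. f x y)) = (LINT p|(M \<Otimes>\<^sub>M M). (a (fst p) - a (snd p)) * f (fst p) (snd p)) / 2"
proof -
  note [measurable] = f(1) a(1)
  have bd: "\<bar>a x * f y z\<bar> \<le> A * C" for x y z
    using a(2)[of x] f(2)[of y z] by (auto simp: abs_mult intro!: mult_mono)
  have i1: "integrable (M \<Otimes>\<^sub>M M) (\<lambda>p. a (fst p) * f (fst p) (snd p))"
    by (rule integrable_sq_bounded[OF _ bd]) measurable
  have i2: "integrable (M \<Otimes>\<^sub>M M) (\<lambda>p. a (snd p) * f (fst p) (snd p))"
    by (rule integrable_sq_bounded[OF _ bd]) measurable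
  have "(LINT x|M. a x * (LINT y|M. f x y)) = (LINT x|M. LINT y|M. a x * f x y)"
    by simp
  also have "\<dots> = (LINT p|(M \<Otimes>\<^sub>M M). a (fst p) * f (fst p) (snd p))"
    by (rule iterated_integral[OF _ bd]) measurable
  finally have 1: "(LINT x|M. a x * (LINT y|M. f x y)) = (LINT p|(M \<Otimes>\<^sub>M M). a (fst p) * f (fst p) (snd p))" .
  define h where "h p = a (fst p) * f (fst p) (snd p)" for p
  have h: "h \<in> borel_measurable (M \<Otimes>\<^sub>M M)" unfolding h_def by measurable
  have "(LINT p|(M \<Otimes>\<^sub>M M). h p) = (LINT (x,y)|(M \<Otimes>\<^sub>M M). h (y, x))"
    by (rule sq.integral_product_swap[OF h, symmetric])
  also have "\<dots> = (LINT p|(M \<Otimes>\<^sub>M M). - (a (snd p) * f (fst p) (snd p)))"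
  proof (intro Bochner_Integration.integral_cong refl)
    fix p
    show "(case p of (x, y) \<Rightarrow> h (y, x)) = - (a (snd p) * f (fst p) (snd p))"
      using anti[of "fst p" "snd p"] by (simp add: h_def split_beta)
  qed
  finally have 2: "(LINT p|(M \<Otimes>\<^sub>M M). a (fst p) * f (fst p) (snd p)) = - (LINT p|(M \<Otimes>\<^sub>M M). a (snd p) * f (fst p) (snd p))"
    using i2 by (simp add: h_def)
  have "(LINT p|(M \<Otimes>\<^sub>M M). (a (fst p) - a (snd p)) * f (fst p) (snd p))
      = (LINT p|(M \<Otimes>\<^sub>M M). a (fst p) * f (fst p) (snd p)) - (LINT p|(M \<Otimes>\<^sub>M M). a (snd p) * f (fst p) (snd p))"
    using i1 i2 by (simp add: left_diff_distrib)
  then show ?thesis using 1 2 by simp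
qed

end

context flux
begin

lemma flux_pair_meas:
  assumes "sym_kernel k \<kappa>" and [measurable]: "z \<in> borel_measurable M"
  shows "(\<lambda>p. k (fst p) (snd p) * \<theta> (z (snd p) - z (fst p))) \<in> borel_measurable (M \<Otimes>\<^sub>M M)"
  using flux_integrand_meas[OF assms] by (simp add: split_beta)

lemma kernel_pair_meas: "sym_kernel k \<kappa> \<Longrightarrow> (\<lambda>p. k (fst p) (snd p)) \<in> borel_measurable (M \<Otimes>\<^sub>M M)"
  using sym_kernel_meas by (simp add: split_beta)

lemma F_test:
  assumes k: "sym_kernel k \<kappa>" and z: "z \<in> borel_measurable M" and a: "a \<in> borel_measurable M" "\<And>x. \<bar>a x\<bar> \<le> A"
  shows "(LINT x|M. a x * F k z x)
    = (LINT p|(M \<Otimes>\<^sub>M M). (a (fst p) - a (snd p)) * (k (fst p) (snd p) * \<theta> (z (snd p) - z (fst p)))) / 2"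
  unfolding F_def
proof (rule antisym_flux_integral[OF flux_pair_meas[OF k z] flux_integrand_bound[OF k] _ a])
  show "k y x * \<theta> (z x - z y) = - (k x y * \<theta> (z y - z x))" for x y
    using theta_odd[of "z y - z x"] sym_kernel_sym[OF k, of x y] by simp
qed

definition dissipation :: "('a \<Rightarrow> 'a \<Rightarrow> real) \<Rightarrow> ('a \<Rightarrow> real) \<Rightarrow> ('a \<Rightarrow> real) \<Rightarrow> real" where
  "dissipation k z1 z2 = (LINT p|(M \<Otimes>\<^sub>M M). k (fst p) (snd p) *
     ((\<theta> (z1 (snd p) - z1 (fst p)) - \<theta> (z2 (snd p) - z2 (fst p))) *
      ((z1 (snd p) - z1 (fst p)) - (z2 (snd p) - z2 (fst p)))))"

lemma theta_diff_mult_nonneg: "0 \<le> (\<theta> a - \<theta> b) * (a - b)"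
  using theta_le[of a b] theta_le[of b a] by (cases "a \<le> b") (auto simp: mult_nonpos_nonpos)

lemma dissipation_nonneg:
  assumes "sym_kernel k \<kappa>"
  shows "0 \<le> dissipation k z1 z2"
  unfolding dissipation_def using sym_kernel_bounds[OF assms]
  by (intro Bochner_Integration.integral_nonneg mult_nonneg_nonneg[OF _ theta_diff_mult_nonneg]) auto

text \<open>
  The right-hand side is monotone: the inner product on the left is nonpositive because \<open>dissipation\<close> is nonnegative.
\<close>

lemma F_dissipation:
  assumes k: "sym_kernel k \<kappa>" and z1: "z1 \<in> borel_measurable M" "\<And>x. \<bar>z1 x\<bar> \<le> G"
    and z2: "z2 \<in> borel_measurable M" "\<And>x. \<bar>z2 x\<bar> \<le> G"
  shows "(LINT x|M. (z1 x - z2 x) * (F k z1 x - F k z2 x)) = - dissipation k z1 z2 / 2"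
proof -
  note [measurable] = z1(1) z2(1) kernel_pair_meas[OF k] F_meas[OF k z1(1)] F_meas[OF k z2(1)]
  have bd: "\<bar>z1 x - z2 x\<bar> \<le> 2 * G" for x using z1(2)[of x] z2(2)[of x] by linarith
  have G: "0 \<le> G" using z1(2) order_trans abs_ge_zero by blast
  have bdF: "\<bar>(z1 x - z2 x) * F k z x\<bar> \<le> 2 * G * (\<kappa> * B)" if "z \<in> borel_measurable M" for x z
    using bd[of x] F_bound[OF k that, of x] G by (auto simp: abs_mult intro!: mult_mono)
  have ii: "integrable M (\<lambda>x. (z1 x - z2 x) * F k z1 x)" "integrable M (\<lambda>x. (z1 x - z2 x) * F k z2 x)"
    by (rule integrable_bounded[OF _ bdF]; measurable)+
  have bd2: "\<bar>((z1 x - z2 x) - (z1 y - z2 y)) * (k x y * \<theta> (z y - z x))\<bar> \<le> 4 * G * (\<kappa> * B)" for x y z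
    using bd[of x] bd[of y] flux_integrand_bound[OF k, of x y "z y - z x"] G
    unfolding abs_mult[of "(z1 x - z2 x) - (z1 y - z2 y)"] by (intro mult_mono) auto
  have jj: "integrable (M \<Otimes>\<^sub>M M) (\<lambda>p. ((z1 (fst p) - z2 (fst p)) - (z1 (snd p) - z2 (snd p))) *
      (k (fst p) (snd p) * \<theta> (z (snd p) - z (fst p))))" if [measurable]: "z \<in> borel_measurable M" for z
    by (rule integrable_sq_bounded[OF _ bd2]) measurable
  have "(LINT x|M. (z1 x - z2 x) * (F k z1 x - F k z2 x))
      = (LINT x|M. (z1 x - z2 x) * F k z1 x) - (LINT x|M. (z1 x - z2 x) * F k z2 x)"
    using ii by (simp add: right_diff_distrib)
  also have "\<dots> = (LINT p|(M \<Otimes>\<^sub>M M). ((z1 (fst p) - z2 (fst p)) - (z1 (snd p) - z2 (snd p))) *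
      (k (fst p) (snd p) * \<theta> (z1 (snd p) - z1 (fst p))) - ((z1 (fst p) - z2 (fst p)) - (z1 (snd p) - z2 (snd p))) *
      (k (fst p) (snd p) * \<theta> (z2 (snd p) - z2 (fst p)))) / 2"
    using F_test[OF k z1(1), of "\<lambda>x. z1 x - z2 x", OF _ bd] F_test[OF k z2(1), of "\<lambda>x. z1 x - z2 x", OF _ bd]
      jj[OF z1(1)] jj[OF z2(1)] by (simp add: diff_divide_distrib)
  also have "\<dots> = (LINT p|(M \<Otimes>\<^sub>M M). - (k (fst p) (snd p) *
     ((\<theta> (z1 (snd p) - z1 (fst p)) - \<theta> (z2 (snd p) - z2 (fst p))) *
      ((z1 (snd p) - z1 (fst p)) - (z2 (snd p) - z2 (fst p)))))) / 2"
    by (intro arg_cong[where f="\<lambda>x. x / 2"] Bochner_Integration.integral_cong) (auto simp: algebra_simps)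
  finally show ?thesis by (simp add: dissipation_def)
qed

definition square_norm :: "('a \<Rightarrow> real) \<Rightarrow> real" where
  "square_norm z = (LINT x|M. (z x)\<^sup>2)"

lemma square_norm_nonneg: "0 \<le> square_norm z"
  by (simp add: square_norm_def)

context
  fixes k :: "'a \<Rightarrow> 'a \<Rightarrow> real" and \<kappa> :: real and g :: "'a \<Rightarrow> real" and G :: real
  assumes k: "sym_kernel k \<kappa>" and g: "g \<in> borel_measurable M" "\<And>x. \<bar>g x\<bar> \<le> G"
begin

private abbreviation (input) "u \<equiv> sol k g"
private abbreviation (input) "v t \<equiv> F k (sol k g t)"

lemma u_meas: "u t \<in> borel_measurable M" by (rule sol_meas[OF k g(1)])
lemma v_meas: "v t \<in> borel_measurable M" by (rule F_meas[OF k u_meas])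
lemma u_bound: "\<bar>u t x\<bar> \<le> G" by (rule sol_bound[OF k g])
lemma v_bound: "\<bar>v t x\<bar> \<le> \<kappa> * B" by (rule F_bound[OF k u_meas])
lemma G_nonneg: "0 \<le> G" using g(2) order_trans abs_ge_zero by blast
lemma kB_nonneg: "0 \<le> \<kappa> * B" using sym_kernel_const[OF k] B_nonneg by simp

lemma u_deriv: "0 \<le> t \<Longrightarrow> ((\<lambda>t. u t x) has_real_derivative v t x) (at t within {0..})"
  by (rule sol_deriv[OF k g(1)])

lemma shift_deriv:
  assumes "0 \<le> \<eta>" "0 \<le> t"
  shows "((\<lambda>t. u (t + \<eta>) x) has_real_derivative v (t + \<eta>) x) (at t within {0..})"
proof -
  have 1: "((\<lambda>t. u t x) has_real_derivative v (t + \<eta>) x) (at (t + \<eta>) within (\<lambda>t. t + \<eta>) ` {0..})"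
    by (rule DERIV_subset[OF u_deriv]) (use assms in auto)
  have 2: "((\<lambda>t. t + \<eta>) has_real_derivative 1) (at t within {0..})"
    by (auto intro!: derivative_eq_intros)
  show ?thesis using DERIV_image_chain[OF 1 2] by (simp add: comp_def)
qed

text \<open>
  The flow contracts the $L^2$ distance of any two of its trajectories, here of \<open>u\<close> and of \<open>u\<close> started later.
\<close>

lemma shift_contraction:
  assumes \<eta>: "0 \<le> \<eta>" and st: "0 \<le> s" "s \<le> t"
  shows "square_norm (\<lambda>x. u (t + \<eta>) x - u t x) \<le> square_norm (\<lambda>x. u (s + \<eta>) x - u s x)"
proof -
  note [measurable] = u_meas v_meas
  define f' where "f' t = (LINT x|M. 2 * ((u (t + \<eta>) x - u t x) * (v (t + \<eta>) x - v t x)))" for t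
  have du: "\<bar>u (t + \<eta>) x - u t x\<bar> \<le> 2 * G" for t x
    using u_bound[of "t + \<eta>" x] u_bound[of t x] by linarith
  have dv: "\<bar>v (t + \<eta>) x - v t x\<bar> \<le> 2 * (\<kappa> * B)" for t x
    using v_bound[of "t + \<eta>" x] v_bound[of t x] by linarith
  have 1: "((\<lambda>t. square_norm (\<lambda>x. u (t + \<eta>) x - u t x)) has_real_derivative f' t) (at t within {0..})" if "0 \<le> t" for t
    unfolding square_norm_def f'_def
  proof (rule has_derivative_expectation[where C="2 * (2 * G * (2 * (\<kappa> * B)))"
        and h="\<lambda>t x. (u (t + \<eta>) x - u t x)\<^sup>2"
        and h'="\<lambda>t x. 2 * ((u (t + \<eta>) x - u t x) * (v (t + \<eta>) x - v t x))"])
    show "integrable M (\<lambda>x. (u (t + \<eta>) x - u t x)\<^sup>2)" for t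
    proof (rule integrable_bounded[where C="(2 * G)\<^sup>2"])
      show "\<bar>(u (t + \<eta>) x - u t x)\<^sup>2\<bar> \<le> (2 * G)\<^sup>2" for x
        using du[of t x] by (rule abs_square_le)
    qed measurable
    show "((\<lambda>t. (u (t + \<eta>) x - u t x)\<^sup>2) has_real_derivative 2 * ((u (t + \<eta>) x - u t x) * (v (t + \<eta>) x - v t x)))
        (at t within {0..})" if "t \<in> {0..}" for t x
    proof -
      have d: "((\<lambda>t. u (t + \<eta>) x - u t x) has_real_derivative (v (t + \<eta>) x - v t x)) (at t within {0..})"
        using that by (intro DERIV_diff u_deriv shift_deriv \<eta>) auto
      show ?thesis using DERIV_mult[OF d d] by (simp add: power2_eq_square mult.commute)
    qed
    show "\<bar>2 * ((u (t + \<eta>) x - u t x) * (v (t + \<eta>) x - v t x))\<bar> \<le> 2 * (2 * G * (2 * (\<kappa> * B)))" for t x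
      using mult_mono[OF du[of t x] dv[of t x]] G_nonneg by (simp add: abs_mult mult_ac)
  qed (use that in auto)
  have 2: "f' t \<le> 0" for t
  proof -
    have "f' t = 2 * (LINT x|M. (u (t + \<eta>) x - u t x) * (v (t + \<eta>) x - v t x))"
      by (simp add: f'_def)
    also have "\<dots> = - dissipation k (u (t + \<eta>)) (u t)"
      by (subst F_dissipation[OF k u_meas u_bound u_meas u_bound]) simp
    finally show ?thesis using dissipation_nonneg[OF k, of "u (t + \<eta>)" "u t"] by simp
  qed
  show ?thesis
    by (rule nonincreasing_of_deriv_within[where f="\<lambda>t. square_norm (\<lambda>x. u (t + \<eta>) x - u t x)" and f'=f'])
      (use 1 2 st in auto)
qed

text \<open>
  Dividing \<open>shift_contraction\<close> by the square of the shift and letting the shift tend to \<open>0\<close>.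
\<close>

lemma speed_nonincreasing:
  assumes st: "0 \<le> s" "s \<le> t"
  shows "square_norm (v t) \<le> square_norm (v s)"
proof -
  note [measurable] = u_meas v_meas
  have *: "(\<lambda>n. square_norm (\<lambda>x. u (t + 1 / real (Suc n)) x - u t x) * (real (Suc n))\<^sup>2) \<longlonglongrightarrow> square_norm (v t)"
    if t: "0 \<le> t" for t
  proof -
    have "(\<lambda>n. LINT x|M. ((u (t + 1 / real (Suc n)) x - u t x) * real (Suc n))\<^sup>2) \<longlonglongrightarrow> (LINT x|M. (v t x)\<^sup>2)"
    proof (rule integral_dominated_convergence[where w="\<lambda>_. (\<kappa> * B)\<^sup>2"
          and s="\<lambda>n x. ((u (t + 1 / real (Suc n)) x - u t x) * real (Suc n))\<^sup>2"
          and f="\<lambda>x. (v t x)\<^sup>2"])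
      show "AE x in M. (\<lambda>n. ((u (t + 1 / real (Suc n)) x - u t x) * real (Suc n))\<^sup>2) \<longlonglongrightarrow> (v t x)\<^sup>2"
      proof (intro AE_I2 tendsto_power)
        fix x
        have lim: "(\<lambda>n. t + 1 / real (Suc n)) \<longlonglongrightarrow> t + 0"
          by (intro tendsto_intros LIMSEQ_Suc[OF lim_1_over_n])
        have "((\<lambda>s. (u s x - u t x) / (s - t)) \<longlongrightarrow> v t x) (at t within {0..})"
          using u_deriv[OF t, of x] by (simp add: has_field_derivative_iff)
        then have "(\<lambda>n. (u (t + 1 / real (Suc n)) x - u t x) / (t + 1 / real (Suc n) - t)) \<longlonglongrightarrow> v t x"
          using lim t unfolding tendsto_at_iff_sequentially comp_def
          by (elim allE[of _ "\<lambda>n. t + 1 / real (Suc n)"]) auto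
        then show "(\<lambda>n. (u (t + 1 / real (Suc n)) x - u t x) * real (Suc n)) \<longlonglongrightarrow> v t x" by simp
      qed
      show "AE x in M. norm (((u (t + 1 / real (Suc n)) x - u t x) * real (Suc n))\<^sup>2) \<le> (\<kappa> * B)\<^sup>2" for n
      proof (rule AE_I2)
        fix x
        have "\<bar>u (t + 1 / real (Suc n)) x - u t x\<bar> \<le> \<kappa> * B * (1 / real (Suc n))"
          using sol_Lipschitz[OF k g(1) t, of "t + 1 / real (Suc n)" x] by simp
        then have "\<bar>u (t + 1 / real (Suc n)) x - u t x\<bar> * real (Suc n) \<le> \<kappa> * B * (1 / real (Suc n)) * real (Suc n)"
          by (rule mult_right_mono) simp
        then have "\<bar>(u (t + 1 / real (Suc n)) x - u t x) * real (Suc n)\<bar> \<le> \<kappa> * B"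
          unfolding abs_mult by simp
        then show "norm (((u (t + 1 / real (Suc n)) x - u t x) * real (Suc n))\<^sup>2) \<le> (\<kappa> * B)\<^sup>2"
          unfolding real_norm_def by (rule abs_square_le)
      qed
    qed auto
    then show ?thesis by (simp add: square_norm_def power_mult_distrib)
  qed
  have le: "square_norm (\<lambda>x. u (t + 1 / real (Suc n)) x - u t x) * (real (Suc n))\<^sup>2
      \<le> square_norm (\<lambda>x. u (s + 1 / real (Suc n)) x - u s x) * (real (Suc n))\<^sup>2" for n
    using shift_contraction[OF _ st] by (intro mult_right_mono) auto
  have "0 \<le> t" using st by simp
  show ?thesis
    by (rule LIMSEQ_le[OF *[OF \<open>0 \<le> t\<close>] *[OF st(1)]]) (use le in blast)
qed

lemma potential_exists: "\<exists>\<Theta>. \<forall>s. (\<Theta> has_real_derivative \<theta> s) (at s)"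
proof -
  have "\<exists>\<Theta>. \<forall>s. -\<infinity> < ereal s \<longrightarrow> ereal s < \<infinity> \<longrightarrow> (\<Theta> has_vector_derivative \<theta> s) (at s)"
    by (rule einterval_antiderivative) (auto simp: theta_isCont)
  then obtain \<Theta> where "\<And>s. (\<Theta> has_vector_derivative \<theta> s) (at s)"
    by auto
  then show ?thesis
    by (intro exI[of _ \<Theta>]) (simp add: has_real_derivative_iff_has_vector_derivative)
qed

text \<open>
  The equation is the gradient flow of half of the convex energy \<open>\<phi>\<close> below, whose derivative along the solution is
  $-2\|u_t\|_2^2$. The energy lost between \<open>s\<close> and \<open>t\<close> is at least what the smallest, that is the final, speed
  allows, and by convexity at most what the tangent at time \<open>s\<close> allows.
\<close>

lemma energy_drop:
  assumes st: "0 \<le> s" "s \<le> t"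
  shows "(t - s) * square_norm (v t) \<le> (LINT x|M. (u t x - u s x) * v s x)"
proof -
  note [measurable] = u_meas v_meas kernel_pair_meas[OF k]
  \<comment> \<open>The energy density is \<open>k\<close> times the convex antiderivative of \<open>\<theta>\<close> at the difference.\<close>
  obtain \<Theta> where \<Theta>: "\<And>s. (\<Theta> has_real_derivative \<theta> s) (at s)"
    using potential_exists by blast
  have [measurable]: "\<Theta> \<in> borel_measurable borel"
    using \<Theta> by (intro borel_measurable_continuous_onI continuous_at_imp_continuous_on ballI DERIV_isCont)
  have convex: "\<Theta> a - \<Theta> b \<le> \<theta> a * (a - b)" for a b
  proof -
    have "\<Theta> b - \<Theta> a \<ge> \<theta> a * (b - a)"
      by (rule convex_on_imp_above_tangent[where A=UNIV])
        (auto intro!: convex_on_realI[where f'=\<theta>] \<Theta> theta_le has_field_derivative_at_within)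
    then show ?thesis by (simp add: algebra_simps)
  qed
  have \<Theta>_bound: "\<bar>\<Theta> w\<bar> \<le> \<bar>\<Theta> 0\<bar> + B * (2 * G)" if "\<bar>w\<bar> \<le> 2 * G" for w
  proof -
    have "norm (\<Theta> w - \<Theta> 0) \<le> B * norm (w - 0)"
      by (rule field_differentiable_bound[of UNIV _ \<theta>]) (auto intro: \<Theta> theta_bound)
    also have "\<dots> \<le> B * (2 * G)" using that B_nonneg by (intro mult_left_mono) auto
    finally show ?thesis by simp
  qed
  define w where "w r p = u r (snd p) - u r (fst p)" for r p
  have w_meas[measurable]: "w r \<in> borel_measurable (M \<Otimes>\<^sub>M M)" for r unfolding w_def by measurable
  have w_bd: "\<bar>w r p\<bar> \<le> 2 * G" for r p
    using u_bound[of r "snd p"] u_bound[of r "fst p"] by (simp add: w_def)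
  define k2 where "k2 p = k (fst p) (snd p)" for p
  have k2_meas[measurable]: "k2 \<in> borel_measurable (M \<Otimes>\<^sub>M M)" unfolding k2_def by measurable
  have k2: "0 \<le> k2 p" "k2 p \<le> \<kappa>" for p using sym_kernel_bounds[OF k] by (simp_all add: k2_def)
  define \<phi> where "\<phi> r = (LINT p|(M \<Otimes>\<^sub>M M). k2 p * \<Theta> (w r p))" for r
  have bd\<phi>: "\<bar>k2 p * \<Theta> (w r p)\<bar> \<le> \<kappa> * (\<bar>\<Theta> 0\<bar> + B * (2 * G))" for r p
    using k2[of p] \<Theta>_bound[OF w_bd[of r p]] by (auto simp: abs_mult intro!: mult_mono)
  have int\<phi>: "integrable (M \<Otimes>\<^sub>M M) (\<lambda>p. k2 p * \<Theta> (w r p))" for r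
    by (rule integrable_sq_bounded[OF _ bd\<phi>]) measurable
  have d\<phi>: "(\<phi> has_real_derivative - (2 * square_norm (v r))) (at r within {0..})" if r: "0 \<le> r" for r
  proof -
    have "(\<phi> has_real_derivative (LINT p|(M \<Otimes>\<^sub>M M). k2 p * (\<theta> (w r p) * (v r (snd p) - v r (fst p))))) (at r within {0..})"
      unfolding \<phi>_def
    proof (rule sq.P.has_derivative_expectation[where C="\<kappa> * (B * (2 * (\<kappa> * B)))"
          and h="\<lambda>r p. k2 p * \<Theta> (w r p)"
          and h'="\<lambda>r p. k2 p * (\<theta> (w r p) * (v r (snd p) - v r (fst p)))"])
      show "((\<lambda>r. k2 p * \<Theta> (w r p)) has_real_derivative k2 p * (\<theta> (w r p) * (v r (snd p) - v r (fst p))))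
          (at r within {0..})" if "r \<in> {0..}" for r p
      proof -
        have "((\<lambda>r. w r p) has_real_derivative (v r (snd p) - v r (fst p))) (at r within {0..})"
          unfolding w_def using that by (intro DERIV_diff u_deriv) auto
        from DERIV_chain2[OF \<Theta> this] show ?thesis by (rule DERIV_cmult)
      qed
      show "\<bar>k2 p * (\<theta> (w r p) * (v r (snd p) - v r (fst p)))\<bar> \<le> \<kappa> * (B * (2 * (\<kappa> * B)))" for r p
      proof -
        have "\<bar>v r (snd p) - v r (fst p)\<bar> \<le> 2 * (\<kappa> * B)"
          using v_bound[of r "snd p"] v_bound[of r "fst p"] by linarith
        then show ?thesis using k2[of p] theta_bound[of "w r p"] kB_nonneg B_nonneg
          unfolding abs_mult by (intro mult_mono) auto
      qed
    qed (use r int\<phi> in auto)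
    moreover have "(LINT p|(M \<Otimes>\<^sub>M M). k2 p * (\<theta> (w r p) * (v r (snd p) - v r (fst p)))) = - (2 * square_norm (v r))"
    proof -
      have "square_norm (v r) = (LINT x|M. v r x * F k (u r) x)" by (simp add: square_norm_def power2_eq_square)
      also have "\<dots> = (LINT p|(M \<Otimes>\<^sub>M M). (v r (fst p) - v r (snd p)) * (k2 p * \<theta> (w r p))) / 2"
        unfolding k2_def w_def by (rule F_test[OF k u_meas v_meas v_bound])
      also have "\<dots> = (LINT p|(M \<Otimes>\<^sub>M M). - (k2 p * (\<theta> (w r p) * (v r (snd p) - v r (fst p))))) / 2"
        by (intro arg_cong[where f="\<lambda>x. x / 2"] Bochner_Integration.integral_cong) (auto simp: algebra_simps)
      finally show ?thesis by simp
    qed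
    ultimately show ?thesis by simp
  qed
  have "\<phi> t + 2 * square_norm (v t) * t \<le> \<phi> s + 2 * square_norm (v t) * s"
  proof (rule nonincreasing_of_deriv_within[where f="\<lambda>r. \<phi> r + 2 * square_norm (v t) * r"
        and f'="\<lambda>r. - (2 * square_norm (v r)) + 2 * square_norm (v t)", OF _ _ st])
    show "((\<lambda>r. \<phi> r + 2 * square_norm (v t) * r) has_real_derivative (- (2 * square_norm (v r)) + 2 * square_norm (v t))) (at r within {0..})"
      if "0 \<le> r" for r
      by (intro DERIV_add d\<phi>[OF that] DERIV_cmult_Id)
    show "- (2 * square_norm (v r)) + 2 * square_norm (v t) \<le> 0" if "s \<le> r" "r \<le> t" for r
      using speed_nonincreasing[of r t] that st by simp
  qed
  then have 1: "2 * ((t - s) * square_norm (v t)) \<le> \<phi> s - \<phi> t" by (simp add: algebra_simps)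
  have "\<phi> s - \<phi> t = (LINT p|(M \<Otimes>\<^sub>M M). k2 p * \<Theta> (w s p) - k2 p * \<Theta> (w t p))"
    unfolding \<phi>_def using int\<phi> by simp
  also have "\<dots> \<le> (LINT p|(M \<Otimes>\<^sub>M M). k2 p * (\<theta> (w s p) * (w s p - w t p)))"
  proof (rule integral_mono)
    show "integrable (M \<Otimes>\<^sub>M M) (\<lambda>p. k2 p * (\<theta> (w s p) * (w s p - w t p)))"
    proof (rule integrable_sq_bounded[where C="\<kappa> * (B * (4 * G))"])
      show "\<bar>k2 p * (\<theta> (w s p) * (w s p - w t p))\<bar> \<le> \<kappa> * (B * (4 * G))" for p
      proof -
        have "\<bar>w s p - w t p\<bar> \<le> 4 * G" using w_bd[of s p] w_bd[of t p] by linarith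
        then show ?thesis using k2[of p] theta_bound[of "w s p"] B_nonneg G_nonneg
          unfolding abs_mult by (intro mult_mono) auto
      qed
    qed measurable
    show "k2 p * \<Theta> (w s p) - k2 p * \<Theta> (w t p) \<le> k2 p * (\<theta> (w s p) * (w s p - w t p))" for p
      using mult_left_mono[OF convex[of "w s p" "w t p"] k2(1)[of p]] by (simp add: algebra_simps)
  qed (use int\<phi> in auto)
  also have "\<dots> = (LINT p|(M \<Otimes>\<^sub>M M). ((u t (fst p) - u s (fst p)) - (u t (snd p) - u s (snd p))) * (k2 p * \<theta> (w s p)))"
    by (intro Bochner_Integration.integral_cong) (auto simp: algebra_simps w_def)
  also have "\<dots> = 2 * (LINT x|M. (u t x - u s x) * v s x)"
  proof -
    have "\<bar>u t x - u s x\<bar> \<le> 2 * G" for x using u_bound[of t x] u_bound[of s x] by linarith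
    then show ?thesis using F_test[OF k u_meas[of s], of "\<lambda>x. u t x - u s x" "2 * G"] by (simp add: k2_def w_def)
  qed
  finally show ?thesis using 1 by simp
qed

text \<open>
  This is the estimate that makes the consistency error summable over the steps without any regularity of \<open>\<theta>\<close>. The
  dissipation between the states at times \<open>r\<close> and \<open>s\<close> is \<open>2 * (q r - c r)\<close> with the inner products \<open>q\<close> and \<open>c\<close>
  below. Nonincreasing speed gives \<open>q r \<le> (r - s) * square_norm (v s)\<close>. The integral of \<open>2 * c\<close> is
  the squared distance \<open>R t\<close> between the end states, which \<open>energy_drop\<close> bounds from below.
\<close>

lemma step_dissipation:
  assumes st: "0 \<le> s" "s \<le> t"
  shows "(LINT r|time_measure s t. dissipation k (u r) (u s)) \<le> 2 * (t - s)\<^sup>2 * (square_norm (v s) - square_norm (v t))"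
proof -
  note u_m = u_meas and v_m = v_meas and u_b = u_bound and v_b = v_bound
  note G0 = G_nonneg and kB0 = kB_nonneg
  note [measurable] = u_m v_m kernel_pair_meas[OF k] sol_joint_meas[OF k g(1)]
  have du: "\<bar>u r x - u s x\<bar> \<le> 2 * G" for r x using u_b[of r x] u_b[of s x] by linarith
  define a where "a = square_norm (v s)"
  define q where "q r = (LINT x|M. (u r x - u s x) * v s x)" for r
  define c where "c r = (LINT x|M. (u r x - u s x) * v r x)" for r
  have duv: "\<bar>(u r x - u s x) * v r' x\<bar> \<le> 2 * G * (\<kappa> * B)" for r r' x
    using mult_mono[OF du[of r x] v_b[of r' x]] G0 by (simp add: abs_mult)
  have duv_int: "integrable M (\<lambda>x. (u r x - u s x) * v r' x)" for r r'
    by (rule integrable_bounded[OF _ duv]) measurable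
  have sq_int: "integrable M (\<lambda>x. (u r x - u s x)\<^sup>2)" for r
    by (rule integrable_bounded[OF _ abs_square_le[OF du]]) measurable
  have v2_int: "integrable M (\<lambda>x. (v r x)\<^sup>2)" for r
    by (rule integrable_bounded[OF _ abs_square_le[OF v_b]]) measurable
  have vv: "\<bar>v s x * v r x\<bar> \<le> \<kappa> * B * (\<kappa> * B)" for r x
    using mult_mono[OF v_b[of s x] v_b[of r x]] kB0 by (simp add: abs_mult)
  have vv_int: "integrable M (\<lambda>x. v s x * v r x)" for r
    by (rule integrable_bounded[OF _ vv]) measurable
  have du_deriv: "((\<lambda>r. u r x - u s x) has_real_derivative v r x) (at r within {0..})" if "0 \<le> r" for r x
    using DERIV_diff[OF u_deriv[OF that] DERIV_const] by simp
  have dis: "dissipation k (u r) (u s) = 2 * (q r - c r)" for r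
  proof -
    have "- dissipation k (u r) (u s) / 2 = (LINT x|M. (u r x - u s x) * (v r x - v s x))"
      by (rule F_dissipation[OF k u_m u_b u_m u_b, symmetric])
    also have "\<dots> = c r - q r"
      using duv_int by (simp add: c_def q_def right_diff_distrib)
    finally show ?thesis by simp
  qed
  have q_le: "q r \<le> (r - s) * a" if r: "s \<le> r" for r
  proof -
    have dq: "(q has_real_derivative (LINT x|M. v s x * v r x)) (at r within {0..})" if "0 \<le> r" for r
      unfolding q_def
    proof (rule has_derivative_expectation[where C="\<kappa> * B * (\<kappa> * B)" and h="\<lambda>r x. (u r x - u s x) * v s x"
          and h'="\<lambda>r x. v s x * v r x"])
      show "((\<lambda>r. (u r x - u s x) * v s x) has_real_derivative v s x * v r x) (at r within {0..})"
        if "r \<in> {0..}" for r x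
        using DERIV_cmult_right[OF du_deriv[of r x], of "v s x"] that by (simp add: mult.commute)
    qed (use that duv_int vv in auto)
    have "q r - a * r \<le> q s - a * s"
    proof (rule nonincreasing_of_deriv_within[where f="\<lambda>r. q r - a * r" and f'="\<lambda>r. (LINT x|M. v s x * v r x) - a", OF _ _ st(1) r])
      show "((\<lambda>r. q r - a * r) has_real_derivative (LINT x|M. v s x * v r x) - a) (at r within {0..})" if "0 \<le> r" for r
        by (intro DERIV_diff dq that DERIV_cmult_Id)
      show "(LINT x|M. v s x * v r x) - a \<le> 0" if "s \<le> r" "r \<le> t'" for r t'
      proof -
        have "(LINT x|M. v s x * v r x) \<le> (LINT x|M. ((v s x)\<^sup>2 + (v r x)\<^sup>2) / 2)"
        proof (rule integral_mono)
          show "v s x * v r x \<le> ((v s x)\<^sup>2 + (v r x)\<^sup>2) / 2" for x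
            using sum_squares_bound[of "v s x" "v r x"] by simp
        qed (use v2_int vv_int in auto)
        also have "\<dots> = (a + square_norm (v r)) / 2"
          using v2_int by (simp add: a_def square_norm_def)
        also have "\<dots> \<le> a" using speed_nonincreasing[OF st(1) that(1)] by (simp add: a_def)
        finally show ?thesis by simp
      qed
    qed
    moreover have "q s = 0" by (simp add: q_def)
    ultimately show ?thesis by (simp add: algebra_simps)
  qed
  define R where "R r = square_norm (\<lambda>x. u r x - u s x)" for r
  have dR: "(R has_real_derivative 2 * c r) (at r within {0..})" if "0 \<le> r" for r
  proof -
    have "(R has_real_derivative (LINT x|M. 2 * ((u r x - u s x) * v r x))) (at r within {0..})"
      unfolding R_def square_norm_def
    proof (rule has_derivative_expectation[where C="2 * (2 * G * (\<kappa> * B))" and h="\<lambda>r x. (u r x - u s x)\<^sup>2"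
          and h'="\<lambda>r x. 2 * ((u r x - u s x) * v r x)"])
      show "((\<lambda>r. (u r x - u s x)\<^sup>2) has_real_derivative 2 * ((u r x - u s x) * v r x)) (at r within {0..})"
        if "r \<in> {0..}" for r x
        using DERIV_mult[OF du_deriv du_deriv, of r x x] that by (simp add: power2_eq_square mult.commute)
      show "\<bar>2 * ((u r x - u s x) * v r x)\<bar> \<le> 2 * (2 * G * (\<kappa> * B))" for r x
        using duv[of r x r] by simp
    qed (use that sq_int in auto)
    then show ?thesis by (simp add: c_def)
  qed
  have c_int: "((\<lambda>r. 2 * c r) has_integral R t - R s) {s..t}"
  proof (rule fundamental_theorem_of_calculus[OF st(2)])
    fix r assume "r \<in> {s..t}"
    then have "(R has_real_derivative 2 * c r) (at r within {s..t})"
      by (intro DERIV_subset[OF dR]) (use st in auto)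
    then show "(R has_vector_derivative 2 * c r) (at r within {s..t})"
      by (simp add: has_real_derivative_iff_has_vector_derivative)
  qed
  have "((\<lambda>r. a * (r - s)\<^sup>2) has_real_derivative 2 * ((r - s) * a)) (at r within {s..t})" for r
    by (auto intro!: derivative_eq_intros)
  then have lin_int: "((\<lambda>r. 2 * ((r - s) * a)) has_integral a * (t - s)\<^sup>2 - a * (s - s)\<^sup>2) {s..t}"
    by (intro fundamental_theorem_of_calculus[OF st(2)])
      (simp add: has_real_derivative_iff_has_vector_derivative)
  have dis_meas: "(\<lambda>r. dissipation k (u r) (u s)) \<in> borel_measurable borel"
  proof -
    have [measurable]: "(\<lambda>x. u (fst x) (fst (snd x))) \<in> borel_measurable (borel \<Otimes>\<^sub>M (M \<Otimes>\<^sub>M M))"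
      "(\<lambda>x. u (fst x) (snd (snd x))) \<in> borel_measurable (borel \<Otimes>\<^sub>M (M \<Otimes>\<^sub>M M))"
      using measurable_compose[of "\<lambda>x. (fst x, fst (snd x))" "borel \<Otimes>\<^sub>M (M \<Otimes>\<^sub>M M)", OF _ sol_joint_meas[OF k g(1)]]
        measurable_compose[of "\<lambda>x. (fst x, snd (snd x))" "borel \<Otimes>\<^sub>M (M \<Otimes>\<^sub>M M)", OF _ sol_joint_meas[OF k g(1)]]
      by (simp_all add: split_beta)
    have [measurable]: "(\<lambda>x. k (fst (snd x)) (snd (snd x))) \<in> borel_measurable (borel \<Otimes>\<^sub>M (M \<Otimes>\<^sub>M M))"
      using measurable_compose[OF measurable_snd kernel_pair_meas[OF k]] by simp
    show ?thesis unfolding dissipation_def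
      by (rule sq.P.borel_measurable_lebesgue_integral) (simp add: split_beta)
  qed
  have dis_bound: "\<bar>dissipation k (u r) (u s)\<bar> \<le> 2 * (2 * G * (\<kappa> * B) + 2 * G * (\<kappa> * B))" for r
  proof -
    have "\<bar>q r\<bar> \<le> 2 * G * (\<kappa> * B)" unfolding q_def using duv by (intro abs_integral_le) measurable
    moreover have "\<bar>c r\<bar> \<le> 2 * G * (\<kappa> * B)" unfolding c_def using duv by (intro abs_integral_le) measurable
    moreover have "\<bar>2 * (a - c)\<bar> \<le> 2 * (X + X)" if "\<bar>a\<bar> \<le> X" "\<bar>c\<bar> \<le> X" for a c X :: real
      using that unfolding abs_le_iff by (simp add: algebra_simps)
    ultimately show ?thesis unfolding dis by blast
  qed
  note dis_int = time_integral[OF dis_meas dis_bound, of s t]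
  have "integral {s..t} (\<lambda>r. dissipation k (u r) (u s)) \<le> a * (t - s)\<^sup>2 - R t"
  proof (rule has_integral_le[OF integrable_integral[OF dis_int(1)]])
    show "((\<lambda>r. 2 * ((r - s) * a) - 2 * c r) has_integral a * (t - s)\<^sup>2 - R t) {s..t}"
      using has_integral_diff[OF lin_int c_int] by (simp add: R_def square_norm_def)
    show "dissipation k (u r) (u s) \<le> 2 * ((r - s) * a) - 2 * c r" if "r \<in> {s..t}" for r
      unfolding dis using q_le[of r] that by simp
  qed
  moreover have "2 * (t - s)\<^sup>2 * square_norm (v t) - (t - s)\<^sup>2 * a \<le> R t"
  proof -
    \<comment> \<open>Expanding the square bounds \<open>R t\<close> below by a multiple of \<open>q t\<close>.\<close>
    have "0 \<le> (LINT x|M. ((t - s) * v s x - (u t x - u s x))\<^sup>2)" by simp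
    also have "\<dots> = (LINT x|M. (t - s)\<^sup>2 * (v s x)\<^sup>2 - 2 * (t - s) * ((u t x - u s x) * v s x) + (u t x - u s x)\<^sup>2)"
      by (intro Bochner_Integration.integral_cong) (auto simp: power2_eq_square algebra_simps)
    also have "\<dots> = (t - s)\<^sup>2 * a - 2 * (t - s) * q t + R t"
      using v2_int sq_int duv_int by (simp add: a_def R_def square_norm_def q_def)
    finally have "2 * (t - s) * q t \<le> (t - s)\<^sup>2 * a + R t" by simp
    moreover have "(t - s) * ((t - s) * square_norm (v t)) \<le> (t - s) * q t"
      using energy_drop[OF st] st by (intro mult_left_mono) (auto simp: q_def)
    ultimately show ?thesis by (simp add: power2_eq_square algebra_simps)
  qed
  ultimately show ?thesis
    unfolding dis_int(2) a_def by (simp add: algebra_simps)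
qed

end

end

section \<open>Storing a bounded antisymmetric flux\<close>

definition clip :: "real \<Rightarrow> real \<Rightarrow> real" where
  "clip b s = max (- b) (min b s)"

lemma clip_bound: "0 \<le> b \<Longrightarrow> \<bar>clip b s\<bar> \<le> b"
  by (auto simp: clip_def)

lemma clip_minus: "0 \<le> b \<Longrightarrow> clip b (- s) = - clip b s"
  by (auto simp: clip_def max_def min_def)

lemma clip_mono: "s \<le> t \<Longrightarrow> clip b s \<le> clip b t"
  by (auto simp: clip_def)

lemma clip_Lipschitz: "s \<le> t \<Longrightarrow> clip b t - clip b s \<le> t - s"
  by (auto simp: clip_def max_def min_def)

lemma clip_nonneg: "0 \<le> b \<Longrightarrow> 0 \<le> s \<Longrightarrow> 0 \<le> clip b s"
  by (auto simp: clip_def)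

lemma clip_nonpos: "0 \<le> b \<Longrightarrow> s \<le> 0 \<Longrightarrow> clip b s \<le> 0"
  by (auto simp: clip_def)

lemma clip_cont: "continuous_on UNIV (clip b)"
  unfolding clip_def by (intro continuous_intros)

lemma clip_meas [measurable]: "clip b \<in> borel_measurable borel"
  using clip_cont by (rule borel_measurable_continuous_onI)

text \<open>
  A convex \<open>j\<close> with derivative \<open>j'\<close> and second derivative at most \<open>J\<close>, expressed through the inequalities that are used.
\<close>

definition smooth_convex :: "(real \<Rightarrow> real) \<Rightarrow> (real \<Rightarrow> real) \<Rightarrow> real \<Rightarrow> bool" where
  "smooth_convex j j' J \<longleftrightarrow> continuous_on UNIV j \<and> continuous_on UNIV j' \<and> 0 \<le> J \<and>
     (\<forall>a b. j a + j' a * (b - a) \<le> j b \<and> j b \<le> j a + j' a * (b - a) + J / 2 * (b - a)\<^sup>2) \<and>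
     (\<forall>a b. a \<le> b \<longrightarrow> 0 \<le> j' b - j' a \<and> j' b - j' a \<le> J * (b - a))"

lemma continuous_bounded_on_interval:
  assumes "continuous_on UNIV (f :: real \<Rightarrow> real)"
  obtains C where "\<And>x. \<bar>x\<bar> \<le> R \<Longrightarrow> \<bar>f x\<bar> \<le> C"
proof -
  have "compact (f ` {-R..R})"
    using assms by (intro compact_continuous_image continuous_on_subset[OF assms]) auto
  then obtain C where "\<forall>x\<in>f ` {-R..R}. norm x \<le> C"
    by (metis compact_imp_bounded bounded_iff)
  then show ?thesis by (intro that[of C]) (auto simp: abs_le_iff)
qed

context flux_space
begin

text \<open>
  An antisymmetric flux that is saturated, that is \<open>b\<close> times the sign of \<open>\<psi> x - \<psi> y\<close>, in all pairs whose
  difference is at least \<open>\<epsilon> * b\<close>.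
\<close>

definition sat_flux :: "real \<Rightarrow> real \<Rightarrow> ('a \<Rightarrow> real) \<Rightarrow> 'a \<Rightarrow> 'a \<Rightarrow> real" where
  "sat_flux b \<epsilon> \<psi> x y = clip b ((\<psi> x - \<psi> y) / \<epsilon>)"

lemma sat_flux_meas:
  assumes [measurable]: "\<psi> \<in> borel_measurable M"
  shows "(\<lambda>p. sat_flux b \<epsilon> \<psi> (fst p) (snd p)) \<in> borel_measurable (M \<Otimes>\<^sub>M M)"
  unfolding sat_flux_def by measurable

lemma sat_flux_section:
  assumes [measurable]: "\<psi> \<in> borel_measurable M"
  shows "sat_flux b \<epsilon> \<psi> x \<in> borel_measurable M"
  unfolding sat_flux_def by measurable

lemma sat_flux_bound: "0 \<le> b \<Longrightarrow> \<bar>sat_flux b \<epsilon> \<psi> x y\<bar> \<le> b"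
  by (simp add: sat_flux_def clip_bound)

lemma sat_flux_antisym: "0 \<le> b \<Longrightarrow> sat_flux b \<epsilon> \<psi> y x = - sat_flux b \<epsilon> \<psi> x y"
  using clip_minus[of b "(\<psi> x - \<psi> y) / \<epsilon>"] by (simp add: sat_flux_def diff_divide_distrib)

lemma sat_flux_minus: "0 \<le> b \<Longrightarrow> sat_flux b \<epsilon> (\<lambda>x. - \<psi> x) x y = - sat_flux b \<epsilon> \<psi> x y"
  using clip_minus[of b "(\<psi> x - \<psi> y) / \<epsilon>"] by (simp add: sat_flux_def diff_divide_distrib)

lemma sat_flux_integrable:
  assumes "\<psi> \<in> borel_measurable M" "0 \<le> b"
  shows "integrable M (sat_flux b \<epsilon> \<psi> x)"
  using sat_flux_section[OF assms(1)] sat_flux_bound[OF assms(2)] by (rule integrable_bounded)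

lemma sat_flux_mono:
  assumes "0 < \<epsilon>" "\<psi> y \<le> \<psi> x"
  shows "sat_flux b \<epsilon> \<psi> y z \<le> sat_flux b \<epsilon> \<psi> x z"
  unfolding sat_flux_def using assms by (intro clip_mono divide_right_mono) auto

text \<open>
  For this \<open>\<omega>\<close> the expression is \<open>1 - \<omega>\<close> times \<open>(a - a') - \<epsilon> * s\<close>, where \<open>s\<close> is the difference of the clipped values. Since \<open>\<epsilon> * s\<close> lies
  between \<open>0\<close> and \<open>(a - a') - (c - c')\<close>, the second factor lies between \<open>a - a'\<close> and \<open>c - c'\<close>.
\<close>

lemma saturation_contraction:
  fixes d :: real
  assumes \<epsilon>: "0 < \<epsilon>" and D: "\<bar>a - a'\<bar> \<le> D" "\<bar>c - c'\<bar> \<le> D" and \<omega>: "\<omega> = \<epsilon> / (\<epsilon> + 1)"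
  shows "\<bar>(1 - \<omega>) * (a - a') - \<omega> * (clip b ((a - c) / \<epsilon>) - clip b ((a' - c') / \<epsilon>))\<bar> \<le> (1 - \<omega>) * D"
proof -
  have w: "\<omega> = (1 - \<omega>) * \<epsilon>" "0 < 1 - \<omega>" "0 < \<omega>" using \<epsilon> by (auto simp: \<omega> field_simps)
  define s where "s = clip b ((a - c) / \<epsilon>) - clip b ((a' - c') / \<epsilon>)"
  define e where "e = ((a - a') - (c - c'))"
  have e: "(a - c) / \<epsilon> - (a' - c') / \<epsilon> = e / \<epsilon>" by (simp add: e_def diff_divide_distrib)
  have s: "0 \<le> s \<and> \<epsilon> * s \<le> e \<or> e \<le> \<epsilon> * s \<and> s \<le> 0"
  proof (cases "0 \<le> e")
    case True
    then have "(a' - c') / \<epsilon> \<le> (a - c) / \<epsilon>" using e \<epsilon> by (metis diff_ge_0_iff_ge divide_nonneg_pos)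
    from clip_mono[OF this, of b] clip_Lipschitz[OF this, of b] have "0 \<le> s" "s \<le> e / \<epsilon>"
      using e by (auto simp: s_def)
    then show ?thesis using \<epsilon> by (simp add: field_simps)
  next
    case False
    then have "(a - c) / \<epsilon> \<le> (a' - c') / \<epsilon>" using e \<epsilon>
      by (metis diff_le_0_iff_le divide_nonpos_pos less_imp_le linorder_not_le)
    from clip_mono[OF this, of b] clip_Lipschitz[OF this, of b] have "s \<le> 0" "e / \<epsilon> \<le> s"
      using e by (auto simp: s_def)
    then show ?thesis using \<epsilon> by (simp add: field_simps)
  qed
  have "(1 - \<omega>) * (a - a') - \<omega> * s = (1 - \<omega>) * ((a - a') - \<epsilon> * s)"
    using w(1) by (metis mult.assoc right_diff_distrib)
  moreover have "\<bar>(a - a') - \<epsilon> * s\<bar> \<le> D"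
  proof -
    have "0 \<le> s \<Longrightarrow> 0 \<le> \<epsilon> * s" "s \<le> 0 \<Longrightarrow> \<epsilon> * s \<le> 0"
      using \<epsilon> by (auto simp: mult_nonneg_nonpos)
    then show ?thesis using s D unfolding e_def by (auto simp: abs_le_iff)
  qed
  then have "(1 - \<omega>) * \<bar>(a - a') - \<epsilon> * s\<bar> \<le> (1 - \<omega>) * D"
    using w by (intro mult_left_mono) auto
  ultimately show ?thesis using w by (simp add: abs_mult s_def)
qed

text \<open>
  The damped iteration \<open>\<psi> \<mapsto> (1 - \<omega>) * \<psi> + \<omega> * (e - \<Lambda> \<psi>)\<close>, where \<open>\<Lambda> \<psi>\<close> is the integral of the
  saturated flux, contracts the sup norm, and its fixed point is the required decomposition.
\<close>

lemma saturated_decomposition: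
  assumes e[measurable]: "e \<in> borel_measurable M" and E: "\<And>x. \<bar>e x\<bar> \<le> E" and b: "0 \<le> b" and \<epsilon>: "0 < \<epsilon>"
  obtains \<psi> where "\<psi> \<in> borel_measurable M" "\<And>x. \<bar>\<psi> x\<bar> \<le> E + b"
    "\<And>x. e x = \<psi> x + (LINT y|M. sat_flux b \<epsilon> \<psi> x y)"
proof -
  define \<omega> where "\<omega> = \<epsilon> / (\<epsilon> + 1)"
  have \<omega>: "0 < \<omega>" "0 < 1 - \<omega>" "1 - \<omega> < 1" using \<epsilon> by (auto simp: \<omega>_def field_simps)
  define \<Lambda> where "\<Lambda> \<psi> x = (LINT y|M. sat_flux b \<epsilon> \<psi> x y)" for \<psi> x
  define T where "T \<psi> x = (1 - \<omega>) * \<psi> x + \<omega> * (e x - \<Lambda> \<psi> x)" for \<psi> x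
  have E0: "0 \<le> E" using E order_trans abs_ge_zero by blast
  have \<Lambda>_bd: "\<bar>\<Lambda> \<psi> x\<bar> \<le> b" if "\<psi> \<in> borel_measurable M" for \<psi> x
    unfolding \<Lambda>_def by (rule abs_integral_le[OF sat_flux_section[OF that] sat_flux_bound[OF b]])
  have T_meas: "T \<psi> \<in> borel_measurable M" if [measurable]: "\<psi> \<in> borel_measurable M" for \<psi>
  proof -
    note [measurable] = sat_flux_meas[OF that]
    have "\<Lambda> \<psi> \<in> borel_measurable M"
      unfolding \<Lambda>_def using sat_flux_meas[OF that] by (intro borel_measurable_lebesgue_integral) (simp add: split_beta)
    then show ?thesis unfolding T_def by measurable
  qed
  have T_contr: "\<bar>T \<psi> x - T \<phi> x\<bar> \<le> (1 - \<omega>) * D"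
    if m: "\<psi> \<in> borel_measurable M" "\<phi> \<in> borel_measurable M" and D: "\<And>x. \<bar>\<psi> x - \<phi> x\<bar> \<le> D" for \<psi> \<phi> D x
  proof -
    note i = sat_flux_integrable[OF m(1) b, of \<epsilon> x] sat_flux_integrable[OF m(2) b, of \<epsilon> x]
    have "T \<psi> x - T \<phi> x = (1 - \<omega>) * (\<psi> x - \<phi> x) - \<omega> * (\<Lambda> \<psi> x - \<Lambda> \<phi> x)"
      by (simp add: T_def algebra_simps)
    also have "\<dots> = (LINT y|M. (1 - \<omega>) * (\<psi> x - \<phi> x) - \<omega> * (sat_flux b \<epsilon> \<psi> x y - sat_flux b \<epsilon> \<phi> x y))"
      unfolding \<Lambda>_def using i by (simp add: prob_space)
    finally have eq: "T \<psi> x - T \<phi> x = \<dots>" .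
    have "(\<lambda>y. (1 - \<omega>) * (\<psi> x - \<phi> x) - \<omega> * (sat_flux b \<epsilon> \<psi> x y - sat_flux b \<epsilon> \<phi> x y)) \<in> borel_measurable M"
      using i by measurable
    then show ?thesis unfolding eq
    proof (rule abs_integral_le)
      show "\<bar>(1 - \<omega>) * (\<psi> x - \<phi> x) - \<omega> * (sat_flux b \<epsilon> \<psi> x y - sat_flux b \<epsilon> \<phi> x y)\<bar> \<le> (1 - \<omega>) * D" for y
        unfolding sat_flux_def by (rule saturation_contraction[OF \<epsilon> D D \<omega>_def])
    qed
  qed
  define it where "it n = (T ^^ n) (\<lambda>_. 0)" for n
  have it_Suc: "it (Suc n) = T (it n)" for n by (simp add: it_def)
  have it_meas: "it n \<in> borel_measurable M" for n
    by (induction n) (auto simp: it_Suc T_meas, simp add: it_def)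
  have it_bd: "\<bar>it n x\<bar> \<le> E + b" for n x
  proof (induction n)
    case (Suc n)
    have "\<bar>(1 - \<omega>) * it n x\<bar> \<le> (1 - \<omega>) * (E + b)"
      using Suc \<omega> by (simp add: abs_mult mult_left_mono)
    moreover have "\<bar>\<omega> * (e x - \<Lambda> (it n) x)\<bar> \<le> \<omega> * (E + b)"
      using E[of x] \<Lambda>_bd[OF it_meas, of n x] \<omega> unfolding abs_mult by (intro mult_mono) auto
    moreover have "(1 - \<omega>) * (E + b) + \<omega> * (E + b) = E + b" by (simp add: algebra_simps)
    ultimately show ?case unfolding it_Suc T_def by linarith
  qed (use E0 b in \<open>simp add: it_def\<close>)
  have diff: "\<bar>it (Suc n) x - it n x\<bar> \<le> (1 - \<omega>) ^ n * (E + b)" for n x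
  proof (induction n arbitrary: x)
    case 0
    then show ?case using it_bd[of 1 x] by (simp add: it_def)
  next
    case (Suc n)
    from T_contr[OF it_meas it_meas Suc] show ?case unfolding it_Suc[symmetric] by (simp add: mult.assoc)
  qed
  have "convergent (\<lambda>n. it n x)" for x
  proof -
    have "summable (\<lambda>n. it (Suc n) x - it n x)"
    proof (rule summable_comparison_test')
      show "summable (\<lambda>n. (1 - \<omega>) ^ n * (E + b))"
        using \<omega> by (intro summable_mult2 summable_geometric) auto
      show "norm (it (Suc n) x - it n x) \<le> (1 - \<omega>) ^ n * (E + b)" if "0 \<le> n" for n
        using diff by simp
    qed
    then have "(\<lambda>n. \<Sum>i<n. it (Suc i) x - it i x) \<longlonglongrightarrow> (\<Sum>i. it (Suc i) x - it i x)"
      by (rule summable_LIMSEQ)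
    moreover have "(\<Sum>i<n. it (Suc i) x - it i x) = it n x" for n
      by (subst sum_lessThan_telescope) (simp add: it_def)
    ultimately show ?thesis by (auto simp: convergent_def)
  qed
  then have lim: "(\<lambda>n. it n x) \<longlonglongrightarrow> lim (\<lambda>n. it n x)" for x by (simp add: convergent_LIMSEQ_iff)
  define \<psi> where "\<psi> x = lim (\<lambda>n. it n x)" for x
  note lim = lim[folded \<psi>_def]
  show ?thesis
  proof (rule that[of \<psi>])
    show m: "\<psi> \<in> borel_measurable M" using lim it_meas by (rule borel_measurable_LIMSEQ_real)
    show "\<bar>\<psi> x\<bar> \<le> E + b" for x
      using tendsto_upperbound[OF tendsto_rabs[OF lim[of x]]] it_bd by simp
    have "(\<lambda>n. \<Lambda> (it n) x) \<longlonglongrightarrow> \<Lambda> \<psi> x" for x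
      unfolding \<Lambda>_def
    proof (rule integral_dominated_convergence[where w="\<lambda>_. b"])
      show "AE y in M. (\<lambda>n. sat_flux b \<epsilon> (it n) x y) \<longlonglongrightarrow> sat_flux b \<epsilon> \<psi> x y"
        unfolding sat_flux_def clip_def using \<epsilon>
        by (intro AE_I2 tendsto_max tendsto_min tendsto_const tendsto_divide tendsto_diff lim) auto
    qed (use sat_flux_section[OF it_meas] sat_flux_section[OF m] sat_flux_bound[OF b] in auto)
    then have "(\<lambda>n. T (it n) x) \<longlonglongrightarrow> T \<psi> x" for x
      unfolding T_def by (intro tendsto_intros lim)
    then have "\<psi> x = T \<psi> x" for x
      using LIMSEQ_unique[OF LIMSEQ_Suc[OF lim[of x]]] by (simp add: it_Suc)
    then have "\<omega> * \<psi> x = \<omega> * (e x - \<Lambda> \<psi> x)" for x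
      unfolding T_def by (simp add: algebra_simps)
    then show "e x = \<psi> x + (LINT y|M. sat_flux b \<epsilon> \<psi> x y)" for x
      using \<omega> by (simp add: \<Lambda>_def)
  qed
qed

lemma integrable_continuous_of_bounded:
  assumes "continuous_on UNIV (j :: real \<Rightarrow> real)" "\<psi> \<in> borel_measurable M" "\<And>x. \<bar>\<psi> x\<bar> \<le> R"
  shows "integrable M (\<lambda>x. j (\<psi> x))"
proof -
  obtain C where C: "\<And>x. \<bar>x\<bar> \<le> R \<Longrightarrow> \<bar>j x\<bar> \<le> C"
    by (rule continuous_bounded_on_interval[OF assms(1), of R]) blast
  have [measurable]: "j \<in> borel_measurable borel" "\<psi> \<in> borel_measurable M"
    using assms by (auto intro: borel_measurable_continuous_onI)
  show ?thesis
    using C[OF assms(3)] by (intro integrable_bounded[where C=C]) auto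
qed

text \<open>
  Among all ways to write the same function as a part \<open>\<phi>\<close> plus an antisymmetric flux bounded by \<open>b\<close>, the
  saturated one nearly minimises the integral of \<open>j\<close>. Testing \<open>\<phi> - \<psi>\<close> with \<open>j' \<circ> \<psi>\<close> leaves the product of
  \<open>j' (\<psi> x) - j' (\<psi> y)\<close> with the difference of the fluxes. It is nonnegative in saturated pairs, and in the others
  the first factor is at most \<open>J * \<epsilon> * b\<close> in absolute value.
\<close>

lemma resaturation:
  assumes j: "smooth_convex j j' J" and b: "0 \<le> b" and \<epsilon>: "0 < \<epsilon>"
    and \<psi>: "\<psi> \<in> borel_measurable M" "\<And>x. \<bar>\<psi> x\<bar> \<le> R" and \<phi>: "\<phi> \<in> borel_measurable M" "\<And>x. \<bar>\<phi> x\<bar> \<le> R"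
    and S: "(\<lambda>p. S (fst p) (snd p)) \<in> borel_measurable (M \<Otimes>\<^sub>M M)" "\<And>x y. \<bar>S x y\<bar> \<le> b" "\<And>x y. S y x = - S x y"
    and eq: "\<And>x. \<psi> x + (LINT y|M. sat_flux b \<epsilon> \<psi> x y) = \<phi> x + (LINT y|M. S x y)"
  shows "(LINT x|M. j (\<psi> x)) \<le> (LINT x|M. j (\<phi> x)) + J * \<epsilon> * b\<^sup>2"
proof -
  have j': "continuous_on UNIV j'" "continuous_on UNIV j" "0 \<le> J" using j by (auto simp: smooth_convex_def)
  note [measurable] = \<psi>(1) \<phi>(1) S(1) sat_flux_meas[OF \<psi>(1)] borel_measurable_continuous_onI[OF j'(1)]
  define D where "D x y = sat_flux b \<epsilon> \<psi> x y - S x y" for x y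
  have D_bd: "\<bar>D x y\<bar> \<le> 2 * b" for x y
    using S(2)[of x y] sat_flux_bound[OF b, of \<epsilon> \<psi> x y] by (simp add: D_def)
  have D_meas: "(\<lambda>p. D (fst p) (snd p)) \<in> borel_measurable (M \<Otimes>\<^sub>M M)" unfolding D_def by measurable
  have S_sec: "integrable M (S x)" for x
  proof (rule integrable_bounded[OF _ S(2)])
    show "S x \<in> borel_measurable M"
      using measurable_compose[OF measurable_Pair1'[of x M M] S(1)] by (simp add: space_M)
  qed
  have d: "\<phi> x - \<psi> x = (LINT y|M. D x y)" for x
    unfolding D_def using eq[of x] S_sec[of x] sat_flux_integrable[OF \<psi>(1) b] by simp
  obtain C where C: "\<And>x. \<bar>x\<bar> \<le> R \<Longrightarrow> \<bar>j' x\<bar> \<le> C"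
    by (rule continuous_bounded_on_interval[OF j'(1), of R]) blast
  have "(LINT x|M. j' (\<psi> x) * (\<phi> x - \<psi> x)) = (LINT p|(M \<Otimes>\<^sub>M M). (j' (\<psi> (fst p)) - j' (\<psi> (snd p))) * D (fst p) (snd p)) / 2"
    unfolding d
  proof (rule antisym_flux_integral[OF D_meas D_bd])
    show "D y x = - D x y" for x y
      using S(3)[of x y] sat_flux_antisym[OF b, of \<epsilon> \<psi> x y] by (simp add: D_def)
    show "\<bar>j' (\<psi> x)\<bar> \<le> C" for x by (rule C[OF \<psi>(2)])
  qed measurable
  also have "\<dots> \<ge> (- 2 * (J * \<epsilon> * b\<^sup>2)) / 2"
  proof (rule divide_right_mono)
    have lower: "- 2 * (J * \<epsilon> * b\<^sup>2) \<le> (j' (\<psi> x) - j' (\<psi> y)) * D x y" if le: "\<psi> y \<le> \<psi> x" for x y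
    proof -
      have jd: "0 \<le> j' (\<psi> x) - j' (\<psi> y)" "j' (\<psi> x) - j' (\<psi> y) \<le> J * (\<psi> x - \<psi> y)"
        using j le by (auto simp: smooth_convex_def)
      show ?thesis
      proof (cases "\<epsilon> * b \<le> \<psi> x - \<psi> y")
        case True
        then have "sat_flux b \<epsilon> \<psi> x y = b" using \<epsilon> b by (simp add: sat_flux_def clip_def field_simps)
        then have "0 \<le> D x y" using S(2)[of x y] by (simp add: D_def abs_le_iff)
        then have "0 \<le> (j' (\<psi> x) - j' (\<psi> y)) * D x y" using jd by simp
        moreover have "0 \<le> J * \<epsilon> * b\<^sup>2" using j' \<epsilon> by simp
        ultimately show ?thesis by linarith
      next
        case False
        then have "j' (\<psi> x) - j' (\<psi> y) \<le> J * (\<epsilon> * b)"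
          using jd(2) mult_left_mono[of "\<psi> x - \<psi> y" "\<epsilon> * b" J] j'(3) by linarith
        then have "\<bar>(j' (\<psi> x) - j' (\<psi> y)) * D x y\<bar> \<le> (J * (\<epsilon> * b)) * (2 * b)"
          using jd(1) D_bd[of x y] b unfolding abs_mult by (intro mult_mono) auto
        then show ?thesis by (simp add: abs_le_iff power2_eq_square algebra_simps)
      qed
    qed
    have low: "- 2 * (J * \<epsilon> * b\<^sup>2) \<le> (j' (\<psi> x) - j' (\<psi> y)) * D x y" for x y
    proof (cases "\<psi> y \<le> \<psi> x")
      case False
      then have "- 2 * (J * \<epsilon> * b\<^sup>2) \<le> (j' (\<psi> y) - j' (\<psi> x)) * D y x" by (intro lower) simp
      also have "D y x = - D x y"
        using S(3)[of x y] sat_flux_antisym[OF b, of \<epsilon> \<psi> x y] by (simp add: D_def)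
      finally show ?thesis by (simp add: algebra_simps)
    qed (rule lower)
    show "- 2 * (J * \<epsilon> * b\<^sup>2) \<le> (LINT p|(M \<Otimes>\<^sub>M M). (j' (\<psi> (fst p)) - j' (\<psi> (snd p))) * D (fst p) (snd p))"
    proof (rule sq.P.integral_ge_const)
      show "integrable (M \<Otimes>\<^sub>M M) (\<lambda>p. (j' (\<psi> (fst p)) - j' (\<psi> (snd p))) * D (fst p) (snd p))"
      proof (rule integrable_sq_bounded[where C="2 * C * (2 * b)"])
        show "(\<lambda>p. (j' (\<psi> (fst p)) - j' (\<psi> (snd p))) * D (fst p) (snd p)) \<in> borel_measurable (M \<Otimes>\<^sub>M M)"
          using D_meas by measurable
        show "\<bar>(j' (\<psi> (fst p)) - j' (\<psi> (snd p))) * D (fst p) (snd p)\<bar> \<le> 2 * C * (2 * b)" for p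
        proof -
          have "\<bar>j' (\<psi> (fst p)) - j' (\<psi> (snd p))\<bar> \<le> 2 * C"
            using C[OF \<psi>(2), of "fst p"] C[OF \<psi>(2), of "snd p"] by linarith
          then show ?thesis using D_bd[of "fst p" "snd p"] unfolding abs_mult by (intro mult_mono) auto
        qed
      qed
    qed (use low in auto)
  qed simp
  finally have test: "- (J * \<epsilon> * b\<^sup>2) \<le> (LINT x|M. j' (\<psi> x) * (\<phi> x - \<psi> x))" by simp
  have i1: "integrable M (\<lambda>x. j' (\<psi> x) * (\<phi> x - \<psi> x))"
  proof (rule integrable_bounded[where C="C * (2 * R)"])
    show "\<bar>j' (\<psi> x) * (\<phi> x - \<psi> x)\<bar> \<le> C * (2 * R)" for x
      using C[OF \<psi>(2), of x] \<psi>(2)[of x] \<phi>(2)[of x] unfolding abs_mult by (intro mult_mono) auto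
  qed measurable
  note i = integrable_continuous_of_bounded[OF j'(2) \<psi>] integrable_continuous_of_bounded[OF j'(2) \<phi>]
  have "(LINT x|M. j (\<psi> x) + j' (\<psi> x) * (\<phi> x - \<psi> x)) \<le> (LINT x|M. j (\<phi> x))"
    using i i1 j by (intro integral_mono) (auto simp: smooth_convex_def)
  then show ?thesis using test i i1 by simp
qed

text \<open>
  The square is a double integral over pairs \<open>(y, z)\<close>, each of which is ordered by \<open>\<zeta>\<close> in at least one way.
\<close>

lemma square_integral_ordered:
  assumes h: "h \<in> borel_measurable M" "\<And>x. 0 \<le> h x" "\<And>x. h x \<le> C" and z: "(\<zeta> :: 'a \<Rightarrow> real) \<in> borel_measurable M"
  shows "(LINT y|M. h y)\<^sup>2 \<le> 2 * (LINT y|M. h y * (LINT z|M. (if \<zeta> y \<le> \<zeta> z then h z else (0::real))))"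
proof -
  note [measurable] = h(1) z
  have C: "0 \<le> C" using h(2,3) order_trans by blast
  have ii: "integrable (M \<Otimes>\<^sub>M M) f" if "f \<in> borel_measurable (M \<Otimes>\<^sub>M M)" "\<And>p. \<bar>f p\<bar> \<le> C * C" for f
    using that by (rule integrable_sq_bounded)
  have hh: "0 \<le> h y * h z \<and> h y * h z \<le> C * C" for y z using h C by (auto intro!: mult_mono)
  define f where "f p = h (fst p) * (if \<zeta> (fst p) \<le> \<zeta> (snd p) then h (snd p) else 0)" for p
  define f' where "f' p = h (fst p) * (if \<zeta> (snd p) \<le> \<zeta> (fst p) then h (snd p) else 0)" for p
  have f_meas: "f \<in> borel_measurable (M \<Otimes>\<^sub>M M)" "f' \<in> borel_measurable (M \<Otimes>\<^sub>M M)" unfolding f_def f'_def by measurable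
  have f_int: "integrable (M \<Otimes>\<^sub>M M) f" "integrable (M \<Otimes>\<^sub>M M) f'"
    using f_meas hh C by (auto intro!: ii simp: f_def f'_def)
  have "(LINT y|M. h y)\<^sup>2 = (LINT y|M. LINT z|M. h y * h z)"
    by (simp add: power2_eq_square)
  also have "\<dots> = (LINT p|(M \<Otimes>\<^sub>M M). h (fst p) * h (snd p))"
    by (rule iterated_integral[where C="C * C"]) (use hh in auto)
  also have "\<dots> \<le> (LINT p|(M \<Otimes>\<^sub>M M). f p + f' p)"
  proof (rule integral_mono)
    show "integrable (M \<Otimes>\<^sub>M M) (\<lambda>p. h (fst p) * h (snd p))" by (rule ii) (use hh in auto)
    show "h (fst p) * h (snd p) \<le> f p + f' p" for p
      using hh[of "fst p" "snd p"] by (auto simp: f_def f'_def)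
  qed (use f_int in auto)
  also have "\<dots> = (LINT p|(M \<Otimes>\<^sub>M M). f p) + (LINT p|(M \<Otimes>\<^sub>M M). f' p)" using f_int by simp
  also have "(LINT p|(M \<Otimes>\<^sub>M M). f' p) = (LINT p|(M \<Otimes>\<^sub>M M). f p)"
  proof -
    have "(LINT p|(M \<Otimes>\<^sub>M M). f p) = (LINT (x,y)|(M \<Otimes>\<^sub>M M). f (y, x))"
      by (rule sq.integral_product_swap[OF f_meas(1), symmetric])
    also have "\<dots> = (LINT p|(M \<Otimes>\<^sub>M M). f' p)"
      by (intro Bochner_Integration.integral_cong) (auto simp: f_def f'_def mult.commute)
    finally show ?thesis by simp
  qed
  also have "(LINT p|(M \<Otimes>\<^sub>M M). f p) = (LINT y|M. LINT z|M. h y * (if \<zeta> y \<le> \<zeta> z then h z else 0))"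
    unfolding f_def
  proof (rule iterated_integral[symmetric, where C="C * C"])
    show "\<bar>h y * (if \<zeta> y \<le> \<zeta> z then h z else 0)\<bar> \<le> C * C" for y z using hh[of y z] C by auto
  qed measurable
  finally show ?thesis by simp
qed

text \<open>
  Think of \<open>h y\<close> as what spills over in the pair \<open>(x, y)\<close>. If it is positive at \<open>y\<close>, then every \<open>z\<close> with
  \<open>\<psi> y \<le> \<psi> z\<close> and \<open>0 < h z\<close> stores a flux of at least \<open>b / 2 \<ge> h z\<close> towards \<open>x\<close>, and none towards \<open>y\<close>. So the stored
  flux alone separates \<open>e x\<close> from \<open>e y\<close> by at least the integral of \<open>h\<close> over these \<open>z\<close>.
\<close>

lemma saturated_excess:
  assumes b: "0 \<le> b" and \<epsilon>: "0 < \<epsilon>" and \<psi>: "\<psi> \<in> borel_measurable M" "\<And>y. \<bar>\<psi> y\<bar> \<le> R"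
    and e: "\<And>x. e x = \<psi> x + (LINT y|M. sat_flux b \<epsilon> \<psi> x y)"
    and h: "h \<in> borel_measurable M" "\<And>y. 0 \<le> h y" "\<And>y. h y \<le> \<beta>" and \<beta>: "2 * \<beta> \<le> b"
    and supp: "\<And>y. 0 < h y \<Longrightarrow> \<psi> y < \<psi> x \<and> b / 2 \<le> sat_flux b \<epsilon> \<psi> x y"
  shows "(LINT y|M. h y)\<^sup>2 \<le> 2 * (LINT y|M. h y * \<bar>e x - e y\<bar>)"
proof -
  note [measurable] = h(1) \<psi>(1) sat_flux_meas[OF \<psi>(1), of b \<epsilon>]
  have e_meas [measurable]: "e \<in> borel_measurable M"
  proof -
    have "(\<lambda>x. \<psi> x + (LINT y|M. sat_flux b \<epsilon> \<psi> x y)) \<in> borel_measurable M"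
      using \<psi>(1) sat_flux_meas[OF \<psi>(1), of b \<epsilon>]
      by (intro borel_measurable_add borel_measurable_lebesgue_integral) (simp_all add: split_beta)
    then show ?thesis using e by (simp cong: measurable_cong)
  qed
  have \<beta>0: "0 \<le> \<beta>" using h(2,3) order_trans by blast
  let ?S = "sat_flux b \<epsilon> \<psi>"
  define t where "t y = (LINT z|M. (if \<psi> y \<le> \<psi> z then h z else 0))" for y
  have t_meas [measurable]: "t \<in> borel_measurable M" unfolding t_def by measurable
  have t_bd: "\<bar>t y\<bar> \<le> \<beta>" for y
    unfolding t_def using h \<beta>0 by (intro abs_integral_le) (auto, measurable)
  \<comment> \<open>What is stored above the level of \<open>\<psi> y\<close> already separates \<open>e x\<close> from \<open>e y\<close>.\<close>
  have key: "t y \<le> \<bar>e x - e y\<bar>" if y: "0 < h y" for y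
  proof -
    have yx: "\<psi> y < \<psi> x" using supp[OF y] by simp
    have "t y \<le> (LINT z|M. ?S x z - ?S y z)"
      unfolding t_def
    proof (rule integral_mono)
      show "integrable M (\<lambda>z. if \<psi> y \<le> \<psi> z then h z else 0)"
        by (rule integrable_bounded[where C=\<beta>]) (use h \<beta>0 in \<open>measurable, auto\<close>)
      show "(if \<psi> y \<le> \<psi> z then h z else 0) \<le> ?S x z - ?S y z" for z
      proof (cases "\<psi> y \<le> \<psi> z \<and> 0 < h z")
        case True
        then have "h z \<le> ?S x z" using supp[of z] h(3)[of z] \<beta> by simp
        moreover have "?S y z \<le> 0"
          unfolding sat_flux_def using True \<epsilon> b by (intro clip_nonpos) (auto simp: divide_nonpos_pos)
        ultimately show ?thesis using True by simp
      next
        case False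
        then have "(if \<psi> y \<le> \<psi> z then h z else 0) = 0" using h(2)[of z] by auto
        then show ?thesis using sat_flux_mono[OF \<epsilon>, of \<psi> y x b z] yx by simp
      qed
    qed (use sat_flux_integrable[OF \<psi>(1) b] in auto)
    also have "\<dots> = (e x - \<psi> x) - (e y - \<psi> y)"
      using sat_flux_integrable[OF \<psi>(1) b] e[of x] e[of y] by simp
    also have "\<dots> \<le> \<bar>e x - e y\<bar>" using yx by linarith
    finally show ?thesis .
  qed
  have e_int: "integrable M (\<lambda>y. h y * \<bar>e x - e y\<bar>)"
  proof (rule integrable_bounded[where C="\<beta> * (2 * (R + b))"])
    have "\<bar>e y\<bar> \<le> R + b" for y
      using \<psi>(2)[of y] abs_integral_le[OF sat_flux_section[OF \<psi>(1)] sat_flux_bound[OF b], of \<epsilon> y] e[of y] by linarith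
    then show "\<bar>h y * \<bar>e x - e y\<bar>\<bar> \<le> \<beta> * (2 * (R + b))" for y
      using h(2,3)[of y] \<beta>0 unfolding abs_mult by (intro mult_mono) (auto simp: abs_le_iff, smt+)
  qed measurable
  have ht: "\<bar>h y * t y\<bar> \<le> \<beta> * \<beta>" for y
    using h(2,3)[of y] t_bd[of y] \<beta>0 unfolding abs_mult by (intro mult_mono) auto
  have "(LINT y|M. h y)\<^sup>2 \<le> 2 * (LINT y|M. h y * t y)"
    unfolding t_def by (rule square_integral_ordered[OF h \<psi>(1)])
  also have "(LINT y|M. h y * t y) \<le> (LINT y|M. h y * \<bar>e x - e y\<bar>)"
  proof (rule integral_mono[OF _ e_int])
    show "integrable M (\<lambda>y. h y * t y)" by (rule integrable_bounded[OF _ ht]) measurable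
    show "h y * t y \<le> h y * \<bar>e x - e y\<bar>" for y
      using key[of y] h(2)[of y] by (cases "h y = 0") (auto intro: mult_left_mono)
  qed
  finally show ?thesis by simp
qed

text \<open>
  The part of the flux \<open>q\<close> that drives the values of \<open>e\<close> at \<open>x\<close> and \<open>y\<close> further apart.
\<close>

definition wrong_sign :: "('a \<Rightarrow> 'a \<Rightarrow> real) \<Rightarrow> ('a \<Rightarrow> real) \<Rightarrow> 'a \<Rightarrow> 'a \<Rightarrow> real" where
  "wrong_sign q e x y = max 0 (q x y * sgn (e x - e y))"

text \<open>
  The flux \<open>q\<close> is put into the store, giving \<open>S\<close> after clipping, and the excess \<open>\<rho>\<close> is added to \<open>\<psi>\<close>. Where
  \<open>\<psi> y < \<psi> x\<close>, the store can overflow only if it already holds at least \<open>b / 2\<close>, and then \<open>\<rho> x y\<close>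
  is between \<open>0\<close> and \<open>q x y\<close>. As \<open>\<psi>\<close> and \<open>e\<close> are ordered alike, the excess is part of the wrong-sign flux. Its
  first-order effect is immediate. The second-order effect is the square of the
  integrated excess, for which \<open>saturated_excess\<close> is made.
\<close>

lemma saturated_flux_step:
  assumes b: "0 \<le> b" and \<epsilon>: "0 < \<epsilon>" and \<psi>: "\<psi> \<in> borel_measurable M" "\<And>y. \<bar>\<psi> y\<bar> \<le> R"
    and e: "\<And>x. e x = \<psi> x + (LINT y|M. sat_flux b \<epsilon> \<psi> x y)"
    and q: "(\<lambda>p. q (fst p) (snd p)) \<in> borel_measurable (M \<Otimes>\<^sub>M M)" "\<And>x y. \<bar>q x y\<bar> \<le> \<beta>" "\<And>x y. q y x = - q x y"
    and \<beta>: "2 * \<beta> \<le> b"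
  obtains \<phi> S where "\<phi> \<in> borel_measurable M" "\<And>x. \<bar>\<phi> x\<bar> \<le> R + \<beta>"
    "(\<lambda>p. S (fst p) (snd p)) \<in> borel_measurable (M \<Otimes>\<^sub>M M)" "\<And>x y. \<bar>S x y\<bar> \<le> b" "\<And>x y. S y x = - S x y"
    "\<And>x. e x + (LINT y|M. q x y) = \<phi> x + (LINT y|M. S x y)"
    "\<And>j j' J. smooth_convex j j' J \<Longrightarrow> (LINT x|M. j (\<phi> x)) \<le> (LINT x|M. j (\<psi> x)) +
       3 / 2 * J * (LINT p|(M \<Otimes>\<^sub>M M). wrong_sign q e (fst p) (snd p) * \<bar>e (fst p) - e (snd p)\<bar>)"
proof -
  have \<beta>0: "0 \<le> \<beta>" using q(2) order_trans abs_ge_zero by blast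
  let ?S = "sat_flux b \<epsilon> \<psi>"
  note [measurable] = \<psi>(1) sat_flux_meas[OF \<psi>(1), of b \<epsilon>] q(1)
  have e_meas [measurable]: "e \<in> borel_measurable M"
  proof -
    have "(\<lambda>x. \<psi> x + (LINT y|M. ?S x y)) \<in> borel_measurable M"
      using \<psi>(1) sat_flux_meas[OF \<psi>(1), of b \<epsilon>]
      by (intro borel_measurable_add borel_measurable_lebesgue_integral) (simp_all add: split_beta)
    then show ?thesis using e by (simp cong: measurable_cong)
  qed
  have e_bd: "\<bar>e y\<bar> \<le> R + b" for y
    using \<psi>(2)[of y] abs_integral_le[OF sat_flux_section[OF \<psi>(1)] sat_flux_bound[OF b], of \<epsilon> y] e[of y] by linarith
  have order: "\<psi> x - \<psi> y \<le> e x - e y" if "\<psi> y \<le> \<psi> x" for x y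
  proof -
    have "(LINT z|M. ?S y z) \<le> (LINT z|M. ?S x z)"
      using sat_flux_integrable[OF \<psi>(1) b] sat_flux_mono[OF \<epsilon> that] by (intro integral_mono) auto
    then show ?thesis using e[of x] e[of y] by linarith
  qed
  have \<psi>_le_e: "\<bar>\<psi> x - \<psi> y\<bar> \<le> \<bar>e x - e y\<bar>" for x y
    using order[of x y] order[of y x] by linarith
  define S where "S x y = clip b (?S x y + q x y)" for x y
  define \<rho> where "\<rho> x y = ?S x y + q x y - S x y" for x y
  let ?W = "wrong_sign q e"
  have S_anti: "S y x = - S x y" for x y
  proof -
    have "?S y x = - ?S x y" "q y x = - q x y" by (rule sat_flux_antisym[OF b], rule q)
    then have "?S y x + q y x = - (?S x y + q x y)" by simp
    then show ?thesis unfolding S_def using clip_minus[OF b, of "?S x y + q x y"] by (simp only:)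
  qed
  have \<rho>_anti: "\<rho> y x = - \<rho> x y" for x y
    using S_anti[of x y] q(3)[of x y] sat_flux_antisym[OF b, of \<epsilon> \<psi> x y] by (simp add: \<rho>_def)
  have S_meas: "(\<lambda>p. S (fst p) (snd p)) \<in> borel_measurable (M \<Otimes>\<^sub>M M)" unfolding S_def by measurable
  have \<rho>_meas: "(\<lambda>p. \<rho> (fst p) (snd p)) \<in> borel_measurable (M \<Otimes>\<^sub>M M)"
    unfolding \<rho>_def using S_meas by measurable
  have W_meas: "(\<lambda>p. ?W (fst p) (snd p)) \<in> borel_measurable (M \<Otimes>\<^sub>M M)" unfolding wrong_sign_def by measurable
  note [measurable] = S_meas \<rho>_meas W_meas
  have sec: "f x \<in> borel_measurable M" if "(\<lambda>p. f (fst p) (snd p)) \<in> borel_measurable (M \<Otimes>\<^sub>M M)" for f :: "'a \<Rightarrow> 'a \<Rightarrow> real" and x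
    using measurable_compose[OF measurable_Pair1'[of x M M] that] by (simp add: space_M)
  have \<rho>_cases: "\<rho> x y = 0 \<or> \<psi> y < \<psi> x \<and> b / 2 \<le> ?S x y \<and> 0 \<le> \<rho> x y \<and> \<rho> x y \<le> q x y" if "\<psi> y \<le> \<psi> x" for x y
  proof -
    have S0: "0 \<le> ?S x y" unfolding sat_flux_def using that \<epsilon> b by (intro clip_nonneg) auto
    have Sb: "?S x y \<le> b" using sat_flux_bound[OF b, of \<epsilon> \<psi> x y] by (simp add: abs_le_iff)
    have qb: "\<bar>q x y\<bar> \<le> \<beta>" by (rule q)
    show ?thesis
    proof (cases "?S x y + q x y \<le> b")
      case True
      then have "S x y = ?S x y + q x y" using S0 qb \<beta> \<beta>0 by (auto simp: S_def clip_def)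
      then show ?thesis by (simp add: \<rho>_def)
    next
      case False
      then have "S x y = b" using b by (auto simp: S_def clip_def)
      moreover have "b / 2 \<le> ?S x y" using False qb \<beta> by linarith
      moreover have "\<psi> y \<noteq> \<psi> x"
      proof
        assume "\<psi> y = \<psi> x"
        then have "?S x y = 0" using b by (simp add: sat_flux_def clip_def)
        then show False using False qb \<beta> \<beta>0 by linarith
      qed
      ultimately show ?thesis using that False Sb by (auto simp: \<rho>_def)
    qed
  qed
  have \<rho>_W: "\<bar>\<rho> x y\<bar> \<le> ?W x y" for x y
  proof -
    have *: "\<bar>\<rho> x y\<bar> \<le> ?W x y" if "\<psi> y \<le> \<psi> x" for x y
    proof -
      have "\<rho> x y = 0 \<or> e x - e y > 0 \<and> 0 \<le> \<rho> x y \<and> \<rho> x y \<le> q x y"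
        using \<rho>_cases[OF that] order[OF that] by auto
      then show ?thesis by (auto simp: wrong_sign_def)
    qed
    show ?thesis
    proof (cases "\<psi> y \<le> \<psi> x")
      case False
      then have "\<bar>\<rho> y x\<bar> \<le> ?W y x" by (intro *) simp
      moreover have "?W y x = ?W x y" using q(3)[of x y] by (simp add: wrong_sign_def sgn_if)
      ultimately show ?thesis using \<rho>_anti[of x y] by simp
    qed (rule *)
  qed
  have W_bd: "?W x y \<le> \<beta>" "0 \<le> ?W x y" for x y
    using q(2)[of x y] \<beta>0 by (auto simp: wrong_sign_def sgn_if abs_le_iff)
  have \<rho>_bd: "\<bar>\<rho> x y\<bar> \<le> \<beta>" for x y using \<rho>_W[of x y] W_bd(1)[of x y] by linarith
  define P where "P x = (LINT y|M. \<rho> x y)" for x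
  have P_meas [measurable]: "P \<in> borel_measurable M"
    unfolding P_def using \<rho>_meas by (intro borel_measurable_lebesgue_integral) (simp add: split_beta)
  have P_bd: "\<bar>P x\<bar> \<le> \<beta>" for x unfolding P_def by (rule abs_integral_le[OF sec[OF \<rho>_meas] \<rho>_bd])
  have S_bd: "\<bar>S x y\<bar> \<le> b" for x y unfolding S_def by (rule clip_bound[OF b])
  have We_bd: "\<bar>?W x y * \<bar>e x - e y\<bar>\<bar> \<le> \<beta> * (2 * (R + b))" for x y
  proof -
    have "\<bar>e x - e y\<bar> \<le> 2 * (R + b)" using e_bd[of x] e_bd[of y] abs_triangle_ineq4[of "e x" "e y"] by simp
    then show ?thesis using W_bd[of x y] \<beta>0 unfolding abs_mult by (intro mult_mono) auto
  qed
  have We_int: "integrable M (\<lambda>y. ?W x y * \<bar>e x - e y\<bar>)" for x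
    using sec[OF W_meas, of x] We_bd[of x] by (intro integrable_bounded) (auto simp del: abs_mult)
  \<comment> \<open>Excess flowing into \<open>x\<close> and out of \<open>x\<close> partly cancels; each is treated by \<open>saturated_excess\<close>, the second for \<open>- \<psi>\<close> and \<open>- e\<close>.\<close>
  have P2: "(P x)\<^sup>2 \<le> 2 * (LINT y|M. ?W x y * \<bar>e x - e y\<bar>)" for x
  proof -
    define h where "h y = max 0 (\<rho> x y)" for y
    define h' where "h' y = max 0 (- \<rho> x y)" for y
    have h_meas [measurable]: "h \<in> borel_measurable M" "h' \<in> borel_measurable M"
      unfolding h_def h'_def using sec[OF \<rho>_meas, of x] by measurable
    have h_le: "0 \<le> h y" "h y \<le> \<beta>" "0 \<le> h' y" "h' y \<le> \<beta>" "h y + h' y \<le> ?W x y" for y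
      using \<rho>_bd[of x y] \<rho>_W[of x y] \<beta>0 by (auto simp: h_def h'_def abs_le_iff)
    have h_int: "integrable M h" "integrable M h'"
      using h_le \<beta>0 by (auto intro!: integrable_bounded[where C=\<beta>])
    have 1: "(LINT y|M. h y)\<^sup>2 \<le> 2 * (LINT y|M. h y * \<bar>e x - e y\<bar>)"
    proof (rule saturated_excess[OF b \<epsilon> \<psi> e h_meas(1) h_le(1,2) \<beta>])
      show "\<psi> y < \<psi> x \<and> b / 2 \<le> ?S x y" if "0 < h y" for y
        using that \<rho>_cases[of y x] \<rho>_cases[of x y] \<rho>_anti[of x y] by (cases "\<psi> y \<le> \<psi> x") (auto simp: h_def)
    qed
    have 2: "(LINT y|M. h' y)\<^sup>2 \<le> 2 * (LINT y|M. h' y * \<bar>- e x - - e y\<bar>)"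
    proof (rule saturated_excess[where \<psi>="\<lambda>x. - \<psi> x" and e="\<lambda>x. - e x", OF b \<epsilon> _ _ _ h_meas(2) h_le(3,4) \<beta>])
      show "- e x = - \<psi> x + (LINT y|M. sat_flux b \<epsilon> (\<lambda>x. - \<psi> x) x y)" for x
        using e[of x] by (simp add: sat_flux_minus[OF b])
      show "- \<psi> y < - \<psi> x \<and> b / 2 \<le> sat_flux b \<epsilon> (\<lambda>x. - \<psi> x) x y" if "0 < h' y" for y
      proof -
        have "0 < \<rho> y x" using that \<rho>_anti[of x y] by (auto simp: h'_def)
        then have "\<psi> x < \<psi> y \<and> b / 2 \<le> ?S y x"
          using \<rho>_cases[of y x] \<rho>_cases[of x y] \<rho>_anti[of x y] by (cases "\<psi> x \<le> \<psi> y") auto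
        then show ?thesis using sat_flux_antisym[OF b, of \<epsilon> \<psi> x y] by (simp add: sat_flux_minus[OF b])
      qed
      show "\<bar>- \<psi> y\<bar> \<le> R" for y using \<psi>(2) by simp
    qed measurable
    have "P x = (LINT y|M. h y - h' y)"
      unfolding P_def by (intro Bochner_Integration.integral_cong) (auto simp: h_def h'_def)
    also have "\<dots> = (LINT y|M. h y) - (LINT y|M. h' y)" using h_int by simp
    finally have "(P x)\<^sup>2 = (LINT y|M. h y)\<^sup>2 + (LINT y|M. h' y)\<^sup>2 - 2 * (LINT y|M. h y) * (LINT y|M. h' y)"
      by (simp add: power2_diff)
    also have "0 \<le> (LINT y|M. h y) * (LINT y|M. h' y)" using h_le by (intro mult_nonneg_nonneg) auto
    then have "(LINT y|M. h y)\<^sup>2 + (LINT y|M. h' y)\<^sup>2 - 2 * (LINT y|M. h y) * (LINT y|M. h' y)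
        \<le> 2 * (LINT y|M. h y * \<bar>e x - e y\<bar>) + 2 * (LINT y|M. h' y * \<bar>e x - e y\<bar>)"
      using 1 2 by (simp add: abs_minus_commute)
    also have "\<dots> = 2 * (LINT y|M. (h y + h' y) * \<bar>e x - e y\<bar>)"
    proof -
      have "\<bar>f y * \<bar>e x - e y\<bar>\<bar> \<le> \<beta> * (2 * (R + b))" if "0 \<le> f y" "f y \<le> \<beta>" for f y
      proof -
        have "\<bar>e x - e y\<bar> \<le> 2 * (R + b)" using e_bd[of x] e_bd[of y] abs_triangle_ineq4[of "e x" "e y"] by simp
        then show ?thesis using that \<beta>0 unfolding abs_mult by (intro mult_mono) auto
      qed
      then have "integrable M (\<lambda>y. h y * \<bar>e x - e y\<bar>)" "integrable M (\<lambda>y. h' y * \<bar>e x - e y\<bar>)"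
        using h_le by (auto intro!: integrable_bounded[where C="\<beta> * (2 * (R + b))"] simp del: abs_mult)
      then show ?thesis by (simp add: distrib_right)
    qed
    also have "\<dots> \<le> 2 * (LINT y|M. ?W x y * \<bar>e x - e y\<bar>)"
    proof -
      have "(LINT y|M. (h y + h' y) * \<bar>e x - e y\<bar>) \<le> (LINT y|M. ?W x y * \<bar>e x - e y\<bar>)"
      proof (rule integral_mono[OF _ We_int])
        show le: "(h y + h' y) * \<bar>e x - e y\<bar> \<le> ?W x y * \<bar>e x - e y\<bar>" for y
          using h_le(5) by (intro mult_right_mono) auto
        show "integrable M (\<lambda>y. (h y + h' y) * \<bar>e x - e y\<bar>)"
        proof (rule Bochner_Integration.integrable_bound[OF We_int[of x]])
          show "AE y in M. norm ((h y + h' y) * \<bar>e x - e y\<bar>) \<le> norm (?W x y * \<bar>e x - e y\<bar>)"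
            using h_le W_bd by (intro AE_I2) (auto simp: abs_mult intro!: mult_right_mono)
        qed measurable
      qed
      then show ?thesis by simp
    qed
    finally show ?thesis .
  qed
  show ?thesis
  proof (rule that[of "\<lambda>x. \<psi> x + P x" S])
    show "\<bar>\<psi> x + P x\<bar> \<le> R + \<beta>" for x using \<psi>(2)[of x] P_bd[of x] by linarith
    show "S y x = - S x y" for x y by (rule S_anti)
    have int: "integrable M (S x)" "integrable M (q x)" "integrable M (?S x)" "integrable M (\<rho> x)" for x
      using integrable_bounded[OF sec[OF S_meas] S_bd] integrable_bounded[OF sec[OF q(1)] q(2)]
        integrable_bounded[OF sec[OF \<rho>_meas] \<rho>_bd] sat_flux_integrable[OF \<psi>(1) b] by auto
    show "e x + (LINT y|M. q x y) = \<psi> x + P x + (LINT y|M. S x y)" for x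
      unfolding e P_def \<rho>_def using int by simp
    fix j j' J assume j: "smooth_convex j j' J"
    have j': "continuous_on UNIV j'" "continuous_on UNIV j" "0 \<le> J" using j by (auto simp: smooth_convex_def)
    note [measurable] = borel_measurable_continuous_onI[OF j'(1)]
    obtain C where C: "\<And>x. \<bar>x\<bar> \<le> R \<Longrightarrow> \<bar>j' x\<bar> \<le> C"
      by (rule continuous_bounded_on_interval[OF j'(1), of R]) blast
    define X where "X = (LINT p|(M \<Otimes>\<^sub>M M). ?W (fst p) (snd p) * \<bar>e (fst p) - e (snd p)\<bar>)"
    have X_int: "integrable (M \<Otimes>\<^sub>M M) (\<lambda>p. ?W (fst p) (snd p) * \<bar>e (fst p) - e (snd p)\<bar>)"
      by (rule integrable_sq_bounded[OF _ We_bd]) measurable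
    have X_it: "X = (LINT x|M. LINT y|M. ?W x y * \<bar>e x - e y\<bar>)"
      unfolding X_def by (rule iterated_integral[OF _ We_bd, symmetric]) measurable
    have jP: "\<bar>j' (\<psi> x) * P x\<bar> \<le> C * \<beta>" for x
      using C[OF \<psi>(2), of x] P_bd[of x] unfolding abs_mult by (intro mult_mono) auto
    have i: "integrable M (\<lambda>x. j' (\<psi> x) * P x)" by (rule integrable_bounded[OF _ jP]) measurable
    have i2: "integrable M (\<lambda>x. (P x)\<^sup>2)" by (rule integrable_bounded[OF _ abs_square_le[OF P_bd]]) measurable
    have i3: "integrable M (\<lambda>x. j (\<psi> x))" by (rule integrable_continuous_of_bounded[OF j'(2) \<psi>])
    have i4: "integrable M (\<lambda>x. j (\<psi> x + P x))"
    proof (rule integrable_continuous_of_bounded[OF j'(2)])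
      show "\<bar>\<psi> x + P x\<bar> \<le> R + \<beta>" for x using \<psi>(2)[of x] P_bd[of x] by linarith
    qed measurable
    have "(LINT x|M. j' (\<psi> x) * P x) = (LINT p|(M \<Otimes>\<^sub>M M). (j' (\<psi> (fst p)) - j' (\<psi> (snd p))) * \<rho> (fst p) (snd p)) / 2"
      unfolding P_def by (rule antisym_flux_integral[OF \<rho>_meas \<rho>_bd \<rho>_anti _ C[OF \<psi>(2)]]) measurable
    also have "\<dots> \<le> (J * X) / 2"
    proof (rule divide_right_mono)
      have jd: "\<bar>j' a - j' c\<bar> \<le> J * \<bar>a - c\<bar>" for a c
        using j by (cases "a \<le> c") (auto simp: smooth_convex_def abs_le_iff)
      have le: "(j' (\<psi> x) - j' (\<psi> y)) * \<rho> x y \<le> J * (?W x y * \<bar>e x - e y\<bar>)" for x y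
      proof -
        have "\<bar>(j' (\<psi> x) - j' (\<psi> y)) * \<rho> x y\<bar> \<le> (J * \<bar>e x - e y\<bar>) * ?W x y"
          unfolding abs_mult
          using order_trans[OF jd[of "\<psi> x" "\<psi> y"] mult_left_mono[OF \<psi>_le_e[of x y] j'(3)]] \<rho>_W[of x y] j'(3)
          by (intro mult_mono) auto
        then show ?thesis by (simp add: abs_le_iff mult_ac)
      qed
      have "(LINT p|(M \<Otimes>\<^sub>M M). (j' (\<psi> (fst p)) - j' (\<psi> (snd p))) * \<rho> (fst p) (snd p))
          \<le> (LINT p|(M \<Otimes>\<^sub>M M). J * (?W (fst p) (snd p) * \<bar>e (fst p) - e (snd p)\<bar>))"
      proof (rule integral_mono)
        show "integrable (M \<Otimes>\<^sub>M M) (\<lambda>p. (j' (\<psi> (fst p)) - j' (\<psi> (snd p))) * \<rho> (fst p) (snd p))"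
        proof (rule integrable_sq_bounded[where C="(2 * C) * \<beta>"])
          show "\<bar>(j' (\<psi> (fst p)) - j' (\<psi> (snd p))) * \<rho> (fst p) (snd p)\<bar> \<le> (2 * C) * \<beta>" for p
          proof -
            have "\<bar>j' (\<psi> (fst p)) - j' (\<psi> (snd p))\<bar> \<le> 2 * C"
              using C[OF \<psi>(2), of "fst p"] C[OF \<psi>(2), of "snd p"] by linarith
            then show ?thesis using \<rho>_bd[of "fst p" "snd p"] unfolding abs_mult by (intro mult_mono) auto
          qed
        qed measurable
        show "integrable (M \<Otimes>\<^sub>M M) (\<lambda>p. J * (?W (fst p) (snd p) * \<bar>e (fst p) - e (snd p)\<bar>))"
          using X_int by simp
      qed (rule le)
      then show "(LINT p|(M \<Otimes>\<^sub>M M). (j' (\<psi> (fst p)) - j' (\<psi> (snd p))) * \<rho> (fst p) (snd p)) \<le> J * X"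
        by (simp add: X_def)
    qed simp
    finally have first: "(LINT x|M. j' (\<psi> x) * P x) \<le> J * X / 2" .
    have second: "(LINT x|M. (P x)\<^sup>2) \<le> 2 * X"
    proof -
      have "integrable M (\<lambda>x. LINT y|M. ?W x y * \<bar>e x - e y\<bar>)"
        using sq.integrable_fst'[OF X_int] by simp
      then have "(LINT x|M. (P x)\<^sup>2) \<le> (LINT x|M. 2 * (LINT y|M. ?W x y * \<bar>e x - e y\<bar>))"
        using i2 P2 by (intro integral_mono) auto
      then show ?thesis by (simp add: X_it)
    qed
    have "(LINT x|M. j (\<psi> x + P x)) \<le> (LINT x|M. j (\<psi> x) + j' (\<psi> x) * P x + J / 2 * (P x)\<^sup>2)"
    proof (rule integral_mono)
      show "j (\<psi> x + P x) \<le> j (\<psi> x) + j' (\<psi> x) * P x + J / 2 * (P x)\<^sup>2" for x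
        using j unfolding smooth_convex_def by (metis add_diff_cancel_left')
    qed (use i i2 i3 i4 in auto)
    also have "\<dots> = (LINT x|M. j (\<psi> x)) + (LINT x|M. j' (\<psi> x) * P x) + J / 2 * (LINT x|M. (P x)\<^sup>2)"
      using i i2 i3 by simp
    also have "\<dots> \<le> (LINT x|M. j (\<psi> x)) + J * X / 2 + J / 2 * (2 * X)"
      using first second j'(3) by (intro add_mono mult_left_mono) auto
    finally show "(LINT x|M. j (\<psi> x + P x)) \<le> (LINT x|M. j (\<psi> x)) + 3 / 2 * J * X"
      by (simp add: algebra_simps)
  qed (use S_meas S_bd in auto)
qed

end

section \<open>Power norms of bounded functions\<close>

lemma powr_tangent:
  fixes x c p :: real
  assumes "0 \<le> x" "0 < c" "1 \<le> p"
  shows "c powr p + p * c powr (p - 1) * (x - c) \<le> x powr p"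
proof (cases "x = 0")
  case True
  have "c powr (p - 1) * c = c powr p" using assms by (simp add: powr_diff)
  then have "c powr p + p * c powr (p - 1) * (x - c) = (1 - p) * c powr p"
    using True by (simp add: algebra_simps)
  then show ?thesis using assms True by (simp add: mult_nonpos_nonneg)
next
  case False
  have "x powr p - c powr p \<ge> (p * c powr (p - 1)) * (x - c)"
    by (rule convex_on_imp_above_tangent[OF powr_convex[OF \<open>1 \<le> p\<close>]])
      (use assms False in \<open>auto intro!: derivative_eq_intros simp: interior_open connected_convex_1\<close>)
  then show ?thesis by simp
qed

lemma powr_convex_combination:
  fixes x y t p :: real
  assumes "0 \<le> x" "0 \<le> y" "0 \<le> t" "t \<le> 1" "1 \<le> p"
  shows "((1 - t) * x + t * y) powr p \<le> (1 - t) * x powr p + t * y powr p"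
proof (cases "(1 - t) * x + t * y = 0")
  case True
  then show ?thesis using assms by simp
next
  case False
  define c where "c = (1 - t) * x + t * y"
  have c: "0 < c" using False assms by (simp add: c_def order_less_le)
  define d where "d = p * c powr (p - 1)"
  have 1: "(1 - t) * (c powr p + d * (x - c)) \<le> (1 - t) * x powr p"
    using powr_tangent[OF assms(1) c assms(5)] assms by (intro mult_left_mono) (auto simp: d_def)
  have 2: "t * (c powr p + d * (y - c)) \<le> t * y powr p"
    using powr_tangent[OF assms(2) c assms(5)] assms by (intro mult_left_mono) (auto simp: d_def)
  have "c powr p = (1 - t) * (c powr p + d * (x - c)) + t * (c powr p + d * (y - c))"
    by (simp add: c_def algebra_simps)
  then show ?thesis using 1 2 unfolding c_def[symmetric] by linarith
qed

text \<open>
  On a probability space, and for bounded functions, this is the $L^p$ norm as a real number.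
\<close>

definition lpn :: "'b measure \<Rightarrow> real \<Rightarrow> ('b \<Rightarrow> real) \<Rightarrow> real" where
  "lpn N p f = (LINT x|N. \<bar>f x\<bar> powr p) powr (1 / p)"

lemma lpn_nonneg: "0 \<le> lpn N p f"
  by (simp add: lpn_def)

lemma lpn_powr: "0 < p \<Longrightarrow> lpn N p f powr p = (LINT x|N. \<bar>f x\<bar> powr p)"
  by (simp add: lpn_def powr_powr)

lemma lpn_le: "0 < p \<Longrightarrow> 0 \<le> c \<Longrightarrow> (LINT x|N. \<bar>f x\<bar> powr p) \<le> c powr p \<Longrightarrow> lpn N p f \<le> c"
  unfolding lpn_def using powr_mono2[of "1 / p" "LINT x|N. \<bar>f x\<bar> powr p" "c powr p"]
  by (simp add: powr_powr)

context prob_space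
begin

lemma powr_integrable:
  assumes "f \<in> borel_measurable M" "\<And>x. \<bar>f x\<bar> \<le> C" "0 < p"
  shows "integrable M (\<lambda>x. \<bar>f x :: real\<bar> powr p)"
proof (rule integrable_const_bound[where B="C powr p"])
  show "AE x in M. norm (\<bar>f x\<bar> powr p) \<le> C powr p"
    using assms by (auto intro!: powr_mono2)
qed (use assms in measurable)

lemma lpn_mono:
  assumes f: "f \<in> borel_measurable M" "g \<in> borel_measurable M" "\<And>x. \<bar>g x\<bar> \<le> C" and p: "0 < p"
    and le: "\<And>x. \<bar>f x\<bar> \<le> \<bar>g x\<bar>"
  shows "lpn M p f \<le> lpn M p g"
  unfolding lpn_def
proof (rule powr_mono2)
  have "\<bar>f x\<bar> \<le> C" for x using le[of x] f(3)[of x] by linarith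
  then show "(LINT x|M. \<bar>f x\<bar> powr p) \<le> (LINT x|M. \<bar>g x\<bar> powr p)"
    using powr_integrable[OF f(1) _ p] powr_integrable[OF f(2,3) p] le p
    by (intro integral_mono) (auto intro!: powr_mono2)
qed (use p in auto)

lemma lpn_const_bound:
  assumes "f \<in> borel_measurable M" "\<And>x. \<bar>f x\<bar> \<le> C" "0 < p"
  shows "lpn M p f \<le> C"
proof (rule lpn_le)
  show C: "0 \<le> C" using assms(2) order_trans abs_ge_zero by blast
  show "(LINT x|M. \<bar>f x\<bar> powr p) \<le> C powr p"
    using assms powr_integrable[OF assms] by (intro integral_le_const) (auto intro!: powr_mono2)
qed (rule assms)

text \<open>
  Minkowski's inequality, by convexity of the power at the weights \<open>a / (a + c)\<close> and \<open>c / (a + c)\<close>, where \<open>a\<close> and \<open>c\<close>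
  are positive numbers slightly above the two norms.
\<close>

lemma lpn_triangle:
  assumes f: "f \<in> borel_measurable M" "\<And>x. \<bar>f x\<bar> \<le> C" and g: "g \<in> borel_measurable M" "\<And>x. \<bar>g x\<bar> \<le> D"
    and p: "1 \<le> p"
  shows "lpn M p (\<lambda>x. f x + g x) \<le> lpn M p f + lpn M p g"
proof (rule field_le_epsilon)
  fix e :: real assume e: "0 < e"
  have p0: "0 < p" using p by simp
  define a where "a = lpn M p f + e / 2"
  define c where "c = lpn M p g + e / 2"
  have ac: "0 < a" "0 < c" using e lpn_nonneg[of M p f] lpn_nonneg[of M p g] by (auto simp: a_def c_def)
  note i = powr_integrable[OF f p0] powr_integrable[OF g p0]
  have If: "(LINT x|M. \<bar>f x\<bar> powr p) \<le> a powr p"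
    unfolding lpn_powr[OF p0, symmetric] using e p0 lpn_nonneg by (intro powr_mono2) (auto simp: a_def)
  have Ig: "(LINT x|M. \<bar>g x\<bar> powr p) \<le> c powr p"
    unfolding lpn_powr[OF p0, symmetric] using e p0 lpn_nonneg by (intro powr_mono2) (auto simp: c_def)
  define t where "t = c / (a + c)"
  have t: "0 \<le> t" "t \<le> 1" "1 - t = a / (a + c)" using ac by (auto simp: t_def field_simps)
  have pt: "\<bar>f x + g x\<bar> powr p \<le> (a + c) powr p * ((1 - t) * (\<bar>f x\<bar> powr p / a powr p) + t * (\<bar>g x\<bar> powr p / c powr p))" for x
  proof -
    have "\<bar>f x\<bar> + \<bar>g x\<bar> = (a + c) * ((1 - t) * (\<bar>f x\<bar> / a) + t * (\<bar>g x\<bar> / c))"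
    proof -
      have "(1 - t) * (\<bar>f x\<bar> / a) = \<bar>f x\<bar> / (a + c)" "t * (\<bar>g x\<bar> / c) = \<bar>g x\<bar> / (a + c)"
        using ac unfolding t(3) unfolding t_def by simp_all
      then show ?thesis using ac by (simp add: add_divide_distrib[symmetric])
    qed
    with abs_triangle_ineq[of "f x" "g x"]
    have "\<bar>f x + g x\<bar> \<le> (a + c) * ((1 - t) * (\<bar>f x\<bar> / a) + t * (\<bar>g x\<bar> / c))" by linarith
    then have "\<bar>f x + g x\<bar> powr p \<le> ((a + c) * ((1 - t) * (\<bar>f x\<bar> / a) + t * (\<bar>g x\<bar> / c))) powr p"
      using p0 by (intro powr_mono2) auto
    also have "\<dots> = (a + c) powr p * ((1 - t) * (\<bar>f x\<bar> / a) + t * (\<bar>g x\<bar> / c)) powr p"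
      using ac t by (simp only: powr_mult)
    also have "\<dots> \<le> (a + c) powr p * ((1 - t) * (\<bar>f x\<bar> / a) powr p + t * (\<bar>g x\<bar> / c) powr p)"
      using ac t p by (intro mult_left_mono powr_convex_combination) auto
    finally show ?thesis using ac by (simp add: powr_divide)
  qed
  have "\<bar>f x + g x\<bar> \<le> C + D" for x using f(2)[of x] g(2)[of x] by linarith
  then have i2: "integrable M (\<lambda>x. \<bar>f x + g x\<bar> powr p)" using f g p0 by (intro powr_integrable) auto
  have "(LINT x|M. \<bar>f x + g x\<bar> powr p)
      \<le> (LINT x|M. (a + c) powr p * ((1 - t) * (\<bar>f x\<bar> powr p / a powr p) + t * (\<bar>g x\<bar> powr p / c powr p)))"
    using i i2 pt by (intro integral_mono) auto
  also have "\<dots> = (a + c) powr p * ((1 - t) * ((LINT x|M. \<bar>f x\<bar> powr p) / a powr p) + t * ((LINT x|M. \<bar>g x\<bar> powr p) / c powr p))"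
    using i by simp
  also have "\<dots> \<le> (a + c) powr p * ((1 - t) * 1 + t * 1)"
    using If Ig t ac by (intro mult_left_mono add_mono) (auto simp: divide_le_eq)
  finally have "lpn M p (\<lambda>x. f x + g x) \<le> a + c"
    using ac p0 by (intro lpn_le) auto
  then show "lpn M p (\<lambda>x. f x + g x) \<le> lpn M p f + lpn M p g + e" by (simp add: a_def c_def)
qed

text \<open>
  Jensen's inequality: the tangent of the power at the absolute value of the mean is integrated.
\<close>

lemma abs_integral_powr_le:
  assumes f: "f \<in> borel_measurable M" "\<And>x. \<bar>f x :: real\<bar> \<le> C" and p: "1 \<le> p"
  shows "\<bar>LINT x|M. f x\<bar> powr p \<le> (LINT x|M. \<bar>f x\<bar> powr p)"
proof (cases "(LINT x|M. f x) = 0")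
  case True
  have "0 \<le> (LINT x|M. \<bar>f x\<bar> powr p)" by (rule Bochner_Integration.integral_nonneg) simp
  then show ?thesis unfolding True abs_zero powr_0 .
next
  case False
  define c where "c = \<bar>LINT x|M. f x\<bar>"
  have c: "0 < c" using False by (simp add: c_def)
  have i: "integrable M f" using f by (intro integrable_const_bound[where B=C]) auto
  note ip = powr_integrable[OF f, of p]
  have "c powr p \<le> c powr p + p * c powr (p - 1) * ((LINT x|M. \<bar>f x\<bar>) - c)"
    using p integral_abs_bound[of M f] by (simp add: c_def)
  also have "\<dots> = (LINT x|M. c powr p + p * c powr (p - 1) * (\<bar>f x\<bar> - c))"
    using i by (simp add: prob_space)
  also have "\<dots> \<le> (LINT x|M. \<bar>f x\<bar> powr p)"
    using i ip p c by (intro integral_mono powr_tangent) auto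
  finally show ?thesis by (simp add: c_def)
qed

lemma integral_abs_le_lpn:
  assumes f: "f \<in> borel_measurable M" "\<And>x. \<bar>f x\<bar> \<le> C" and p: "1 \<le> p"
  shows "(LINT x|M. \<bar>f x\<bar>) \<le> lpn M p f"
proof -
  have "((LINT x|M. \<bar>f x\<bar>) powr p) powr (1 / p) \<le> (LINT x|M. \<bar>f x\<bar> powr p) powr (1 / p)"
    using abs_integral_powr_le[of "\<lambda>x. \<bar>f x\<bar>" C p] f p by (intro powr_mono2) auto
  then show ?thesis using p by (simp add: powr_powr lpn_def)
qed

end

lemma (in flux_space) lpn_marginal:
  assumes h: "(\<lambda>q. h (fst q) (snd q)) \<in> borel_measurable (M \<Otimes>\<^sub>M M)" "\<And>x y. \<bar>h x y\<bar> \<le> C" and p: "1 \<le> p"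
  shows "lpn M p (\<lambda>x. LINT y|M. h x y) \<le> lpn (M \<Otimes>\<^sub>M M) p (\<lambda>q. h (fst q) (snd q))"
proof (rule lpn_le)
  note [measurable] = h(1)
  have m: "(\<lambda>x. LINT y|M. h x y) \<in> borel_measurable M"
    using h(1) by (intro borel_measurable_lebesgue_integral) (simp add: split_beta)
  have sec: "h x \<in> borel_measurable M" for x
    using measurable_compose[OF measurable_Pair1'[of x M M] h(1)] by (simp add: space_M)
  have "0 \<le> C" using h(2) order_trans abs_ge_zero by blast
  then have hp: "\<bar>\<bar>h x y\<bar> powr p\<bar> \<le> C powr p" for x y using h(2)[of x y] p by (auto intro!: powr_mono2)
  have "(LINT x|M. \<bar>LINT y|M. h x y\<bar> powr p) \<le> (LINT x|M. LINT y|M. \<bar>h x y\<bar> powr p)"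
  proof (rule integral_mono)
    show "integrable M (\<lambda>x. \<bar>LINT y|M. h x y\<bar> powr p)"
      using m abs_integral_le[OF sec h(2)] p by (intro powr_integrable[where C=C]) auto
    show "integrable M (\<lambda>x. LINT y|M. \<bar>h x y\<bar> powr p)"
      using sq.integrable_fst'[OF integrable_sq_bounded[of "\<lambda>q. \<bar>h (fst q) (snd q)\<bar> powr p" "C powr p"]] hp by simp
    show "\<bar>LINT y|M. h x y\<bar> powr p \<le> (LINT y|M. \<bar>h x y\<bar> powr p)" for x
      by (rule abs_integral_powr_le[OF sec h(2) p])
  qed
  also have "\<dots> = (LINT q|(M \<Otimes>\<^sub>M M). \<bar>h (fst q) (snd q)\<bar> powr p)"
    by (rule iterated_integral[OF _ hp]) measurable
  also have "\<dots> = lpn (M \<Otimes>\<^sub>M M) p (\<lambda>q. h (fst q) (snd q)) powr p" using p by (simp add: lpn_powr)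
  finally show "(LINT x|M. \<bar>LINT y|M. h x y\<bar> powr p) \<le> lpn (M \<Otimes>\<^sub>M M) p (\<lambda>q. h (fst q) (snd q)) powr p" .
qed (use p lpn_nonneg in auto)

lemma nondecreasing_away:
  fixes f :: "real \<Rightarrow> real"
  assumes "\<And>x. (f has_real_derivative f' x) (at x)" "\<And>x. 0 \<le> f' x * (x - a)"
  shows "f a \<le> f b"
proof (cases a b rule: linorder_cases)
  case less
  then obtain z where "a < z" "z < b" "f b - f a = (b - a) * f' z" using MVT2[of a b f f'] assms by blast
  moreover have "0 \<le> f' z" using assms(2)[of z] \<open>a < z\<close> by (auto simp: zero_le_mult_iff)
  then have "0 \<le> (b - a) * f' z" using less by simp
  ultimately show ?thesis by simp
next
  case greater
  then obtain z where z: "b < z" "z < a" "f a - f b = (a - b) * f' z" using MVT2[of b a f f'] assms by blast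
  have "f' z \<le> 0" using assms(2)[of z] z by (auto simp: zero_le_mult_iff)
  then have "(a - b) * f' z \<le> 0" using greater by (simp add: mult_nonneg_nonpos)
  then show ?thesis using z by simp
qed simp

lemma smooth_convexI:
  assumes j: "\<And>x. (j has_real_derivative j' x) (at x)" "\<And>x. (j' has_real_derivative j'' x) (at x)"
    and J: "\<And>x. 0 \<le> j'' x" "\<And>x. j'' x \<le> J"
  shows "smooth_convex j j' J"
proof -
  have incr: "0 \<le> j' b - j' a \<and> j' b - j' a \<le> J * (b - a)" if "a \<le> b" for a b
  proof (cases "a = b")
    case False
    then have "a < b" using that by simp
    then obtain z where "j' b - j' a = (b - a) * j'' z" using MVT2[of a b j' j''] j(2) by blast
    then show ?thesis using J[of z] that by (simp add: mult.commute[of J] mult_left_mono)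
  qed simp
  have lower: "j a + j' a * (b - a) \<le> j b" for a b
  proof -
    have "(\<lambda>x. j x - j' a * x) a \<le> (\<lambda>x. j x - j' a * x) b"
    proof (rule nondecreasing_away[where f="\<lambda>x. j x - j' a * x" and f'="\<lambda>x. j' x - j' a"])
      show "((\<lambda>x. j x - j' a * x) has_real_derivative j' x - j' a) (at x)" for x
        by (intro DERIV_diff j DERIV_cmult_Id)
      show "0 \<le> (j' x - j' a) * (x - a)" for x
        using incr[of x a] incr[of a x] by (cases "a \<le> x") (auto simp: mult_nonpos_nonpos)
    qed
    then show ?thesis by (simp add: algebra_simps)
  qed
  have upper: "j b \<le> j a + j' a * (b - a) + J / 2 * (b - a)\<^sup>2" for a b
  proof -
    have "(\<lambda>x. j' a * x + J / 2 * (x - a)\<^sup>2 - j x) a \<le> (\<lambda>x. j' a * x + J / 2 * (x - a)\<^sup>2 - j x) b"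
    proof (rule nondecreasing_away[where f="\<lambda>x. j' a * x + J / 2 * (x - a)\<^sup>2 - j x"
          and f'="\<lambda>x. j' a + J * (x - a) - j' x"])
      show "((\<lambda>x. j' a * x + J / 2 * (x - a)\<^sup>2 - j x) has_real_derivative j' a + J * (x - a) - j' x) (at x)" for x
        by (auto intro!: derivative_eq_intros j)
      show "0 \<le> (j' a + J * (x - a) - j' x) * (x - a)" for x
      proof (cases "a \<le> x")
        case True
        then show ?thesis using incr[of a x] by (intro mult_nonneg_nonneg) auto
      next
        case False
        then show ?thesis using incr[of x a] by (intro mult_nonpos_nonpos) (auto simp: right_diff_distrib)
      qed
    qed
    then show ?thesis by (simp add: algebra_simps)
  qed
  have J0: "0 \<le> J" using J order_trans by blast
  have "continuous_on UNIV j" "continuous_on UNIV j'"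
    using DERIV_continuous_on[of UNIV j j'] DERIV_continuous_on[of UNIV j' j''] j by auto
  then show ?thesis unfolding smooth_convex_def using J0 lower upper incr by blast
qed

text \<open>
  For $p < 2$ the power $|z|^p$ has an unbounded second derivative. Smoothing it at the scale \<open>\<tau>\<close> bounds
  the second derivative, at the price of an error \<open>\<tau>\<close> in the norm.
\<close>

lemma smoothed_power:
  fixes p \<tau> :: real
  assumes p: "1 < p" "p \<le> 2" and \<tau>: "0 < \<tau>"
  shows "\<exists>j'. smooth_convex (\<lambda>z. sqrt (z\<^sup>2 + \<tau>\<^sup>2) powr p) j' (p * \<tau> powr (p - 2))"
proof -
  define q where "q z = z\<^sup>2 + \<tau>\<^sup>2" for z
  have q: "0 < q z" for z using \<tau> by (simp add: q_def add_nonneg_pos)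
  have dq: "(q has_real_derivative 2 * z) (at z)" for z
    unfolding q_def by (auto intro!: derivative_eq_intros)
  have dpow: "((\<lambda>z. q z powr r) has_real_derivative r * q z powr (r - 1) * (2 * z)) (at z)" for r z
    by (rule DERIV_chain2[OF has_real_derivative_powr[OF q] dq])
  define j' where "j' z = p * z * q z powr (p / 2 - 1)" for z
  define j'' where "j'' z = p * q z powr (p / 2 - 1) + p * z * ((p / 2 - 1) * q z powr (p / 2 - 2) * (2 * z))" for z
  have j''_eq: "j'' z = p * q z powr (p / 2 - 2) * ((p - 1) * z\<^sup>2 + \<tau>\<^sup>2)" for z
  proof -
    have "q z powr (p / 2 - 1) = q z powr (p / 2 - 2) * q z"
      using powr_add[of "q z" "p / 2 - 2" 1] q[of z] by simp
    then show ?thesis unfolding j''_def by (simp add: q_def power2_eq_square algebra_simps)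
  qed
  have "smooth_convex (\<lambda>z. q z powr (p / 2)) j' (p * \<tau> powr (p - 2))"
  proof (rule smooth_convexI[where j''=j''])
    show "((\<lambda>z. q z powr (p / 2)) has_real_derivative j' x) (at x)" for x
      using dpow[of "p / 2" x] by (simp add: j'_def mult_ac)
    show "(j' has_real_derivative j'' x) (at x)" for x
    proof -
      have "((\<lambda>z. p * z * q z powr (p / 2 - 1)) has_real_derivative
          p * q x powr (p / 2 - 1) + (p / 2 - 1) * q x powr (p / 2 - 1 - 1) * (2 * x) * (p * x)) (at x)"
        by (rule DERIV_mult[OF DERIV_cmult_Id dpow])
      moreover have "p / 2 - 1 - 1 = p / 2 - 2" by simp
      ultimately show ?thesis unfolding j'_def j''_def by (simp only: mult_ac)
    qed
    show "0 \<le> j'' x" for x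
      unfolding j''_eq using p by (intro mult_nonneg_nonneg) auto
    show "j'' x \<le> p * \<tau> powr (p - 2)" for x
    proof -
      have "p * q x powr (p / 2 - 2) * ((p - 1) * x\<^sup>2 + \<tau>\<^sup>2) \<le> p * q x powr (p / 2 - 2) * q x"
        using p by (intro mult_left_mono) (auto simp: q_def intro!: mult_left_le_one_le)
      also have "\<dots> = p * q x powr (p / 2 - 1)"
        using powr_add[of "q x" "p / 2 - 2" 1] q[of x] by simp
      also have "\<dots> \<le> p * (\<tau>\<^sup>2) powr (p / 2 - 1)"
        using p \<tau> by (intro mult_left_mono powr_mono2') (auto simp: q_def)
      also have "(\<tau>\<^sup>2) powr (p / 2 - 1) = \<tau> powr (p - 2)"
      proof -
        have "\<tau>\<^sup>2 = \<tau> powr 2" using \<tau> by simp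
        then have "(\<tau>\<^sup>2) powr (p / 2 - 1) = \<tau> powr (2 * (p / 2 - 1))" by (simp only: powr_powr)
        also have "2 * (p / 2 - 1) = p - 2" by simp
        finally show ?thesis .
      qed
      finally show ?thesis by (simp add: j''_eq)
    qed
  qed
  moreover have "q z powr (p / 2) = sqrt (z\<^sup>2 + \<tau>\<^sup>2) powr p" for z
  proof -
    have "sqrt (q z) = q z powr (1 / 2)" using q[of z] by (simp add: powr_half_sqrt)
    then have "sqrt (q z) powr p = q z powr (1 / 2 * p)" by (simp only: powr_powr)
    then show ?thesis by (simp add: q_def)
  qed
  ultimately show ?thesis by auto
qed

text \<open>
  Turns an increment \<open>i\<close> of a \<open>p\<close>-th power into an increment of the norm \<open>A\<close>. The smoothing keeps \<open>A\<close> above \<open>\<tau>\<close>.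
\<close>

lemma powr_perturb:
  fixes A i \<tau> p :: real
  assumes "\<tau> \<le> A" "0 < \<tau>" "0 \<le> i" "1 \<le> p"
  shows "(A powr p + i) powr (1 / p) \<le> A + i * \<tau> powr (1 - p)"
proof -
  define \<delta> where "\<delta> = i * \<tau> powr (1 - p)"
  have \<delta>: "0 \<le> \<delta>" using assms by (simp add: \<delta>_def)
  have "i \<le> p * A powr (p - 1) * \<delta>"
  proof -
    have "1 \<le> A powr (p - 1) * \<tau> powr (1 - p)"
    proof -
      have "\<tau> powr (p - 1) * \<tau> powr (1 - p) = 1" using assms by (simp add: powr_add[symmetric])
      moreover have "\<tau> powr (p - 1) \<le> A powr (p - 1)" using assms by (intro powr_mono2) auto
      then have "\<tau> powr (p - 1) * \<tau> powr (1 - p) \<le> A powr (p - 1) * \<tau> powr (1 - p)"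
        by (rule mult_right_mono) simp
      ultimately show ?thesis by simp
    qed
    then have "1 * 1 \<le> p * (A powr (p - 1) * \<tau> powr (1 - p))" using assms by (intro mult_mono) auto
    then have "i * (1 * 1) \<le> i * (p * (A powr (p - 1) * \<tau> powr (1 - p)))" using assms by (intro mult_left_mono) auto
    then show ?thesis by (simp add: \<delta>_def mult_ac)
  qed
  then have "A powr p + i \<le> (A + \<delta>) powr p"
    using powr_tangent[of "A + \<delta>" A p] assms \<delta> by simp
  then have "(A powr p + i) powr (1 / p) \<le> ((A + \<delta>) powr p) powr (1 / p)"
    using assms by (intro powr_mono2) auto
  then show ?thesis using assms \<delta> by (simp add: powr_powr \<delta>_def)
qed

lemma time_Fubini:
  fixes f :: "real \<Rightarrow> 'b \<Rightarrow> real"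
  assumes N: "prob_space N" and f: "(\<lambda>(r, x). f r x) \<in> borel_measurable (borel \<Otimes>\<^sub>M N)" and C: "\<And>r x. \<bar>f r x\<bar> \<le> C"
  shows "(LINT x|N. LINT r|time_measure s t. f r x) = (LINT r|time_measure s t. LINT x|N. f r x)"
    and "(\<lambda>x. LINT r|time_measure s t. f r x) \<in> borel_measurable N"
    and "(\<lambda>r. LINT x|N. f r x) \<in> borel_measurable borel"
proof -
  interpret N: prob_space N by (rule N)
  interpret T: finite_measure "time_measure s t" by (rule finite_time_measure)
  interpret P: pair_sigma_finite "time_measure s t" N ..
  have sets: "sets (time_measure s t \<Otimes>\<^sub>M N) = sets (borel \<Otimes>\<^sub>M N)"
    by (rule sets_pair_measure_cong) auto
  have f': "case_prod f \<in> borel_measurable (time_measure s t \<Otimes>\<^sub>M N)"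
    using f by (subst measurable_cong_sets[OF sets refl]) simp
  interpret F: finite_measure "time_measure s t \<Otimes>\<^sub>M N"
    by (rule finite_measure_pair_measure) unfold_locales
  have "integrable (time_measure s t \<Otimes>\<^sub>M N) (case_prod f)"
    using f' C by (intro F.integrable_const_bound[where B=C]) auto
  from P.Fubini_integral[OF this]
  show "(LINT x|N. LINT r|time_measure s t. f r x) = (LINT r|time_measure s t. LINT x|N. f r x)" .
  have "(\<lambda>(x, r). f r x) \<in> borel_measurable (N \<Otimes>\<^sub>M time_measure s t)"
    using measurable_compose[OF measurable_pair_swap' f'] by (simp add: split_beta)
  then show "(\<lambda>x. LINT r|time_measure s t. f r x) \<in> borel_measurable N"
    by (rule T.borel_measurable_lebesgue_integral)
  show "(\<lambda>r. LINT x|N. f r x) \<in> borel_measurable borel"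
    using f by (intro N.borel_measurable_lebesgue_integral) simp
qed

section \<open>The error of explicit Euler steps\<close>

lemma time_integral_le:
  assumes f: "f \<in> borel_measurable borel" "\<And>r. \<bar>f r\<bar> \<le> (C::real)" and st: "s \<le> t"
    and le: "\<And>r. s \<le> r \<Longrightarrow> r \<le> t \<Longrightarrow> f r \<le> D"
  shows "(LINT r|time_measure s t. f r) \<le> (t - s) * D"
proof -
  have "integral {s..t} f \<le> integral {s..t} (\<lambda>_. D)"
    using time_integral(1)[OF f] le by (intro integral_le) auto
  then show ?thesis unfolding time_integral(2)[OF f] using st by simp
qed

lemma time_integral_abs_le:
  assumes f: "f \<in> borel_measurable borel" "\<And>r. \<bar>f r\<bar> \<le> (C::real)" and st: "s \<le> t"
    and le: "\<And>r. s \<le> r \<Longrightarrow> r \<le> t \<Longrightarrow> \<bar>f r\<bar> \<le> D"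
  shows "\<bar>LINT r|time_measure s t. f r\<bar> \<le> (t - s) * D"
proof -
  have "(LINT r|time_measure s t. f r) \<le> (t - s) * D"
    using le by (intro time_integral_le[OF f st]) (auto simp: abs_le_iff)
  moreover have "(LINT r|time_measure s t. - f r) \<le> (t - s) * D"
    using le f by (intro time_integral_le[OF _ _ st, of _ C]) (auto simp: abs_le_iff)
  ultimately show ?thesis by (auto simp: abs_le_iff)
qed

lemma time_integral_const: "s \<le> t \<Longrightarrow> (LINT r|time_measure s t. (c::real)) = (t - s) * c"
  using time_integral(2)[of "\<lambda>_. c" "\<bar>c\<bar>" s t] by simp

context flux
begin

text \<open>
  Here \<open>r\<close> and \<open>s\<close> are differences of the exact solution at two times, and \<open>m\<close> is the difference of the
  numerical solution. Monotonicity removes \<open>m\<close> from the bound. If \<open>m\<close> lies between \<open>r\<close> and \<open>s\<close>, both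
  factors on the left are dominated by those on the right, and otherwise the left side is nonpositive.
\<close>

lemma theta_three_point: "(\<theta> r - \<theta> m) * (m - s) \<le> (\<theta> r - \<theta> s) * (r - s)"
proof -
  have "(\<theta> r - \<theta> s) * (r - s) - (\<theta> r - \<theta> m) * (m - s) = (\<theta> m - \<theta> s) * (m - s) + (\<theta> r - \<theta> m) * (r - m)
      + (\<theta> m - \<theta> s) * (r - m)"
    by (simp add: algebra_simps)
  show ?thesis
  proof (cases "m \<le> r")
    case True
    show ?thesis
    proof (cases "s \<le> m")
      case sm: True
      then show ?thesis using True theta_le[of m r] theta_le[of s m] by (intro mult_mono) auto
    next
      case False
      then have "(\<theta> r - \<theta> m) * (m - s) \<le> 0" using True theta_le[of m r] by (intro mult_nonneg_nonpos) auto
      then show ?thesis using theta_diff_mult_nonneg[of r s] by simp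
    qed
  next
    case False
    show ?thesis
    proof (cases "s \<le> m")
      case True
      then have "(\<theta> r - \<theta> m) * (m - s) \<le> 0" using False theta_le[of r m] by (intro mult_nonpos_nonneg) auto
      then show ?thesis using theta_diff_mult_nonneg[of r s] by simp
    next
      case sm: False
      have "(\<theta> m - \<theta> r) * (s - m) \<le> (\<theta> s - \<theta> r) * (s - r)"
        using False sm theta_le[of r m] theta_le[of m s] by (intro mult_mono) auto
      then show ?thesis by (simp add: algebra_simps)
    qed
  qed
qed

lemma eul_bounded:
  assumes k: "sym_kernel k \<kappa>" and g: "g \<in> borel_measurable M" "\<And>x. \<bar>g x\<bar> \<le> G"
  shows "\<exists>R. \<forall>x. \<bar>eul k g \<sigma> h x\<bar> \<le> R"
proof (induction h)
  case (Suc h)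
  then obtain R where R: "\<And>x. \<bar>eul k g \<sigma> h x\<bar> \<le> R" by blast
  have "\<bar>eul k g \<sigma> (Suc h) x\<bar> \<le> R + \<bar>\<sigma> h\<bar> * (\<kappa> * B)" for x
  proof -
    have "\<bar>\<sigma> h * F k (eul k g \<sigma> h) x\<bar> \<le> \<bar>\<sigma> h\<bar> * (\<kappa> * B)"
      unfolding abs_mult using F_bound[OF k eul_meas[OF k g(1)], of \<sigma> h x] by (intro mult_left_mono) auto
    then show ?thesis using R[of x] by simp
  qed
  then show ?case by blast
qed (use g in auto)

text \<open>
  The kernel \<open>k\<close> belongs to the exact solution and \<open>k'\<close> to the scheme. The bound \<open>B'\<close> concerns the values of \<open>\<theta>\<close>
  along the exact solution only. Unlike \<open>B\<close> it does not grow with the level of the truncation, and so it may enter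
  the factor of the kernel difference.
\<close>

context
  fixes k k' :: "'a \<Rightarrow> 'a \<Rightarrow> real" and \<kappa> \<kappa>' :: real and g :: "'a \<Rightarrow> real" and G B' :: real
  assumes k: "sym_kernel k \<kappa>" and k': "sym_kernel k' \<kappa>'"
    and g: "g \<in> borel_measurable M" "\<And>x. \<bar>g x\<bar> \<le> G"
    and B': "\<And>r x y. \<bar>\<theta> (sol k g r y - sol k g r x)\<bar> \<le> B'"
begin

private abbreviation (input) "U \<equiv> sol k g"
private abbreviation (input) "V t \<equiv> F k (sol k g t)"

definition integrated_flux :: "real \<Rightarrow> real \<Rightarrow> 'a \<Rightarrow> 'a \<Rightarrow> real" where
  "integrated_flux s t x y = (LINT r|time_measure s t. \<theta> (U r y - U r x))"

text \<open>
  The difference between the flux of the exact solution over a step and that of the scheme started at \<open>z\<close>, both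
  taken with the kernel of the scheme.
\<close>

definition step_flux :: "real \<Rightarrow> real \<Rightarrow> ('a \<Rightarrow> real) \<Rightarrow> 'a \<Rightarrow> 'a \<Rightarrow> real" where
  "step_flux s t z x y = k' x y * (integrated_flux s t x y - (t - s) * \<theta> (z y - z x))"

text \<open>
  What replacing \<open>k\<close> by \<open>k'\<close> changes in the increment of the exact solution.
\<close>

definition kernel_defect :: "real \<Rightarrow> real \<Rightarrow> 'a \<Rightarrow> real" where
  "kernel_defect s t x = (LINT y|M. (k x y - k' x y) * integrated_flux s t x y)"

lemma u_pair_meas:
  "(\<lambda>(r, p). U r (fst p)) \<in> borel_measurable (borel \<Otimes>\<^sub>M (M \<Otimes>\<^sub>M M))"
  "(\<lambda>(r, p). U r (snd p)) \<in> borel_measurable (borel \<Otimes>\<^sub>M (M \<Otimes>\<^sub>M M))"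
  using measurable_compose[of "\<lambda>x. (fst x, fst (snd x))" "borel \<Otimes>\<^sub>M (M \<Otimes>\<^sub>M M)", OF _ sol_joint_meas[OF k g(1)]]
    measurable_compose[of "\<lambda>x. (fst x, snd (snd x))" "borel \<Otimes>\<^sub>M (M \<Otimes>\<^sub>M M)", OF _ sol_joint_meas[OF k g(1)]]
  by (simp_all add: split_beta)

lemma u_time_meas: "(\<lambda>r. U r x) \<in> borel_measurable borel"
  using measurable_compose[OF measurable_Pair2'[of x M borel] sol_joint_meas[OF k g(1)]]
  by (simp add: space_M)

lemma theta_pair_meas:
  "(\<lambda>(r, p). \<theta> (U r (snd p) - U r (fst p))) \<in> borel_measurable (borel \<Otimes>\<^sub>M (M \<Otimes>\<^sub>M M))"
  using u_pair_meas unfolding split_beta by measurable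

lemma integrated_flux_meas: "(\<lambda>p. integrated_flux s t (fst p) (snd p)) \<in> borel_measurable (M \<Otimes>\<^sub>M M)"
  unfolding integrated_flux_def
  using time_Fubini(2)[OF sq.P.prob_space_axioms theta_pair_meas, where C=B] theta_bound by simp

lemma theta_time_meas: "(\<lambda>r. \<theta> (U r y - U r x)) \<in> borel_measurable borel"
  using u_time_meas[of x] u_time_meas[of y] by measurable

lemma integrated_flux_bound: "s \<le> t \<Longrightarrow> \<bar>integrated_flux s t x y\<bar> \<le> (t - s) * B'"
  unfolding integrated_flux_def using theta_time_meas theta_bound B' by (intro time_integral_abs_le[where C=B]) auto

lemma integrated_flux_antisym: "integrated_flux s t y x = - integrated_flux s t x y"
proof -
  have "integrated_flux s t y x = (LINT r|time_measure s t. - \<theta> (U r y - U r x))"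
    unfolding integrated_flux_def using theta_odd[of "U _ y - U _ x"] by simp
  then show ?thesis by (simp add: integrated_flux_def)
qed

lemma u_increment:
  assumes st: "0 \<le> s" "s \<le> t"
  shows "U t x - U s x = (LINT y|M. k x y * integrated_flux s t x y)"
proof -
  have m: "(\<lambda>(r, y). k x y * \<theta> (U r y - U r x)) \<in> borel_measurable (borel \<Otimes>\<^sub>M M)"
  proof -
    have [measurable]: "(\<lambda>p. U (fst p) (snd p)) \<in> borel_measurable (borel \<Otimes>\<^sub>M M)"
      using sol_joint_meas[OF k g(1)] by (simp add: split_beta)
    have [measurable]: "k x \<in> borel_measurable M" by (rule section_meas[OF sym_kernel_meas[OF k]])
    note [measurable] = u_time_meas[of x]
    show ?thesis unfolding split_beta by measurable
  qed
  have bd: "\<bar>k x y * \<theta> (U r y - U r x)\<bar> \<le> \<kappa> * B" for r y by (rule flux_integrand_bound[OF k])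
  note Fub = time_Fubini[OF prob_space_axioms m bd]
  have vm: "(\<lambda>r. V r x) \<in> borel_measurable borel" using Fub(3) by (simp add: F_def)
  have "((\<lambda>r. V r x) has_integral U t x - U s x) {s..t}"
  proof (rule fundamental_theorem_of_calculus[OF st(2)])
    fix r assume "r \<in> {s..t}"
    then have "((\<lambda>r. U r x) has_real_derivative V r x) (at r within {s..t})"
      by (intro DERIV_subset[OF u_deriv[OF k g]]) (use st in auto)
    then show "((\<lambda>r. U r x) has_vector_derivative V r x) (at r within {s..t})"
      by (simp add: has_real_derivative_iff_has_vector_derivative)
  qed
  then have "U t x - U s x = integral {s..t} (\<lambda>r. V r x)" by (simp add: integral_unique)
  also have "\<dots> = (LINT r|time_measure s t. V r x)"
    by (rule time_integral(2)[OF vm v_bound[OF k g], symmetric])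
  also have "\<dots> = (LINT y|M. LINT r|time_measure s t. k x y * \<theta> (U r y - U r x))"
    unfolding F_def by (rule Fub(1)[symmetric])
  finally show ?thesis by (simp add: integrated_flux_def)
qed

lemma u_slow:
  assumes st: "0 \<le> s" "s \<le> t"
  shows "\<bar>U t x - U s x\<bar> \<le> \<kappa> * B' * (t - s)"
  unfolding u_increment[OF st]
proof (rule abs_integral_le)
  show "(\<lambda>y. k x y * integrated_flux s t x y) \<in> borel_measurable M"
    using kernel_pair_meas[OF k] integrated_flux_meas[of s t]
    by (intro section_meas[of "\<lambda>x y. k x y * integrated_flux s t x y"]) (simp add: split_beta)
  show "\<bar>k x y * integrated_flux s t x y\<bar> \<le> \<kappa> * B' * (t - s)" for y
    using mult_mono[of "\<bar>k x y\<bar>" \<kappa> "\<bar>integrated_flux s t x y\<bar>" "(t - s) * B'"] sym_kernel_bounds[OF k, of x y]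
      integrated_flux_bound[OF st(2), of x y] sym_kernel_const[OF k] by (simp add: abs_mult mult_ac)
qed

lemma B'_nonneg: "0 \<le> B'"
  using B' order_trans abs_ge_zero by blast

lemma step_flux_meas:
  assumes [measurable]: "z \<in> borel_measurable M"
  shows "(\<lambda>p. step_flux s t z (fst p) (snd p)) \<in> borel_measurable (M \<Otimes>\<^sub>M M)"
proof -
  note [measurable] = kernel_pair_meas[OF k'] integrated_flux_meas
  show ?thesis unfolding step_flux_def by measurable
qed

lemma step_flux_bound:
  assumes st: "s \<le> t"
  shows "\<bar>step_flux s t z x y\<bar> \<le> \<kappa>' * (2 * B * (t - s))"
proof -
  have "\<bar>integrated_flux s t x y\<bar> \<le> (t - s) * B"
    unfolding integrated_flux_def using theta_time_meas theta_bound st by (intro time_integral_abs_le[where C=B]) auto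
  moreover have "\<bar>(t - s) * \<theta> (z y - z x)\<bar> \<le> (t - s) * B"
    using theta_bound[of "z y - z x"] st by (simp add: abs_mult mult_left_mono)
  ultimately have "\<bar>integrated_flux s t x y - (t - s) * \<theta> (z y - z x)\<bar> \<le> 2 * B * (t - s)"
    by (simp add: abs_le_iff algebra_simps)
  then show ?thesis unfolding step_flux_def abs_mult
    using sym_kernel_bounds[OF k', of x y] sym_kernel_const[OF k'] by (intro mult_mono) auto
qed

lemma step_flux_antisym: "step_flux s t z y x = - step_flux s t z x y"
  using integrated_flux_antisym[of s t y x] sym_kernel_sym[OF k', of y x] theta_odd[of "z y - z x"]
  by (simp add: step_flux_def algebra_simps)

lemma kernel_defect_meas: "kernel_defect s t \<in> borel_measurable M"
proof -
  note [measurable] = kernel_pair_meas[OF k'] kernel_pair_meas[OF k] integrated_flux_meas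
  have "(\<lambda>p. (k (fst p) (snd p) - k' (fst p) (snd p)) * integrated_flux s t (fst p) (snd p)) \<in> borel_measurable (M \<Otimes>\<^sub>M M)"
    by measurable
  then show ?thesis unfolding kernel_defect_def
    by (intro borel_measurable_lebesgue_integral) (simp add: split_beta)
qed

lemma kernel_diff_bound: "\<bar>k x y - k' x y\<bar> \<le> \<kappa> + \<kappa>'"
  using sym_kernel_bounds[OF k, of x y] sym_kernel_bounds[OF k', of x y] by (simp add: abs_le_iff)

lemma kernel_defect_integrand_bound:
  assumes "s \<le> t"
  shows "\<bar>(k x y - k' x y) * integrated_flux s t x y\<bar> \<le> (\<kappa> + \<kappa>') * ((t - s) * B')"
  unfolding abs_mult using kernel_diff_bound[of x y] integrated_flux_bound[OF assms, of x y]
    sym_kernel_const[OF k] sym_kernel_const[OF k'] by (intro mult_mono) auto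

lemma kernel_defect_bound:
  assumes "s \<le> t"
  shows "\<bar>kernel_defect s t x\<bar> \<le> (\<kappa> + \<kappa>') * ((t - s) * B')"
  unfolding kernel_defect_def
proof (rule abs_integral_le[OF _ kernel_defect_integrand_bound[OF assms]])
  note [measurable] = kernel_pair_meas[OF k'] kernel_pair_meas[OF k] integrated_flux_meas
  show "(\<lambda>y. (k x y - k' x y) * integrated_flux s t x y) \<in> borel_measurable M"
    by (rule section_meas[of "\<lambda>x y. (k x y - k' x y) * integrated_flux s t x y"]) (simp add: split_beta)
qed

lemma kernel_defect_lpn:
  assumes st: "s \<le> t" and p: "1 \<le> p"
  shows "lpn M p (kernel_defect s t) \<le> (t - s) * B' * lpn (M \<Otimes>\<^sub>M M) p (\<lambda>q. k (fst q) (snd q) - k' (fst q) (snd q))"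
proof -
  note [measurable] = kernel_pair_meas[OF k'] kernel_pair_meas[OF k] integrated_flux_meas
  have c: "0 \<le> (t - s) * B'" using st B'_nonneg by simp
  have "lpn M p (kernel_defect s t)
      \<le> lpn (M \<Otimes>\<^sub>M M) p (\<lambda>q. (k (fst q) (snd q) - k' (fst q) (snd q)) * integrated_flux s t (fst q) (snd q))"
    unfolding kernel_defect_def[abs_def]
    by (rule lpn_marginal[OF _ kernel_defect_integrand_bound[OF st] p]) measurable
  also have "\<dots> \<le> (t - s) * B' * lpn (M \<Otimes>\<^sub>M M) p (\<lambda>q. k (fst q) (snd q) - k' (fst q) (snd q))"
  proof (rule lpn_le)
    let ?d = "\<lambda>q. k (fst q) (snd q) - k' (fst q) (snd q)"
    have i: "integrable (M \<Otimes>\<^sub>M M) (\<lambda>q. \<bar>?d q\<bar> powr p)"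
      using p kernel_diff_bound by (intro sq.P.powr_integrable[where C="\<kappa> + \<kappa>'"]) auto
    have "(LINT q|(M \<Otimes>\<^sub>M M). \<bar>?d q * integrated_flux s t (fst q) (snd q)\<bar> powr p)
        \<le> (LINT q|(M \<Otimes>\<^sub>M M). ((t - s) * B') powr p * \<bar>?d q\<bar> powr p)"
    proof (rule integral_mono)
      show "integrable (M \<Otimes>\<^sub>M M) (\<lambda>q. \<bar>?d q * integrated_flux s t (fst q) (snd q)\<bar> powr p)"
        using p kernel_defect_integrand_bound[OF st] by (intro sq.P.powr_integrable) auto
      show "\<bar>?d q * integrated_flux s t (fst q) (snd q)\<bar> powr p \<le> ((t - s) * B') powr p * \<bar>?d q\<bar> powr p" for q
      proof -
        have "\<bar>?d q * integrated_flux s t (fst q) (snd q)\<bar> \<le> ((t - s) * B') * \<bar>?d q\<bar>"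
          using integrated_flux_bound[OF st, of "fst q" "snd q"]
          unfolding abs_mult by (subst mult.commute) (intro mult_right_mono, auto)
        then have "\<bar>?d q * integrated_flux s t (fst q) (snd q)\<bar> powr p \<le> (((t - s) * B') * \<bar>?d q\<bar>) powr p"
          using p by (intro powr_mono2) auto
        then show ?thesis by (simp only: powr_mult)
      qed
    qed (use i in simp)
    also have "\<dots> = ((t - s) * B' * lpn (M \<Otimes>\<^sub>M M) p ?d) powr p"
      using p by (simp add: powr_mult lpn_powr)
    finally show "(LINT q|(M \<Otimes>\<^sub>M M). \<bar>?d q * integrated_flux s t (fst q) (snd q)\<bar> powr p)
        \<le> ((t - s) * B' * lpn (M \<Otimes>\<^sub>M M) p ?d) powr p" .
  qed (use p mult_nonneg_nonneg[OF c lpn_nonneg] in auto)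
  finally show ?thesis .
qed

lemma error_increment:
  assumes st: "0 \<le> s" "s \<le> t" and z: "z \<in> borel_measurable M"
  shows "U t x - (z x + (t - s) * F k' z x) = (U s x - z x + (LINT y|M. step_flux s t z x y)) + kernel_defect s t x"
proof -
  note [measurable] = kernel_pair_meas[OF k'] kernel_pair_meas[OF k] integrated_flux_meas step_flux_meas[OF z]
  have i1: "integrable M (step_flux s t z x)"
    by (rule integrable_bounded[OF section_meas step_flux_bound[OF st(2)]]) (simp add: split_beta)
  have i2: "integrable M (\<lambda>y. (k x y - k' x y) * integrated_flux s t x y)"
    by (rule integrable_bounded[OF section_meas[of "\<lambda>x y. (k x y - k' x y) * integrated_flux s t x y"]
          kernel_defect_integrand_bound[OF st(2)]]) (simp add: split_beta)
  have i3: "integrable M (\<lambda>y. (t - s) * (k' x y * \<theta> (z y - z x)))"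
    using flux_integrand_section[OF k' z, of x] by simp
  have "U t x - U s x = (LINT y|M. step_flux s t z x y + (k x y - k' x y) * integrated_flux s t x y + (t - s) * (k' x y * \<theta> (z y - z x)))"
    unfolding u_increment[OF st] step_flux_def by (intro Bochner_Integration.integral_cong) (auto simp: algebra_simps)
  also have "\<dots> = (LINT y|M. step_flux s t z x y) + kernel_defect s t x + (t - s) * F k' z x"
    using i1 i2 i3 by (simp add: kernel_defect_def F_def)
  finally show ?thesis by simp
qed

text \<open>
  In each pair, \<open>theta_three_point\<close> integrated over the step bounds the work by \<open>k'\<close> times \<open>Y\<close>, which depends on the
  exact solution alone. Replacing \<open>k'\<close> by \<open>k\<close> turns this into the dissipation of the exact solution; the
  replacement is paid for by the crude bound \<open>Y = O((t - s)\<^sup>2)\<close>.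
\<close>

lemma wrong_sign_work:
  assumes st: "0 \<le> s" "s \<le> t" and z: "z \<in> borel_measurable M" "\<And>x. \<bar>z x\<bar> \<le> R"
  shows "(LINT p|(M \<Otimes>\<^sub>M M). wrong_sign (step_flux s t z) (\<lambda>x. U s x - z x) (fst p) (snd p) *
            \<bar>(U s (fst p) - z (fst p)) - (U s (snd p) - z (snd p))\<bar>)
      \<le> 2 * (t - s)\<^sup>2 * (square_norm (V s) - square_norm (V t))
        + 4 * \<kappa> * B'\<^sup>2 * (t - s)\<^sup>2 * (LINT p|(M \<Otimes>\<^sub>M M). \<bar>k (fst p) (snd p) - k' (fst p) (snd p)\<bar>)"
proof -
  note [measurable] = kernel_pair_meas[OF k'] kernel_pair_meas[OF k] integrated_flux_meas step_flux_meas[OF z(1)]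
    z(1) u_meas[OF k g] u_pair_meas
  define e where "e x = U s x - z x" for x
  have [measurable]: "e \<in> borel_measurable M" unfolding e_def by measurable
  define w where "w r p = U r (snd p) - U r (fst p)" for r and p :: "'a \<times> 'a"
  define \<Delta> where "\<Delta> r p = (\<theta> (w r p) - \<theta> (w s p)) * (w r p - w s p)" for r and p :: "'a \<times> 'a"
  have u_bd: "\<bar>U r x\<bar> \<le> G" for r x by (rule u_bound[OF k g])
  have w_bd: "\<bar>w r p - w s p\<bar> \<le> 4 * G" for r p
    using u_bd[of r "snd p"] u_bd[of r "fst p"] u_bd[of s "snd p"] u_bd[of s "fst p"] by (simp add: w_def)
  have \<Delta>0: "0 \<le> \<Delta> r p" for r p unfolding \<Delta>_def by (rule theta_diff_mult_nonneg)
  have \<Delta>_bd: "\<bar>\<Delta> r p\<bar> \<le> 2 * B * (4 * G)" for r p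
    unfolding \<Delta>_def abs_mult using theta_diff_le w_bd B_nonneg by (intro mult_mono) auto
  have \<Delta>_bd': "\<Delta> r p \<le> 2 * B' * (2 * (\<kappa> * B' * (t - s)))" if r: "s \<le> r" "r \<le> t" for r p
  proof -
    have mono: "\<kappa> * B' * (r - s) \<le> \<kappa> * B' * (t - s)"
      using r sym_kernel_const[OF k] B'_nonneg by (intro mult_left_mono) auto
    have "\<bar>\<theta> (w r p) - \<theta> (w s p)\<bar> \<le> 2 * B'"
      using B'[of r "snd p" "fst p"] B'[of s "snd p" "fst p"] unfolding w_def by linarith
    moreover have "\<bar>w r p - w s p\<bar> \<le> 2 * (\<kappa> * B' * (t - s))"
      using u_slow[OF st(1) r(1), of "snd p"] u_slow[OF st(1) r(1), of "fst p"] mono unfolding w_def by linarith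
    ultimately have "\<bar>\<Delta> r p\<bar> \<le> 2 * B' * (2 * (\<kappa> * B' * (t - s)))"
      unfolding \<Delta>_def abs_mult using B'_nonneg by (intro mult_mono) auto
    then show ?thesis by simp
  qed
  have w_meas: "(\<lambda>(r, p). w r p) \<in> borel_measurable (borel \<Otimes>\<^sub>M (M \<Otimes>\<^sub>M M))"
    unfolding w_def using u_pair_meas by (simp add: split_beta)
  have ws_meas [measurable]: "w s \<in> borel_measurable (M \<Otimes>\<^sub>M M)" unfolding w_def by measurable
  have \<Delta>_meas: "(\<lambda>(r, p). \<Delta> r p) \<in> borel_measurable (borel \<Otimes>\<^sub>M (M \<Otimes>\<^sub>M M))"
    unfolding \<Delta>_def using w_meas unfolding split_beta by measurable
  have \<Delta>_time: "(\<lambda>r. \<Delta> r p) \<in> borel_measurable borel" for p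
    unfolding \<Delta>_def w_def using u_time_meas[of "fst p"] u_time_meas[of "snd p"] by measurable
  define Y where "Y p = (LINT r|time_measure s t. \<Delta> r p)" for p
  have Y_meas [measurable]: "Y \<in> borel_measurable (M \<Otimes>\<^sub>M M)"
    unfolding Y_def[abs_def] by (rule time_Fubini(2)[OF sq.P.prob_space_axioms \<Delta>_meas \<Delta>_bd])
  have Y_le: "Y p \<le> (t - s) * (2 * B' * (2 * (\<kappa> * B' * (t - s))))" for p
    unfolding Y_def using \<Delta>_bd' by (intro time_integral_le[OF \<Delta>_time \<Delta>_bd st(2)]) auto
  have Y0: "0 \<le> Y p" for p unfolding Y_def using \<Delta>0 by simp
  define k2 where "k2 p = k (fst p) (snd p)" for p
  define k2' where "k2' p = k' (fst p) (snd p)" for p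
  have [measurable]: "k2 \<in> borel_measurable (M \<Otimes>\<^sub>M M)" "k2' \<in> borel_measurable (M \<Otimes>\<^sub>M M)"
    unfolding k2_def k2'_def by measurable
  have k2: "0 \<le> k2 p" "k2 p \<le> \<kappa>" "0 \<le> k2' p" "k2' p \<le> \<kappa>'" for p
    using sym_kernel_bounds[OF k] sym_kernel_bounds[OF k'] by (simp_all add: k2_def k2'_def)
  define Cy where "Cy = (t - s) * (2 * B' * (2 * (\<kappa> * B' * (t - s))))"
  have kd: "\<bar>k2 p - k2' p\<bar> \<le> \<kappa> + \<kappa>'" for p using kernel_diff_bound by (simp add: k2_def k2'_def)
  have iY1: "integrable (M \<Otimes>\<^sub>M M) (\<lambda>p. k2 p * Y p)"
  proof (rule integrable_sq_bounded[where C="\<kappa> * Cy"])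
    show "\<bar>k2 p * Y p\<bar> \<le> \<kappa> * Cy" for p
      using k2[of p] Y0[of p] Y_le[of p] by (auto simp: Cy_def abs_mult intro!: mult_mono)
  qed measurable
  have iD: "integrable (M \<Otimes>\<^sub>M M) (\<lambda>p. \<bar>k2 p - k2' p\<bar>)"
    by (rule integrable_sq_bounded[where C="\<kappa> + \<kappa>'"]) (use kd in auto)
  have pointwise: "wrong_sign (step_flux s t z) e (fst p) (snd p) * \<bar>e (fst p) - e (snd p)\<bar>
      \<le> k2 p * Y p + Cy * \<bar>k2 p - k2' p\<bar>" for p
  proof -
    define a where "a = e (fst p) - e (snd p)"
    define m where "m = z (snd p) - z (fst p)"
    have a: "a = m - w s p" by (simp add: a_def e_def m_def w_def)
    have th: "(\<lambda>r. \<theta> (w r p)) \<in> borel_measurable borel" unfolding w_def by (rule theta_time_meas)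
    have ti: "integrable (time_measure s t) (\<lambda>r. \<theta> (w r p))" by (rule time_integrable[OF th theta_bound])
    have ci: "integrable (time_measure s t) (\<lambda>r. c)" for c :: real by (rule time_integrable[of _ "\<bar>c\<bar>"]) auto
    have "step_flux s t z (fst p) (snd p) * a = k2' p * (LINT r|time_measure s t. (\<theta> (w r p) - \<theta> m) * (m - w s p))"
      using ti ci[of "\<theta> m"] time_integral_const[OF st(2), of 1]
      by (simp add: step_flux_def integrated_flux_def k2'_def a w_def m_def)
    also have "\<dots> \<le> k2' p * Y p"
    proof (rule mult_left_mono[OF _ k2(3)])
      show "(LINT r|time_measure s t. (\<theta> (w r p) - \<theta> m) * (m - w s p)) \<le> Y p"
        unfolding Y_def \<Delta>_def
        using ti ci[of "\<theta> m"] time_integrable[OF \<Delta>_time \<Delta>_bd, of s t p] theta_three_point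
        by (intro integral_mono) (auto simp: \<Delta>_def)
    qed
    finally have 1: "step_flux s t z (fst p) (snd p) * a \<le> k2' p * Y p" .
    have "wrong_sign (step_flux s t z) e (fst p) (snd p) * \<bar>a\<bar> = max 0 (step_flux s t z (fst p) (snd p) * a)"
      by (auto simp: wrong_sign_def a_def sgn_if max_def zero_le_mult_iff mult_le_0_iff)
    also have "\<dots> \<le> k2' p * Y p" using 1 k2(3)[of p] Y0[of p] by simp
    also have "\<dots> \<le> k2 p * Y p + \<bar>k2 p - k2' p\<bar> * Y p"
      using mult_right_mono[of "k2' p - k2 p" "\<bar>k2 p - k2' p\<bar>" "Y p"] Y0[of p] by (simp add: algebra_simps)
    also have "\<bar>k2 p - k2' p\<bar> * Y p \<le> Cy * \<bar>k2 p - k2' p\<bar>"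
      using Y_le[of p] by (subst mult.commute) (auto simp: Cy_def intro!: mult_right_mono)
    finally show ?thesis by (simp add: a_def)
  qed
  have "(LINT p|(M \<Otimes>\<^sub>M M). wrong_sign (step_flux s t z) e (fst p) (snd p) * \<bar>e (fst p) - e (snd p)\<bar>)
      \<le> (LINT p|(M \<Otimes>\<^sub>M M). k2 p * Y p + Cy * \<bar>k2 p - k2' p\<bar>)"
  proof (rule integral_mono_AE')
    show "integrable (M \<Otimes>\<^sub>M M) (\<lambda>p. k2 p * Y p + Cy * \<bar>k2 p - k2' p\<bar>)" using iY1 iD by simp
    show "AE p in M \<Otimes>\<^sub>M M. 0 \<le> k2 p * Y p + Cy * \<bar>k2 p - k2' p\<bar>"
      by (intro AE_I2 order_trans[OF _ pointwise]) (simp add: wrong_sign_def)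
  qed (use pointwise in simp)
  also have "\<dots> = (LINT p|(M \<Otimes>\<^sub>M M). k2 p * Y p) + Cy * (LINT p|(M \<Otimes>\<^sub>M M). \<bar>k2 p - k2' p\<bar>)"
    using iY1 iD by simp
  also have "(LINT p|(M \<Otimes>\<^sub>M M). k2 p * Y p) = (LINT r|time_measure s t. dissipation k (U r) (U s))"
  proof -
    have m: "(\<lambda>(r, p). k2 p * \<Delta> r p) \<in> borel_measurable (borel \<Otimes>\<^sub>M (M \<Otimes>\<^sub>M M))"
      using \<Delta>_meas unfolding split_beta by measurable
    have bd: "\<bar>k2 p * \<Delta> r p\<bar> \<le> \<kappa> * (2 * B * (4 * G))" for r p
      unfolding abs_mult using k2[of p] \<Delta>_bd[of r p] by (intro mult_mono) auto
    from time_Fubini(1)[OF sq.P.prob_space_axioms m bd, of s t] show ?thesis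
      by (simp add: Y_def dissipation_def k2_def \<Delta>_def w_def)
  qed
  also have "\<dots> \<le> 2 * (t - s)\<^sup>2 * (square_norm (V s) - square_norm (V t))"
    by (rule step_dissipation[OF k g st])
  also have "Cy = 4 * \<kappa> * B'\<^sup>2 * (t - s)\<^sup>2" by (simp add: Cy_def power2_eq_square)
  finally show ?thesis by (simp add: e_def k2_def k2'_def)
qed

lemma smoothed_norm:
  "lpn M p (\<lambda>x. sqrt ((f x)\<^sup>2 + \<tau>\<^sup>2)) = (LINT x|M. sqrt ((f x)\<^sup>2 + \<tau>\<^sup>2) powr p) powr (1 / p)"
  by (simp add: lpn_def)

lemma smoothed_norm_ge:
  assumes \<tau>: "\<tau> > 0" and p: "0 < p" and f: "f \<in> borel_measurable M" "\<And>x. \<bar>f x\<bar> \<le> C"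
  shows "\<tau> \<le> lpn M p (\<lambda>x. sqrt ((f x)\<^sup>2 + \<tau>\<^sup>2))" "lpn M p f \<le> lpn M p (\<lambda>x. sqrt ((f x)\<^sup>2 + \<tau>\<^sup>2))"
proof -
  note [measurable] = f(1)
  have m: "(\<lambda>x. sqrt ((f x)\<^sup>2 + \<tau>\<^sup>2)) \<in> borel_measurable M" by measurable
  have bd: "\<bar>sqrt ((f x)\<^sup>2 + \<tau>\<^sup>2)\<bar> \<le> C + \<tau>" for x
    using sqrt_sum_squares_le_sum_abs[of "f x" \<tau>] f(2)[of x] \<tau> by simp
  have "lpn M p (\<lambda>_. \<tau>) \<le> lpn M p (\<lambda>x. sqrt ((f x)\<^sup>2 + \<tau>\<^sup>2))"
    using \<tau> by (intro lpn_mono[OF _ m bd p]) (auto simp: real_le_rsqrt)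
  moreover have "lpn M p (\<lambda>_. \<tau>) = \<tau>" using \<tau> p by (simp add: lpn_def prob_space powr_powr)
  ultimately show "\<tau> \<le> lpn M p (\<lambda>x. sqrt ((f x)\<^sup>2 + \<tau>\<^sup>2))" by simp
  show "lpn M p f \<le> lpn M p (\<lambda>x. sqrt ((f x)\<^sup>2 + \<tau>\<^sup>2))"
    by (intro lpn_mono[OF f(1) m bd p]) (simp add: real_le_rsqrt)
qed

lemma smoothed_norm_add:
  assumes \<tau>: "\<tau> > 0" and p: "1 \<le> p" and f: "f \<in> borel_measurable M" "\<And>x. \<bar>f x\<bar> \<le> C"
    and h: "h \<in> borel_measurable M" "\<And>x. \<bar>h x\<bar> \<le> D"
  shows "lpn M p (\<lambda>x. sqrt ((f x + h x)\<^sup>2 + \<tau>\<^sup>2)) \<le> lpn M p (\<lambda>x. sqrt ((f x)\<^sup>2 + \<tau>\<^sup>2)) + lpn M p h"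
proof -
  note [measurable] = f(1) h(1)
  have bd: "\<bar>sqrt ((f x)\<^sup>2 + \<tau>\<^sup>2)\<bar> \<le> C + \<tau>" for x
    using sqrt_sum_squares_le_sum_abs[of "f x" \<tau>] f(2)[of x] \<tau> by simp
  have pt: "sqrt ((f x + h x)\<^sup>2 + \<tau>\<^sup>2) \<le> sqrt ((f x)\<^sup>2 + \<tau>\<^sup>2) + \<bar>h x\<bar>" for x
    using real_sqrt_sum_squares_triangle_ineq[of "f x" "h x" \<tau> 0] by simp
  have "lpn M p (\<lambda>x. sqrt ((f x + h x)\<^sup>2 + \<tau>\<^sup>2)) \<le> lpn M p (\<lambda>x. sqrt ((f x)\<^sup>2 + \<tau>\<^sup>2) + \<bar>h x\<bar>)"
  proof (rule lpn_mono[where C="C + \<tau> + D"])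
    show "\<bar>sqrt ((f x)\<^sup>2 + \<tau>\<^sup>2) + \<bar>h x\<bar>\<bar> \<le> C + \<tau> + D" for x using bd[of x] h(2)[of x] by simp
    show "\<bar>sqrt ((f x + h x)\<^sup>2 + \<tau>\<^sup>2)\<bar> \<le> \<bar>sqrt ((f x)\<^sup>2 + \<tau>\<^sup>2) + \<bar>h x\<bar>\<bar>" for x
      using pt[of x] by simp
  qed (use p in auto)
  also have "\<dots> \<le> lpn M p (\<lambda>x. sqrt ((f x)\<^sup>2 + \<tau>\<^sup>2)) + lpn M p (\<lambda>x. \<bar>h x\<bar>)"
    by (rule lpn_triangle[OF _ bd _ _ p]) (use h in auto)
  also have "lpn M p (\<lambda>x. \<bar>h x\<bar>) = lpn M p h" by (simp add: lpn_def)
  finally show ?thesis .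
qed

lemma smoothed_norm_of_integral:
  assumes \<tau>: "\<tau> > 0" and p: "1 \<le> p" and f: "f \<in> borel_measurable M" "\<And>x. \<bar>f x\<bar> \<le> C" and i: "0 \<le> i"
    and le: "(LINT x|M. sqrt ((h x)\<^sup>2 + \<tau>\<^sup>2) powr p) \<le> (LINT x|M. sqrt ((f x)\<^sup>2 + \<tau>\<^sup>2) powr p) + i"
  shows "lpn M p (\<lambda>x. sqrt ((h x)\<^sup>2 + \<tau>\<^sup>2)) \<le> lpn M p (\<lambda>x. sqrt ((f x)\<^sup>2 + \<tau>\<^sup>2)) + i * \<tau> powr (1 - p)"
proof -
  let ?A = "lpn M p (\<lambda>x. sqrt ((f x)\<^sup>2 + \<tau>\<^sup>2))"
  have p0: "0 < p" using p by simp
  have "?A powr p = (LINT x|M. sqrt ((f x)\<^sup>2 + \<tau>\<^sup>2) powr p)"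
    using lpn_powr[OF p0, of M "\<lambda>x. sqrt ((f x)\<^sup>2 + \<tau>\<^sup>2)"] by simp
  then have "lpn M p (\<lambda>x. sqrt ((h x)\<^sup>2 + \<tau>\<^sup>2)) \<le> (?A powr p + i) powr (1 / p)"
    unfolding smoothed_norm[where f=h] using le p by (intro powr_mono2) auto
  also have "\<dots> \<le> ?A + i * \<tau> powr (1 - p)"
    by (rule powr_perturb[OF smoothed_norm_ge(1)[OF \<tau> p0 f] \<tau> i p])
  finally show ?thesis .
qed

text \<open>
  The bound on the second derivative from \<open>smoothed_power\<close> times the factor from \<open>powr_perturb\<close>: what a unit of
  work costs in terms of norms.
\<close>

lemma smoothing_constant:
  fixes \<tau> p :: real
  assumes \<tau>: "0 < \<tau>" and p: "1 < p" "p \<le> 2"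
  shows "p * \<tau> powr (p - 2) * \<tau> powr (1 - p) \<le> 2 / \<tau>"
proof -
  have "\<tau> powr (p - 2) * \<tau> powr (1 - p) = 1 / \<tau>"
  proof -
    have "\<tau> powr (p - 2) * \<tau> powr (1 - p) = \<tau> powr ((p - 2) + (1 - p))" by (simp only: powr_add)
    also have "(p - 2) + (1 - p) = - 1" by simp
    also have "\<tau> powr - 1 = 1 / \<tau>" using \<tau> by (simp add: powr_minus divide_inverse)
    finally show ?thesis .
  qed
  then show ?thesis using p \<tau> by (simp add: mult.assoc divide_right_mono)
qed

text \<open>
  Any decomposition with a flux bounded by \<open>b\<close> may be replaced by a saturated one, at a cost that is arbitrarily
  small with \<open>\<epsilon>\<close>.
\<close>

lemma resaturation_norm:
  assumes \<tau>: "0 < \<tau>" and p: "1 < p" "p \<le> 2" and b0: "0 \<le> b" and \<epsilon>: "0 < \<epsilon>"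
    and e: "e \<in> borel_measurable M" "\<And>x. \<bar>e x\<bar> \<le> R" and \<phi>: "\<phi> \<in> borel_measurable M" "\<And>x. \<bar>\<phi> x\<bar> \<le> Q"
    and S: "(\<lambda>p. S (fst p) (snd p)) \<in> borel_measurable (M \<Otimes>\<^sub>M M)" "\<And>x y. \<bar>S x y\<bar> \<le> b" "\<And>x y. S y x = - S x y"
    and eq: "\<And>x. e x = \<phi> x + (LINT y|M. S x y)"
  obtains \<psi> Q' where "\<psi> \<in> borel_measurable M" "\<And>x. \<bar>\<psi> x\<bar> \<le> Q'"
    "\<And>x. e x = \<psi> x + (LINT y|M. sat_flux b \<epsilon> \<psi> x y)"
    "lpn M p (\<lambda>x. sqrt ((\<psi> x)\<^sup>2 + \<tau>\<^sup>2)) \<le> lpn M p (\<lambda>x. sqrt ((\<phi> x)\<^sup>2 + \<tau>\<^sup>2)) + 2 / \<tau> * \<epsilon> * b\<^sup>2"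
proof -
  obtain j' where j: "smooth_convex (\<lambda>z. sqrt (z\<^sup>2 + \<tau>\<^sup>2) powr p) j' (p * \<tau> powr (p - 2))"
    using smoothed_power[OF p \<tau>] by blast
  define J where "J = p * \<tau> powr (p - 2)"
  have J0: "0 \<le> J" using p by (simp add: J_def)
  obtain \<psi> where \<psi>: "\<psi> \<in> borel_measurable M" "\<And>x. \<bar>\<psi> x\<bar> \<le> R + b"
    "\<And>x. e x = \<psi> x + (LINT y|M. sat_flux b \<epsilon> \<psi> x y)"
    using saturated_decomposition[OF e b0 \<epsilon>] by blast
  define R' where "R' = max (R + b) Q"
  have bds: "\<bar>\<phi> x\<bar> \<le> R'" "\<bar>\<psi> x\<bar> \<le> R'" for x
    using \<phi>(2)[of x] \<psi>(2)[of x] by (simp_all add: R'_def)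
  have p1: "1 \<le> p" using p by simp
  have "(LINT x|M. sqrt ((\<psi> x)\<^sup>2 + \<tau>\<^sup>2) powr p) \<le> (LINT x|M. sqrt ((\<phi> x)\<^sup>2 + \<tau>\<^sup>2) powr p) + J * \<epsilon> * b\<^sup>2"
    by (rule resaturation[OF j[folded J_def] b0 \<epsilon> \<psi>(1) bds(2) \<phi>(1) bds(1) S]) (simp add: eq[symmetric] \<psi>(3)[symmetric])
  then have 4: "lpn M p (\<lambda>x. sqrt ((\<psi> x)\<^sup>2 + \<tau>\<^sup>2)) \<le> lpn M p (\<lambda>x. sqrt ((\<phi> x)\<^sup>2 + \<tau>\<^sup>2)) + J * \<epsilon> * b\<^sup>2 * \<tau> powr (1 - p)"
    using J0 \<epsilon> by (intro smoothed_norm_of_integral[OF \<tau> p1 \<phi>(1) bds(1)]) auto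
  have "J * \<epsilon> * b\<^sup>2 * \<tau> powr (1 - p) \<le> 2 / \<tau> * \<epsilon> * b\<^sup>2"
    using mult_right_mono[OF smoothing_constant[OF \<tau> p], of "\<epsilon> * b\<^sup>2"] \<epsilon> by (simp add: J_def mult_ac)
  then show ?thesis using that[OF \<psi>(1) bds(2) \<psi>(3)] 4 by linarith
qed

text \<open>
  The bound of \<open>wrong_sign_work\<close>.
\<close>

definition step_injection :: "real \<Rightarrow> real \<Rightarrow> real" where
  "step_injection s t = 2 * (t - s)\<^sup>2 * (square_norm (V s) - square_norm (V t))
     + 4 * \<kappa> * B'\<^sup>2 * (t - s)\<^sup>2 * (LINT p|(M \<Otimes>\<^sub>M M). \<bar>k (fst p) (snd p) - k' (fst p) (snd p)\<bar>)"

lemma step_injection_nonneg: "0 \<le> s \<Longrightarrow> s \<le> t \<Longrightarrow> 0 \<le> step_injection s t"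
  unfolding step_injection_def using speed_nonincreasing[OF k g, of s t] sym_kernel_const[OF k]
  by (intro add_nonneg_nonneg mult_nonneg_nonneg) auto

text \<open>
  A step consists of storing the flux error (\<open>saturated_flux_step\<close>), adding the kernel defect to the spilled
  part, and restoring the saturated form (\<open>resaturation_norm\<close>). The capacity \<open>b\<close> is at least twice the flux error of the step.
\<close>

lemma chatter_step:
  assumes st: "0 \<le> s" "s \<le> t" and \<tau>: "0 < \<tau>" and p: "1 < p" "p \<le> 2"
    and z: "z \<in> borel_measurable M" "\<And>x. \<bar>z x\<bar> \<le> R"
    and b: "\<kappa>' * (4 * B * (t - s)) \<le> b" and \<epsilon>: "0 < \<epsilon>"
    and \<psi>: "\<psi> \<in> borel_measurable M" "\<And>x. \<bar>\<psi> x\<bar> \<le> Q"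
    and e: "\<And>x. U s x - z x = \<psi> x + (LINT y|M. sat_flux b \<epsilon> \<psi> x y)"
  obtains \<psi>' Q' where "\<psi>' \<in> borel_measurable M" "\<And>x. \<bar>\<psi>' x\<bar> \<le> Q'"
    "\<And>x. U t x - (z x + (t - s) * F k' z x) = \<psi>' x + (LINT y|M. sat_flux b \<epsilon> \<psi>' x y)"
    "lpn M p (\<lambda>x. sqrt ((\<psi>' x)\<^sup>2 + \<tau>\<^sup>2)) \<le> lpn M p (\<lambda>x. sqrt ((\<psi> x)\<^sup>2 + \<tau>\<^sup>2))
       + 3 / \<tau> * step_injection s t + (t - s) * B' * lpn (M \<Otimes>\<^sub>M M) p (\<lambda>q. k (fst q) (snd q) - k' (fst q) (snd q))
       + 2 / \<tau> * \<epsilon> * b\<^sup>2"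
proof -
  have p1: "1 \<le> p" "0 < p" using p by auto
  have b0: "0 \<le> b"
  proof -
    have "0 \<le> \<kappa>' * (4 * B * (t - s))" using sym_kernel_const[OF k'] B_nonneg st by simp
    then show ?thesis using b by linarith
  qed
  define \<beta> where "\<beta> = \<kappa>' * (2 * B * (t - s))"
  have \<beta>: "2 * \<beta> \<le> b" using b by (simp add: \<beta>_def)
  obtain j' where j: "smooth_convex (\<lambda>z. sqrt (z\<^sup>2 + \<tau>\<^sup>2) powr p) j' (p * \<tau> powr (p - 2))"
    using smoothed_power[OF p \<tau>] by blast
  note q = step_flux_meas[OF z(1), of s t] step_flux_bound[OF st(2), of z, folded \<beta>_def] step_flux_antisym[of s t z]
  obtain \<phi> S where \<phi>: "\<phi> \<in> borel_measurable M" "\<And>x. \<bar>\<phi> x\<bar> \<le> Q + \<beta>"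
    and S: "(\<lambda>p. S (fst p) (snd p)) \<in> borel_measurable (M \<Otimes>\<^sub>M M)" "\<And>x y. \<bar>S x y\<bar> \<le> b" "\<And>x y. S y x = - S x y"
    and eq: "\<And>x. (U s x - z x) + (LINT y|M. step_flux s t z x y) = \<phi> x + (LINT y|M. S x y)"
    and le: "\<And>j j' J. smooth_convex j j' J \<Longrightarrow> (LINT x|M. j (\<phi> x)) \<le> (LINT x|M. j (\<psi> x)) +
       3 / 2 * J * (LINT p|(M \<Otimes>\<^sub>M M). wrong_sign (step_flux s t z) (\<lambda>x. U s x - z x) (fst p) (snd p) *
          \<bar>(U s (fst p) - z (fst p)) - (U s (snd p) - z (snd p))\<bar>)"
    by (rule saturated_flux_step[where e="\<lambda>x. U s x - z x", OF b0 \<epsilon> \<psi> e q \<beta>])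
      (rule that, assumption+)
  define J where "J = p * \<tau> powr (p - 2)"
  have J0: "0 \<le> J" using p by (simp add: J_def)
  define X where "X = step_injection s t"
  have X0: "0 \<le> X" using step_injection_nonneg[OF st] by (simp add: X_def)
  have "(LINT x|M. sqrt ((\<phi> x)\<^sup>2 + \<tau>\<^sup>2) powr p) \<le> (LINT x|M. sqrt ((\<psi> x)\<^sup>2 + \<tau>\<^sup>2) powr p) + 3 / 2 * J * X"
  proof -
    have "3 / 2 * J * (LINT p|(M \<Otimes>\<^sub>M M). wrong_sign (step_flux s t z) (\<lambda>x. U s x - z x) (fst p) (snd p) *
          \<bar>(U s (fst p) - z (fst p)) - (U s (snd p) - z (snd p))\<bar>) \<le> 3 / 2 * J * X"
      using wrong_sign_work[OF st z] J0 by (intro mult_left_mono) (auto simp: X_def step_injection_def)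
    then show ?thesis using le[OF j] by (simp add: J_def)
  qed
  then have 1: "lpn M p (\<lambda>x. sqrt ((\<phi> x)\<^sup>2 + \<tau>\<^sup>2)) \<le> lpn M p (\<lambda>x. sqrt ((\<psi> x)\<^sup>2 + \<tau>\<^sup>2)) + 3 / 2 * J * X * \<tau> powr (1 - p)"
    using J0 X0 by (intro smoothed_norm_of_integral[OF \<tau> p1(1) \<psi>]) auto
  note kd = kernel_defect_meas[of s t] kernel_defect_bound[OF st(2)]
  note 2 = smoothed_norm_add[OF \<tau> p1(1) \<phi> kd]
  note 3 = kernel_defect_lpn[OF st(2) p1(1)]
  define e' where "e' x = U t x - (z x + (t - s) * F k' z x)" for x
  have e'_eq: "e' x = (\<phi> x + kernel_defect s t x) + (LINT y|M. S x y)" for x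
    unfolding e'_def error_increment[OF st z(1)] eq by simp
  have e'_meas: "e' \<in> borel_measurable M"
    unfolding e'_def using u_meas[OF k g] z(1) F_meas[OF k' z(1)] by measurable
  have e'_bd: "\<bar>e' x\<bar> \<le> G + (R + (t - s) * (\<kappa>' * B))" for x
  proof -
    have "\<bar>(t - s) * F k' z x\<bar> \<le> (t - s) * (\<kappa>' * B)"
      unfolding abs_mult using F_bound[OF k' z(1), of x] st by (intro mult_mono) auto
    then show ?thesis using u_bound[OF k g, of t x] z(2)[of x] unfolding e'_def by linarith
  qed
  define \<phi>' where "\<phi>' x = \<phi> x + kernel_defect s t x" for x
  have \<phi>'_meas: "\<phi>' \<in> borel_measurable M" unfolding \<phi>'_def using \<phi>(1) kd(1) by measurable
  have \<phi>'_bd: "\<bar>\<phi>' x\<bar> \<le> Q + \<beta> + (\<kappa> + \<kappa>') * ((t - s) * B')" for x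
    unfolding \<phi>'_def using \<phi>(2)[of x] kd(2)[of x] by linarith
  obtain \<psi>' Q' where \<psi>': "\<psi>' \<in> borel_measurable M" "\<And>x. \<bar>\<psi>' x\<bar> \<le> Q'"
    "\<And>x. e' x = \<psi>' x + (LINT y|M. sat_flux b \<epsilon> \<psi>' x y)"
    "lpn M p (\<lambda>x. sqrt ((\<psi>' x)\<^sup>2 + \<tau>\<^sup>2)) \<le> lpn M p (\<lambda>x. sqrt ((\<phi>' x)\<^sup>2 + \<tau>\<^sup>2)) + 2 / \<tau> * \<epsilon> * b\<^sup>2"
    by (rule resaturation_norm[OF \<tau> p b0 \<epsilon> e'_meas e'_bd \<phi>'_meas \<phi>'_bd S]) (simp add: e'_eq \<phi>'_def, rule that, assumption+)
  have 5: "3 / 2 * J * X * \<tau> powr (1 - p) \<le> 3 / \<tau> * X"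
    using mult_right_mono[OF smoothing_constant[OF \<tau> p], of "3 / 2 * X"] X0 by (simp add: J_def mult_ac)
  show ?thesis
  proof (rule that[OF \<psi>'(1,2) \<psi>'(3)[unfolded e'_def]])
    show "lpn M p (\<lambda>x. sqrt ((\<psi>' x)\<^sup>2 + \<tau>\<^sup>2)) \<le> lpn M p (\<lambda>x. sqrt ((\<psi> x)\<^sup>2 + \<tau>\<^sup>2))
       + 3 / \<tau> * step_injection s t + (t - s) * B' * lpn (M \<Otimes>\<^sub>M M) p (\<lambda>q. k (fst q) (snd q) - k' (fst q) (snd q))
       + 2 / \<tau> * \<epsilon> * b\<^sup>2"
      using 1 2 3 \<psi>'(4)[unfolded \<phi>'_def] 5[unfolded X_def] unfolding X_def by linarith
  qed
qed

text \<open>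
  The norm of \<open>\<psi>\<close> grows by \<open>3 / \<tau>\<close> times \<open>step_injection\<close> in each step. The speeds in it telescope,
  leaving \<open>6 * square_norm (V 0) * \<tau>\<close>. At the end the stored flux adds at most its capacity, which is a multiple of \<open>\<tau>\<close>.
\<close>

lemma chatter_error:
  assumes p: "1 < p" "p \<le> 2" and \<tau>: "0 < \<tau>"
    and th: "th 0 = 0" "\<And>i. i < N \<Longrightarrow> th i \<le> th (Suc i) \<and> th (Suc i) \<le> th i + \<tau>" and h: "h \<le> N"
    and g0: "g0 \<in> borel_measurable M" "\<And>x. \<bar>g0 x\<bar> \<le> G0"
  defines "D \<equiv> lpn (M \<Otimes>\<^sub>M M) p (\<lambda>q. k (fst q) (snd q) - k' (fst q) (snd q))"
  shows "lpn M p (\<lambda>x. U (th h) x - eul k' g0 (\<lambda>i. th (Suc i) - th i) h x)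
     \<le> lpn M p (\<lambda>x. g x - g0 x) + th h * (12 * \<kappa> * B'\<^sup>2 + B') * D + (2 + 6 * square_norm (V 0) + 4 * \<kappa>' * B) * \<tau>"
proof -
  have p1: "1 \<le> p" "0 < p" using p by auto
  define W where "W = eul k' g0 (\<lambda>i. th (Suc i) - th i)"
  have W_Suc: "W (Suc i) = (\<lambda>x. W i x + (th (Suc i) - th i) * F k' (W i) x)" for i by (simp add: W_def)
  have W_meas: "W i \<in> borel_measurable M" for i unfolding W_def by (rule eul_meas[OF k' g0(1)])
  have W_bd: "\<exists>R. \<forall>x. \<bar>W i x\<bar> \<le> R" for i
    unfolding W_def by (rule eul_bounded[OF k' g0])
  have th_nonneg: "0 \<le> th i" if "i \<le> N" for i
    using that th by (induction i) (auto intro: order_trans)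
  define b where "b = 4 * \<kappa>' * B * \<tau>"
  have b0: "0 \<le> b" using sym_kernel_const[OF k'] B_nonneg \<tau> by (simp add: b_def)
  define E0 where "E0 = lpn M p (\<lambda>x. g x - g0 x)"
  have D0: "0 \<le> D" unfolding D_def by (rule lpn_nonneg)
  define sp where "sp i = square_norm (V (th i))" for i
  have D1: "(LINT q|(M \<Otimes>\<^sub>M M). \<bar>k (fst q) (snd q) - k' (fst q) (snd q)\<bar>) \<le> D"
    unfolding D_def using kernel_diff_bound kernel_pair_meas[OF k] kernel_pair_meas[OF k'] p1
    by (intro sq.P.integral_abs_le_lpn[where C="\<kappa> + \<kappa>'"]) auto
  \<comment> \<open>Each of the \<open>N + 1\<close> resaturations costs \<open>2 / \<tau> * \<epsilon> * b\<^sup>2\<close>, together at most \<open>\<tau>\<close>.\<close>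
  define \<epsilon> where "\<epsilon> = \<tau>\<^sup>2 / (2 * real (Suc N) * (b\<^sup>2 + 1))"
  have b1: "0 < b\<^sup>2 + 1" by (simp add: add_nonneg_pos)
  have \<epsilon>: "0 < \<epsilon>" using \<tau> b1 by (simp add: \<epsilon>_def)
  define \<eta> where "\<eta> = 2 / \<tau> * \<epsilon> * b\<^sup>2"
  have \<eta>: "real (Suc i) * \<eta> \<le> \<tau>" if "i \<le> N" for i
  proof -
    have "real (Suc i) * \<eta> \<le> real (Suc N) * \<eta>"
      using that \<tau> \<epsilon> by (intro mult_right_mono) (auto simp: \<eta>_def)
    also have "\<dots> = \<tau> * (b\<^sup>2 / (b\<^sup>2 + 1))"
      using \<tau> b1 by (simp add: \<eta>_def \<epsilon>_def power2_eq_square divide_simps)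
    also have "\<dots> \<le> \<tau> * 1" using \<tau> b1 by (intro mult_left_mono) (auto simp: divide_le_eq)
    finally show ?thesis by simp
  qed
  \<comment> \<open>Initial error, smoothing, resaturations, accumulated work and kernel defects up to the grid point \<open>i\<close>.\<close>
  define A where "A i = E0 + \<tau> + real (Suc i) * \<eta> + 3 / \<tau> * (2 * \<tau>\<^sup>2 * (sp 0 - sp i) + 4 * \<kappa> * B'\<^sup>2 * \<tau> * th i * D)
      + th i * B' * D" for i
  have "\<exists>\<psi> Q. \<psi> \<in> borel_measurable M \<and> (\<forall>x. \<bar>\<psi> x\<bar> \<le> Q) \<and>
      (\<forall>x. U (th i) x - W i x = \<psi> x + (LINT y|M. sat_flux b \<epsilon> \<psi> x y)) \<and>
      lpn M p (\<lambda>x. sqrt ((\<psi> x)\<^sup>2 + \<tau>\<^sup>2)) \<le> A i" if "i \<le> N" for i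
    using that
  proof (induction i)
    case 0
    have e0: "(\<lambda>x. g x - g0 x) \<in> borel_measurable M" "\<bar>g x - g0 x\<bar> \<le> G + G0" for x
      using g(1) g0(1) g(2)[of x] g0(2)[of x] by auto
    obtain \<psi> Q where \<psi>: "\<psi> \<in> borel_measurable M" "\<And>x. \<bar>\<psi> x\<bar> \<le> Q"
      "\<And>x. g x - g0 x = \<psi> x + (LINT y|M. sat_flux b \<epsilon> \<psi> x y)"
      "lpn M p (\<lambda>x. sqrt ((\<psi> x)\<^sup>2 + \<tau>\<^sup>2)) \<le> lpn M p (\<lambda>x. sqrt ((g x - g0 x)\<^sup>2 + \<tau>\<^sup>2)) + 2 / \<tau> * \<epsilon> * b\<^sup>2"
      by (rule resaturation_norm[OF \<tau> p b0 \<epsilon> e0 e0, of "\<lambda>_ _. 0"]) (simp, simp add: b0, simp, simp, rule that, assumption+)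
    have "lpn M p (\<lambda>x. sqrt ((0 + (g x - g0 x))\<^sup>2 + \<tau>\<^sup>2)) \<le> lpn M p (\<lambda>x. sqrt (0\<^sup>2 + \<tau>\<^sup>2)) + E0"
      unfolding E0_def by (rule smoothed_norm_add[OF \<tau> p1(1) _ _ e0, where C=0]) auto
    moreover have "lpn M p (\<lambda>x. sqrt (0\<^sup>2 + \<tau>\<^sup>2)) = \<tau>"
      using \<tau> p1 by (simp add: lpn_def prob_space powr_powr)
    ultimately have "lpn M p (\<lambda>x. sqrt ((\<psi> x)\<^sup>2 + \<tau>\<^sup>2)) \<le> A 0"
      using \<psi>(4) by (simp add: A_def \<eta>_def th)
    then show ?case using \<psi>(1-3) th by (intro exI[of _ \<psi>] exI[of _ Q]) (auto simp: W_def sol_nonpos)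
  next
    case (Suc i)
    then have i: "i < N" "i \<le> N" by auto
    obtain \<psi> Q where \<psi>: "\<psi> \<in> borel_measurable M" "\<And>x. \<bar>\<psi> x\<bar> \<le> Q"
      "\<And>x. U (th i) x - W i x = \<psi> x + (LINT y|M. sat_flux b \<epsilon> \<psi> x y)"
      "lpn M p (\<lambda>x. sqrt ((\<psi> x)\<^sup>2 + \<tau>\<^sup>2)) \<le> A i"
      using Suc.IH[OF i(2)] by blast
    obtain R where R: "\<And>x. \<bar>W i x\<bar> \<le> R" using W_bd by blast
    define s where "s = th i"
    define t where "t = th (Suc i)"
    have st: "0 \<le> s" "s \<le> t" "t - s \<le> \<tau>" using th(2)[OF i(1)] th_nonneg[OF i(2)] by (auto simp: s_def t_def)
    have "\<kappa>' * (4 * B * (t - s)) \<le> \<kappa>' * (4 * B * \<tau>)"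
      using st sym_kernel_const[OF k'] B_nonneg by (intro mult_left_mono) auto
    then have bb: "\<kappa>' * (4 * B * (t - s)) \<le> b" by (simp add: b_def)
    obtain \<psi>' Q' where \<psi>': "\<psi>' \<in> borel_measurable M" "\<And>x. \<bar>\<psi>' x\<bar> \<le> Q'"
      "\<And>x. U t x - (W i x + (t - s) * F k' (W i) x) = \<psi>' x + (LINT y|M. sat_flux b \<epsilon> \<psi>' x y)"
      "lpn M p (\<lambda>x. sqrt ((\<psi>' x)\<^sup>2 + \<tau>\<^sup>2)) \<le> lpn M p (\<lambda>x. sqrt ((\<psi> x)\<^sup>2 + \<tau>\<^sup>2))
         + 3 / \<tau> * step_injection s t + (t - s) * B' * D + 2 / \<tau> * \<epsilon> * b\<^sup>2"
      by (rule chatter_step[OF st(1,2) \<tau> p W_meas R bb \<epsilon> \<psi>(1,2) \<psi>(3)[folded s_def], folded D_def])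
        (rule that, assumption+)
    have "step_injection s t \<le> 2 * \<tau>\<^sup>2 * (sp i - sp (Suc i)) + 4 * \<kappa> * B'\<^sup>2 * \<tau> * (t - s) * D"
    proof -
      have sq: "(t - s)\<^sup>2 \<le> \<tau>\<^sup>2" using st by (intro power_mono) auto
      have sq': "(t - s)\<^sup>2 \<le> \<tau> * (t - s)" using st by (simp add: power2_eq_square mult_right_mono)
      have dec: "0 \<le> sp i - sp (Suc i)"
        using speed_nonincreasing[OF k g st(1,2)] by (simp add: sp_def s_def t_def)
      have "2 * (t - s)\<^sup>2 * (sp i - sp (Suc i)) \<le> 2 * \<tau>\<^sup>2 * (sp i - sp (Suc i))"
        using sq dec by (intro mult_right_mono) auto
      moreover have "4 * \<kappa> * B'\<^sup>2 * (t - s)\<^sup>2 * (LINT q|(M \<Otimes>\<^sub>M M). \<bar>k (fst q) (snd q) - k' (fst q) (snd q)\<bar>)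
          \<le> 4 * \<kappa> * B'\<^sup>2 * (\<tau> * (t - s)) * D"
        using sq' D1 sym_kernel_const[OF k] D0 st \<tau> by (intro mult_mono mult_nonneg_nonneg) auto
      ultimately show ?thesis unfolding step_injection_def by (simp add: sp_def s_def t_def mult.assoc)
    qed
    then have "3 / \<tau> * step_injection s t \<le> 3 / \<tau> * (2 * \<tau>\<^sup>2 * (sp i - sp (Suc i)) + 4 * \<kappa> * B'\<^sup>2 * \<tau> * (t - s) * D)"
      using \<tau> by (intro mult_left_mono) auto
    then have "lpn M p (\<lambda>x. sqrt ((\<psi>' x)\<^sup>2 + \<tau>\<^sup>2)) \<le> A i
         + 3 / \<tau> * (2 * \<tau>\<^sup>2 * (sp i - sp (Suc i)) + 4 * \<kappa> * B'\<^sup>2 * \<tau> * (t - s) * D) + (t - s) * B' * D + \<eta>"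
      using \<psi>(4) \<psi>'(4) unfolding \<eta>_def by linarith
    also have "\<dots> = A (Suc i)"
      unfolding A_def s_def t_def by (simp add: algebra_simps)
    finally show ?case using \<psi>'(1-3) unfolding W_Suc
      by (intro exI[of _ \<psi>'] exI[of _ Q']) (auto simp: s_def t_def)
  qed
  from this[OF h] obtain \<psi> Q where \<psi>: "\<psi> \<in> borel_measurable M" "\<And>x. \<bar>\<psi> x\<bar> \<le> Q"
      "\<And>x. U (th h) x - W h x = \<psi> x + (LINT y|M. sat_flux b \<epsilon> \<psi> x y)"
      "lpn M p (\<lambda>x. sqrt ((\<psi> x)\<^sup>2 + \<tau>\<^sup>2)) \<le> A h" by blast
  define \<Lambda> where "\<Lambda> x = (LINT y|M. sat_flux b \<epsilon> \<psi> x y)" for x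
  have \<Lambda>: "\<Lambda> \<in> borel_measurable M" "\<And>x. \<bar>\<Lambda> x\<bar> \<le> b"
  proof -
    show "\<Lambda> \<in> borel_measurable M"
      unfolding \<Lambda>_def using sat_flux_meas[OF \<psi>(1)] by (intro borel_measurable_lebesgue_integral) (simp add: split_beta)
    show "\<bar>\<Lambda> x\<bar> \<le> b" for x
      unfolding \<Lambda>_def by (rule abs_integral_le[OF sat_flux_section[OF \<psi>(1)] sat_flux_bound[OF b0]])
  qed
  have "lpn M p (\<lambda>x. U (th h) x - W h x) \<le> lpn M p \<psi> + lpn M p \<Lambda>"
    unfolding \<psi>(3) \<Lambda>_def[symmetric] by (rule lpn_triangle[OF \<psi>(1,2) \<Lambda> p1(1)])
  also have "lpn M p \<psi> \<le> A h"
    using smoothed_norm_ge(2)[OF \<tau> p1(2) \<psi>(1,2)] \<psi>(4) by simp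
  also have "lpn M p \<Lambda> \<le> b" by (rule lpn_const_bound[OF \<Lambda> p1(2)])
  also have "A h + b \<le> E0 + th h * (12 * \<kappa> * B'\<^sup>2 + B') * D + (2 + 6 * square_norm (V 0) + 4 * \<kappa>' * B) * \<tau>"
  proof -
    have "3 / \<tau> * (2 * \<tau>\<^sup>2 * (sp 0 - sp h) + 4 * \<kappa> * B'\<^sup>2 * \<tau> * th h * D)
        = 6 * \<tau> * (sp 0 - sp h) + 12 * \<kappa> * B'\<^sup>2 * th h * D"
      using \<tau> by (simp add: power2_eq_square field_simps)
    also have "\<dots> \<le> 6 * \<tau> * sp 0 + 12 * \<kappa> * B'\<^sup>2 * th h * D"
      using \<tau> square_norm_nonneg by (simp add: sp_def)
    finally show ?thesis using \<eta>[OF h] by (simp add: A_def b_def sp_def th algebra_simps)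
  qed
  finally show ?thesis by (simp add: W_def E0_def)
qed

text \<open>
  The flux error is split at the exact solution of time \<open>s\<close>. The part \<open>q2\<close>, from the motion of the exact solution within the step, is
  \<open>O((t - s)\<^sup>2)\<close>. The part \<open>q1\<close> transports a fraction between \<open>0\<close> and \<open>1\<close> of \<open>e y - e x\<close> from \<open>y\<close> to \<open>x\<close>. By Jensen's inequality in
  \<open>y\<close> and convexity of the power in each pair, this does not increase the norm of \<open>e\<close>.
\<close>

lemma Lipschitz_step:
  assumes st: "0 \<le> s" "s \<le> t" and p: "1 \<le> p" and L: "\<And>a c. \<bar>\<theta> a - \<theta> c\<bar> \<le> L * \<bar>a - c\<bar>" and small: "\<kappa>' * L * (t - s) \<le> 1"
    and z: "z \<in> borel_measurable M" "\<And>x. \<bar>z x\<bar> \<le> R"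
  shows "lpn M p (\<lambda>x. U t x - (z x + (t - s) * F k' z x)) \<le> lpn M p (\<lambda>x. U s x - z x)
     + (t - s) * B' * lpn (M \<Otimes>\<^sub>M M) p (\<lambda>q. k (fst q) (snd q) - k' (fst q) (snd q))
     + 2 * \<kappa>' * L * \<kappa> * B' * (t - s)\<^sup>2"
proof -
  have p0: "0 < p" using p by simp
  have L0: "0 \<le> L" using L[of 1 0] by (simp add: order_trans[OF abs_ge_zero])
  note [measurable] = kernel_pair_meas[OF k'] kernel_pair_meas[OF k] integrated_flux_meas z(1) u_meas[OF k g]
  define e where "e x = U s x - z x" for x
  have e_meas [measurable]: "e \<in> borel_measurable M" unfolding e_def by measurable
  have e_bd: "\<bar>e x\<bar> \<le> G + R" for x using u_bound[OF k g, of s x] z(2)[of x] unfolding e_def by linarith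
  define q1 where "q1 x y = k' x y * ((t - s) * (\<theta> (U s y - U s x) - \<theta> (z y - z x)))" for x y
  define q2 where "q2 x y = k' x y * (integrated_flux s t x y - (t - s) * \<theta> (U s y - U s x))" for x y
  have q_meas: "(\<lambda>p. q1 (fst p) (snd p)) \<in> borel_measurable (M \<Otimes>\<^sub>M M)"
    "(\<lambda>p. q2 (fst p) (snd p)) \<in> borel_measurable (M \<Otimes>\<^sub>M M)"
    unfolding q1_def q2_def by measurable
  note [measurable] = q_meas
  have sec: "f x \<in> borel_measurable M" if "(\<lambda>p. f (fst p) (snd p)) \<in> borel_measurable (M \<Otimes>\<^sub>M M)" for f :: "'a \<Rightarrow> 'a \<Rightarrow> real" and x
    using section_meas[of f] that by (simp add: split_beta)
  have q2_bd: "\<bar>q2 x y\<bar> \<le> 2 * \<kappa>' * L * \<kappa> * B' * (t - s)\<^sup>2" for x y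
  proof -
    have th: "(\<lambda>r. \<theta> (U r y - U r x)) \<in> borel_measurable borel" by (rule theta_time_meas)
    have "integrated_flux s t x y - (t - s) * \<theta> (U s y - U s x)
        = (LINT r|time_measure s t. \<theta> (U r y - U r x) - \<theta> (U s y - U s x))"
      using time_integrable[OF th theta_bound] time_integrable[of "\<lambda>_. \<theta> (U s y - U s x)" B s t] theta_bound
        time_integral_const[OF st(2), of "\<theta> (U s y - U s x)"]
      by (simp only: integrated_flux_def) (subst Bochner_Integration.integral_diff, auto)
    also have "\<bar>\<dots>\<bar> \<le> (t - s) * (L * (2 * (\<kappa> * B' * (t - s))))"
    proof (rule time_integral_abs_le[OF _ theta_diff_le st(2)])
      show "\<bar>\<theta> (U r y - U r x) - \<theta> (U s y - U s x)\<bar> \<le> L * (2 * (\<kappa> * B' * (t - s)))" if r: "s \<le> r" "r \<le> t" for r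
      proof -
        have mono: "\<kappa> * B' * (r - s) \<le> \<kappa> * B' * (t - s)"
          using r sym_kernel_const[OF k] B'_nonneg by (intro mult_left_mono) auto
        have "\<bar>(U r y - U r x) - (U s y - U s x)\<bar> \<le> 2 * (\<kappa> * B' * (t - s))"
          using u_slow[OF st(1) r(1), of y] u_slow[OF st(1) r(1), of x] mono by linarith
        then show ?thesis using L[of "U r y - U r x" "U s y - U s x"] L0
          by (meson mult_left_mono order_trans)
      qed
    qed (use th in measurable)
    finally have "\<bar>q2 x y\<bar> \<le> \<kappa>' * ((t - s) * (L * (2 * (\<kappa> * B' * (t - s)))))"
      unfolding q2_def abs_mult using sym_kernel_bounds[OF k', of x y] by (intro mult_mono) auto
    then show ?thesis by (simp add: power2_eq_square mult_ac)
  qed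
  have q1_between: "0 \<le> q1 x y \<and> q1 x y \<le> e y - e x \<or> e y - e x \<le> q1 x y \<and> q1 x y \<le> 0" for x y
  proof -
    define a where "a = U s y - U s x"
    define c where "c = z y - z x"
    have ac: "e y - e x = a - c" by (simp add: e_def a_def c_def)
    have k0: "0 \<le> k' x y * (t - s)" "k' x y * (t - s) \<le> \<kappa>' * (t - s)"
      using sym_kernel_bounds[OF k', of x y] st by (auto intro: mult_right_mono)
    have "\<bar>q1 x y\<bar> \<le> \<bar>a - c\<bar>"
    proof -
      have "\<bar>q1 x y\<bar> = k' x y * (t - s) * \<bar>\<theta> a - \<theta> c\<bar>"
        using abs_mult[of "k' x y * (t - s)" "\<theta> a - \<theta> c"] abs_of_nonneg[OF k0(1)]
        by (simp only: q1_def a_def c_def mult.assoc)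
      also have "\<dots> \<le> \<kappa>' * (t - s) * (L * \<bar>a - c\<bar>)"
        by (rule mult_mono[OF k0(2) L]) (use order_trans[OF k0] in auto)
      also have "\<dots> = (\<kappa>' * L * (t - s)) * \<bar>a - c\<bar>" by (simp add: mult_ac)
      also have "\<dots> \<le> 1 * \<bar>a - c\<bar>" using small by (intro mult_right_mono) auto
      finally show ?thesis by simp
    qed
    moreover have "q1 x y = (k' x y * (t - s)) * (\<theta> a - \<theta> c)" by (simp add: q1_def a_def c_def)
    ultimately show ?thesis unfolding ac
      using k0(1) theta_le[of a c] theta_le[of c a]
      by (cases "c \<le> a") (auto simp: mult_nonneg_nonpos)
  qed
  have q1_bd: "\<bar>q1 x y\<bar> \<le> 2 * (G + R)" for x y
    using q1_between[of x y] e_bd[of x] e_bd[of y] by (auto simp: abs_le_iff)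
  have q1_anti: "q1 y x = - q1 x y" for x y
    using theta_odd[of "U s y - U s x"] theta_odd[of "z y - z x"] sym_kernel_sym[OF k', of y x]
    by (simp add: q1_def algebra_simps)
  define Q1 where "Q1 x = (LINT y|M. q1 x y)" for x
  define Q2 where "Q2 x = (LINT y|M. q2 x y)" for x
  have Q_meas [measurable]: "Q1 \<in> borel_measurable M" "Q2 \<in> borel_measurable M"
    unfolding Q1_def Q2_def using q_meas by (auto intro!: borel_measurable_lebesgue_integral simp: split_beta)
  have Q1_bd: "\<bar>Q1 x\<bar> \<le> 2 * (G + R)" for x unfolding Q1_def by (rule abs_integral_le[OF sec[OF q_meas(1)] q1_bd])
  have Q2_bd: "\<bar>Q2 x\<bar> \<le> 2 * \<kappa>' * L * \<kappa> * B' * (t - s)\<^sup>2" for x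
    unfolding Q2_def by (rule abs_integral_le[OF sec[OF q_meas(2)] q2_bd])
  have contraction: "lpn M p (\<lambda>x. e x + Q1 x) \<le> lpn M p e"
  proof (rule lpn_le[OF p0 lpn_nonneg])
    define h where "h x y = \<bar>e x + q1 x y\<bar> powr p" for x y
    have h_meas [measurable]: "(\<lambda>q. h (fst q) (snd q)) \<in> borel_measurable (M \<Otimes>\<^sub>M M)" unfolding h_def by measurable
    have eq_bd: "\<bar>e x + q1 x y\<bar> \<le> G + R" for x y
      using q1_between[of x y] e_bd[of x] e_bd[of y] by (auto simp: abs_le_iff)
    have GR: "0 \<le> G + R" using e_bd order_trans abs_ge_zero by blast
    have h_bd: "\<bar>h x y\<bar> \<le> (G + R) powr p" for x y unfolding h_def using eq_bd p0 by (auto intro!: powr_mono2)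
    have h_int: "integrable (M \<Otimes>\<^sub>M M) (\<lambda>q. h (fst q) (snd q))" by (rule integrable_sq_bounded[OF h_meas h_bd])
    have h_int': "integrable (M \<Otimes>\<^sub>M M) (\<lambda>q. h (snd q) (fst q))"
    proof (rule integrable_sq_bounded[OF _ h_bd])
      show "(\<lambda>q. h (snd q) (fst q)) \<in> borel_measurable (M \<Otimes>\<^sub>M M)"
        using measurable_compose[OF measurable_pair_swap' h_meas] by (simp add: split_beta)
    qed
    have ep_int: "integrable M (\<lambda>x. \<bar>e x\<bar> powr p)" by (rule powr_integrable[OF e_meas e_bd p0])
    have e_powr: "\<bar>\<bar>e x\<bar> powr p\<bar> \<le> (G + R) powr p" for x using e_bd[of x] p0 by (auto intro!: powr_mono2)
    have e2_int: "integrable (M \<Otimes>\<^sub>M M) (\<lambda>q. \<bar>e (fst q)\<bar> powr p)" "integrable (M \<Otimes>\<^sub>M M) (\<lambda>q. \<bar>e (snd q)\<bar> powr p)"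
      by (rule integrable_sq_bounded[OF _ e_powr]; measurable)+
    have sym_sum: "h x y + h y x \<le> \<bar>e x\<bar> powr p + \<bar>e y\<bar> powr p" for x y
    proof (cases "e y = e x")
      case True
      then have "q1 x y = 0" "q1 y x = 0" using q1_between[of x y] q1_between[of y x] by auto
      then show ?thesis by (simp add: h_def)
    next
      case False
      define l where "l = q1 x y / (e y - e x)"
      have l: "0 \<le> l" "l \<le> 1" "q1 x y = l * (e y - e x)"
        using q1_between[of x y] False by (auto simp: l_def divide_le_eq zero_le_divide_iff)
      have "e x + q1 x y = (1 - l) * e x + l * e y" using l(3) by (simp add: algebra_simps)
      then have "\<bar>e x + q1 x y\<bar> \<le> (1 - l) * \<bar>e x\<bar> + l * \<bar>e y\<bar>"
        using abs_triangle_ineq[of "(1 - l) * e x" "l * e y"] l by (simp add: abs_mult)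
      then have "h x y \<le> ((1 - l) * \<bar>e x\<bar> + l * \<bar>e y\<bar>) powr p" unfolding h_def using p0 by (intro powr_mono2) auto
      also have "\<dots> \<le> (1 - l) * \<bar>e x\<bar> powr p + l * \<bar>e y\<bar> powr p"
        using l p by (intro powr_convex_combination) auto
      finally have 1: "h x y \<le> (1 - l) * \<bar>e x\<bar> powr p + l * \<bar>e y\<bar> powr p" .
      have "e y + q1 y x = (1 - l) * e y + l * e x" using l(3) q1_anti[of x y] by (simp add: algebra_simps)
      then have "\<bar>e y + q1 y x\<bar> \<le> (1 - l) * \<bar>e y\<bar> + l * \<bar>e x\<bar>"
        using abs_triangle_ineq[of "(1 - l) * e y" "l * e x"] l by (simp add: abs_mult)
      then have "h y x \<le> ((1 - l) * \<bar>e y\<bar> + l * \<bar>e x\<bar>) powr p" unfolding h_def using p0 by (intro powr_mono2) auto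
      also have "\<dots> \<le> (1 - l) * \<bar>e y\<bar> powr p + l * \<bar>e x\<bar> powr p"
        using l p by (intro powr_convex_combination) auto
      finally show ?thesis using 1 by (simp add: algebra_simps)
    qed
    have "(LINT x|M. \<bar>e x + Q1 x\<bar> powr p) \<le> (LINT x|M. LINT y|M. h x y)"
    proof (rule integral_mono)
      have "\<bar>e x + Q1 x\<bar> \<le> G + R + 2 * (G + R)" for x using e_bd[of x] Q1_bd[of x] by linarith
      then show "integrable M (\<lambda>x. \<bar>e x + Q1 x\<bar> powr p)" by (intro powr_integrable[OF _ _ p0]) auto
      show "integrable M (\<lambda>x. LINT y|M. h x y)" using sq.integrable_fst'[OF h_int] by simp
      show "\<bar>e x + Q1 x\<bar> powr p \<le> (LINT y|M. h x y)" for x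
      proof -
        have "e x + Q1 x = (LINT y|M. e x + q1 x y)"
          unfolding Q1_def using integrable_bounded[OF sec[OF q_meas(1)] q1_bd, of x] by (simp add: prob_space)
        then show ?thesis unfolding h_def
          using abs_integral_powr_le[of "\<lambda>y. e x + q1 x y" "G + R" p, OF _ eq_bd p] sec[OF q_meas(1), of x] by simp
      qed
    qed
    also have "\<dots> = (LINT q|(M \<Otimes>\<^sub>M M). h (fst q) (snd q))" by (rule iterated_integral[OF h_meas h_bd])
    also have "\<dots> = ((LINT q|(M \<Otimes>\<^sub>M M). h (fst q) (snd q)) + (LINT q|(M \<Otimes>\<^sub>M M). h (snd q) (fst q))) / 2"
      using sq.integral_product_swap[OF h_meas] by (simp add: case_prod_beta')
    also have "\<dots> = (LINT q|(M \<Otimes>\<^sub>M M). h (fst q) (snd q) + h (snd q) (fst q)) / 2"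
      using h_int h_int' by simp
    also have "\<dots> \<le> (LINT q|(M \<Otimes>\<^sub>M M). \<bar>e (fst q)\<bar> powr p + \<bar>e (snd q)\<bar> powr p) / 2"
      using h_int h_int' e2_int sym_sum by (intro divide_right_mono integral_mono) auto
    also have "\<dots> = ((LINT q|(M \<Otimes>\<^sub>M M). \<bar>e (fst q)\<bar> powr p) + (LINT q|(M \<Otimes>\<^sub>M M). \<bar>e (snd q)\<bar> powr p)) / 2"
      using e2_int by simp
    also have "\<dots> = (LINT x|M. \<bar>e x\<bar> powr p)"
    proof -
      have "(LINT q|(M \<Otimes>\<^sub>M M). \<bar>e (fst q)\<bar> powr p) = (LINT x|M. LINT y|M. \<bar>e x\<bar> powr p)"
        by (rule iterated_integral[OF _ e_powr, symmetric]) measurable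
      moreover have "(LINT q|(M \<Otimes>\<^sub>M M). \<bar>e (snd q)\<bar> powr p) = (LINT x|M. LINT y|M. \<bar>e y\<bar> powr p)"
        by (rule iterated_integral[OF _ e_powr, symmetric]) measurable
      ultimately show ?thesis by (simp add: prob_space)
    qed
    also have "\<dots> = lpn M p e powr p" using p0 by (simp add: lpn_powr)
    finally show "(LINT x|M. \<bar>e x + Q1 x\<bar> powr p) \<le> lpn M p e powr p" .
  qed
  have split: "(LINT y|M. step_flux s t z x y) = Q1 x + Q2 x" for x
  proof -
    have "(LINT y|M. step_flux s t z x y) = (LINT y|M. q1 x y + q2 x y)"
      by (intro Bochner_Integration.integral_cong) (auto simp: step_flux_def q1_def q2_def algebra_simps)
    then show ?thesis unfolding Q1_def Q2_def
      using integrable_bounded[OF sec[OF q_meas(1)] q1_bd, of x] integrable_bounded[OF sec[OF q_meas(2)] q2_bd, of x] by simp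
  qed
  note kd = kernel_defect_meas[of s t] kernel_defect_bound[OF st(2)]
  have eQ: "(\<lambda>x. e x + Q1 x) \<in> borel_measurable M" by measurable
  have eQ_bd: "\<bar>e x + Q1 x\<bar> \<le> G + R + 2 * (G + R)" for x using e_bd[of x] Q1_bd[of x] by linarith
  have eQQ_bd: "\<bar>e x + Q1 x + Q2 x\<bar> \<le> G + R + 2 * (G + R) + 2 * \<kappa>' * L * \<kappa> * B' * (t - s)\<^sup>2" for x
    using eQ_bd[of x] Q2_bd[of x] by linarith
  have "U t x - (z x + (t - s) * F k' z x) = (e x + Q1 x + Q2 x) + kernel_defect s t x" for x
    unfolding error_increment[OF st z(1)] split by (simp add: e_def)
  then have "lpn M p (\<lambda>x. U t x - (z x + (t - s) * F k' z x)) = lpn M p (\<lambda>x. (e x + Q1 x + Q2 x) + kernel_defect s t x)"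
    by simp
  also have "\<dots> \<le> lpn M p (\<lambda>x. e x + Q1 x + Q2 x) + lpn M p (kernel_defect s t)"
    by (rule lpn_triangle[OF _ eQQ_bd kd p]) measurable
  also have "lpn M p (\<lambda>x. e x + Q1 x + Q2 x) \<le> lpn M p (\<lambda>x. e x + Q1 x) + lpn M p Q2"
    by (rule lpn_triangle[OF eQ eQ_bd Q_meas(2) Q2_bd p])
  also have "lpn M p Q2 \<le> 2 * \<kappa>' * L * \<kappa> * B' * (t - s)\<^sup>2" by (rule lpn_const_bound[OF Q_meas(2) Q2_bd p0])
  finally show ?thesis using contraction kernel_defect_lpn[OF st(2) p] by (simp add: e_def[abs_def])
qed

lemma Lipschitz_error:
  assumes p: "1 \<le> p" and L: "\<And>a c. \<bar>\<theta> a - \<theta> c\<bar> \<le> L * \<bar>a - c\<bar>" and small: "\<kappa>' * L * \<tau> \<le> 1"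
    and th: "th 0 = 0" "\<And>i. i < N \<Longrightarrow> th i \<le> th (Suc i) \<and> th (Suc i) \<le> th i + \<tau>" and h: "h \<le> N"
    and g0: "g0 \<in> borel_measurable M" "\<And>x. \<bar>g0 x\<bar> \<le> G0"
  defines "D \<equiv> lpn (M \<Otimes>\<^sub>M M) p (\<lambda>q. k (fst q) (snd q) - k' (fst q) (snd q))"
  shows "lpn M p (\<lambda>x. U (th h) x - eul k' g0 (\<lambda>i. th (Suc i) - th i) h x)
     \<le> lpn M p (\<lambda>x. g x - g0 x) + th h * (B' * D + 2 * \<kappa>' * L * \<kappa> * B' * \<tau>)"
proof -
  define W where "W = eul k' g0 (\<lambda>i. th (Suc i) - th i)"
  have W_Suc: "W (Suc i) = (\<lambda>x. W i x + (th (Suc i) - th i) * F k' (W i) x)" for i by (simp add: W_def)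
  have W_meas: "W i \<in> borel_measurable M" for i unfolding W_def by (rule eul_meas[OF k' g0(1)])
  have W_bd: "\<exists>R. \<forall>x. \<bar>W i x\<bar> \<le> R" for i
    unfolding W_def by (rule eul_bounded[OF k' g0])
  have th_nonneg: "0 \<le> th i" if "i \<le> N" for i
    using that th by (induction i) (auto intro: order_trans)
  have L0: "0 \<le> L" using L[of 1 0] by (simp add: order_trans[OF abs_ge_zero])
  have "lpn M p (\<lambda>x. U (th h) x - W h x) \<le> lpn M p (\<lambda>x. g x - g0 x) + th h * (B' * D + 2 * \<kappa>' * L * \<kappa> * B' * \<tau>)"
    using h
  proof (induction h)
    case 0
    then show ?case by (simp add: W_def th sol_nonpos)
  next
    case (Suc i)
    then have i: "i < N" "i \<le> N" by auto
    define s where "s = th i"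
    define t where "t = th (Suc i)"
    have st: "0 \<le> s" "s \<le> t" "t - s \<le> \<tau>" using th(2)[OF i(1)] th_nonneg[OF i(2)] by (auto simp: s_def t_def)
    obtain R where R: "\<And>x. \<bar>W i x\<bar> \<le> R" using W_bd by blast
    have \<kappa>L: "0 \<le> \<kappa>' * L" using sym_kernel_const[OF k'] L0 by simp
    have sm: "\<kappa>' * L * (t - s) \<le> 1"
      using mult_left_mono[OF st(3) \<kappa>L] small by linarith
    have "0 \<le> 2 * (\<kappa>' * L) * (\<kappa> * B')" using \<kappa>L sym_kernel_const[OF k] B'_nonneg by simp
    then have c: "0 \<le> 2 * \<kappa>' * L * \<kappa> * B'" by (simp only: mult.assoc)
    have "(t - s)\<^sup>2 \<le> \<tau> * (t - s)" using st by (simp add: power2_eq_square mult_right_mono)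
    then have "2 * \<kappa>' * L * \<kappa> * B' * (t - s)\<^sup>2 \<le> 2 * \<kappa>' * L * \<kappa> * B' * (\<tau> * (t - s))"
      using c by (rule mult_left_mono)
    moreover have "lpn M p (\<lambda>x. U t x - (W i x + (t - s) * F k' (W i) x)) \<le> lpn M p (\<lambda>x. U s x - W i x)
       + (t - s) * B' * D + 2 * \<kappa>' * L * \<kappa> * B' * (t - s)\<^sup>2"
      unfolding D_def by (rule Lipschitz_step[OF st(1,2) p L sm W_meas R])
    ultimately have "lpn M p (\<lambda>x. U t x - W (Suc i) x) \<le> lpn M p (\<lambda>x. g x - g0 x) + s * (B' * D + 2 * \<kappa>' * L * \<kappa> * B' * \<tau>)
       + (t - s) * B' * D + 2 * \<kappa>' * L * \<kappa> * B' * (\<tau> * (t - s))"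
      using Suc.IH[OF i(2)] unfolding W_Suc s_def t_def by linarith
    also have "\<dots> = lpn M p (\<lambda>x. g x - g0 x) + t * (B' * D + 2 * \<kappa>' * L * \<kappa> * B' * \<tau>)"
      by (simp add: algebra_simps)
    finally show ?case by (simp add: t_def)
  qed
  then show ?thesis by (simp add: W_def)
qed

end

end

section \<open>Lebesgue classes and their Borel representatives\<close>

text \<open>
  The Borel counterpart of \<open>lebesgue_on S\<close>, spread over the whole type. Integrals and null sets agree with
  those of \<open>lebesgue_on S\<close>, while products of such measures remain of the same form.
\<close>

definition volume_on :: "'a::euclidean_space set \<Rightarrow> 'a measure" where
  "volume_on S = density lborel (indicator S)"

lemma space_volume_on [simp]: "space (volume_on S) = UNIV"
  and sets_volume_on [simp, measurable_cong]: "sets (volume_on S) = sets borel"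
  by (simp_all add: volume_on_def)

lemma AE_lebesgue_on:
  assumes "S \<in> sets borel"
  shows "(AE x in lebesgue_on S. P x) \<longleftrightarrow> (AE x in volume_on S. P x)"
proof -
  have "(AE x in lebesgue_on S. P x) \<longleftrightarrow> (AE x in lebesgue. x \<in> S \<longrightarrow> P x)"
    using assms by (intro AE_restrict_space_iff) auto
  also have "\<dots> \<longleftrightarrow> (AE x in lborel. x \<in> S \<longrightarrow> P x)" by (rule AE_completion_iff)
  also have "\<dots> \<longleftrightarrow> (AE x in volume_on S. P x)"
    unfolding volume_on_def using assms by (subst AE_density) (auto simp: indicator_def)
  finally show ?thesis .
qed

lemma AE_volume_on: "S \<in> sets borel \<Longrightarrow> AE x in volume_on S. x \<in> S"
  unfolding volume_on_def by (subst AE_density) (auto simp: indicator_def)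

lemma integral_volume_on:
  assumes "S \<in> sets borel" "f \<in> borel_measurable borel"
  shows "(LINT x|volume_on S. f x) = (LINT x|lborel. indicator S x * f x :: real)"
    and "integrable (volume_on S) f \<longleftrightarrow> integrable lborel (\<lambda>x. indicator S x * f x)"
proof -
  have eq: "volume_on S = density lborel (\<lambda>x. ennreal (indicator S x))"
    by (simp add: volume_on_def ennreal_indicator)
  show "(LINT x|volume_on S. f x) = (LINT x|lborel. indicator S x * f x)"
    unfolding eq using assms by (subst integral_density) auto
  show "integrable (volume_on S) f \<longleftrightarrow> integrable lborel (\<lambda>x. indicator S x * f x)"
    unfolding eq using assms by (subst integrable_density) auto
qed

lemma borel_representative:
  fixes f :: "'a::euclidean_space \<Rightarrow> real"
  assumes S: "S \<in> sets borel" and f: "f \<in> borel_measurable (lebesgue_on S)"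
  obtains f' where "f' \<in> borel_measurable borel" "AE x in volume_on S. f x = f' x"
proof -
  have "(\<lambda>x. indicator S x *\<^sub>R f x) \<in> borel_measurable lebesgue"
    using f S by (subst borel_measurable_restrict_space_iff[symmetric]) auto
  from completion_ex_borel_measurable_real[OF this]
  obtain f' where f': "f' \<in> borel_measurable lborel" "AE x in lborel. indicator S x *\<^sub>R f x = f' x" by blast
  have "AE x in volume_on S. f x = f' x"
    unfolding volume_on_def using S f'(2) by (subst AE_density) (auto simp: indicator_def elim!: eventually_mono)
  then show ?thesis using that f'(1) by simp
qed

text \<open>
  The Lebesgue measure is complete, so a function that agrees almost everywhere with a Borel function is measurable.
\<close>

lemma lebesgue_on_representative:
  fixes f f' :: "'a::euclidean_space \<Rightarrow> real"
  assumes S: "S \<in> sets borel" and f': "f' \<in> borel_measurable borel" and eq: "AE x in volume_on S. f x = f' x"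
  shows "f \<in> borel_measurable (lebesgue_on S)"
    and "integrable (lebesgue_on S) f \<longleftrightarrow> integrable (volume_on S) f'"
    and "(LINT x|lebesgue_on S. f x) = (LINT x|volume_on S. f' x)"
proof -
  have eq': "AE x in lebesgue. indicator S x * f' x = indicator S x * f x"
    using eq unfolding AE_lebesgue_on[OF S, symmetric] using S
    by (subst (asm) AE_restrict_space_iff) (auto simp: indicator_def elim!: eventually_mono)
  have m': "(\<lambda>x. indicator S x * f' x) \<in> borel_measurable lborel" using S f' by measurable
  have ml: "(\<lambda>x. indicator S x * f' x) \<in> borel_measurable lebesgue" by (rule measurable_completion[OF m'])
  have m: "(\<lambda>x. indicator S x * f x) \<in> borel_measurable lebesgue"
    by (rule borel_measurable_AE[OF ml eq'])
  show "f \<in> borel_measurable (lebesgue_on S)"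
    using m S by (subst borel_measurable_restrict_space_iff) auto
  show "integrable (lebesgue_on S) f \<longleftrightarrow> integrable (volume_on S) f'"
  proof -
    have "integrable (lebesgue_on S) f \<longleftrightarrow> integrable lebesgue (\<lambda>x. indicator S x * f x)"
      using S by (subst integrable_restrict_space) auto
    also have "\<dots> \<longleftrightarrow> integrable lebesgue (\<lambda>x. indicator S x * f' x)"
      using eq' by (intro integrable_cong_AE m ml) (auto elim!: eventually_mono)
    also have "\<dots> \<longleftrightarrow> integrable (volume_on S) f'"
      unfolding integral_volume_on(2)[OF S f'] by (rule integrable_completion[OF m'])
    finally show ?thesis .
  qed
  have "(LINT x|lebesgue_on S. f x) = (LINT x|lebesgue. indicator S x * f x)"
    using S by (subst integral_restrict_space) auto
  also have "\<dots> = (LINT x|lebesgue. indicator S x * f' x)"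
    using eq' by (intro integral_cong_AE m ml) (auto elim!: eventually_mono)
  also have "\<dots> = (LINT x|volume_on S. f' x)"
    unfolding integral_volume_on(1)[OF S f'] by (rule integral_completion[OF m'])
  finally show "(LINT x|lebesgue_on S. f x) = (LINT x|volume_on S. f' x)" .
qed

lemma Lp_norm_representative:
  fixes f f' :: "'a::euclidean_space \<Rightarrow> real"
  assumes S: "S \<in> sets borel" and f': "f' \<in> borel_measurable borel" "\<And>x. \<bar>f' x\<bar> \<le> C" and eq: "AE x in volume_on S. f x = f' x"
    and p: "0 < p" and prob: "prob_space (volume_on S)"
  shows "Lp_norm p S f = ennreal (lpn (volume_on S) p f')"
proof -
  interpret prob_space "volume_on S" by (rule prob)
  have m: "(\<lambda>x. \<bar>f' x\<bar> powr p) \<in> borel_measurable borel" using f' by measurable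
  have eq': "AE x in volume_on S. \<bar>f x\<bar> powr p = \<bar>f' x\<bar> powr p" using eq by eventually_elim simp
  have "integrable (volume_on S) (\<lambda>x. \<bar>f' x\<bar> powr p)"
    using f' p by (intro powr_integrable) auto
  then show ?thesis
    unfolding Lp_norm_def lpn_def
    using lebesgue_on_representative[OF S f'(1) eq] lebesgue_on_representative[OF S m eq'] by simp
qed

abbreviation unit_volume :: "real measure" where
  "unit_volume \<equiv> volume_on \<Omega>"

lemma prob_space_unit_volume: "prob_space unit_volume"
  by (rule prob_spaceI) (simp add: volume_on_def emeasure_density emeasure_lborel_Icc_eq)

interpretation unit: flux_space unit_volume
proof -
  interpret prob_space unit_volume by (rule prob_space_unit_volume)
  show "flux_space unit_volume" by unfold_locales simp
qed

lemma volume_on_Times: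
  assumes S: "(S :: real set) \<in> sets borel" "(T :: real set) \<in> sets borel" "finite_measure (volume_on T)"
  shows "volume_on (S \<times> T) = volume_on S \<Otimes>\<^sub>M volume_on T"
proof -
  interpret T: finite_measure "density lborel (indicator T)" using S(3) by (simp add: volume_on_def)
  have "volume_on S \<Otimes>\<^sub>M volume_on T = density (lborel \<Otimes>\<^sub>M lborel) (\<lambda>(x, y). indicator S x * indicator T y)"
    unfolding volume_on_def using S by (intro pair_measure_density) (auto intro: sigma_finite_lborel T.sigma_finite_measure_axioms)
  also have "\<dots> = volume_on (S \<times> T)"
    unfolding volume_on_def lborel_prod by (intro arg_cong[where f="density lborel"]) (auto simp: fun_eq_iff indicator_def)
  finally show ?thesis by simp
qed

lemma unit_square_volume: "volume_on (\<Omega> \<times> \<Omega>) = unit_volume \<Otimes>\<^sub>M unit_volume"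
  by (rule volume_on_Times) (auto intro: prob_space.finite_measure prob_space_unit_volume)

lemma Linfty_representative:
  assumes "Linfty \<Omega> f"
  obtains f' C where "f' \<in> borel_measurable borel" "\<And>x. \<bar>f' x\<bar> \<le> C" "0 < C" "AE x in unit_volume. f x = f' x"
proof -
  have S: "\<Omega> \<in> sets borel" by simp
  obtain C where C: "AE x in unit_volume. \<bar>f x\<bar> \<le> C"
    using assms unfolding Linfty_def AE_lebesgue_on[OF S] by blast
  obtain f0 where f0: "f0 \<in> borel_measurable borel" "AE x in unit_volume. f x = f0 x"
    using assms borel_representative[OF S, of f] unfolding Linfty_def by blast
  define D where "D = \<bar>C\<bar> + 1"
  show ?thesis
  proof (rule that[of "\<lambda>x. clip D (f0 x)" D])
    show "(\<lambda>x. clip D (f0 x)) \<in> borel_measurable borel" using f0(1) by measurable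
    show "\<bar>clip D (f0 x)\<bar> \<le> D" for x by (rule clip_bound) (simp add: D_def)
    show "0 < D" by (simp add: D_def)
    show "AE x in unit_volume. f x = clip D (f0 x)"
      using C f0(2) by eventually_elim (auto simp: clip_def D_def)
  qed
qed

text \<open>
  Averaging with the transposed kernel and clipping make symmetry and bounds hold at every point, not just almost
  everywhere.
\<close>

lemma kernel_representative:
  assumes "kernel K"
  obtains k \<kappa> where "unit.sym_kernel k \<kappa>" "AE p in unit_volume \<Otimes>\<^sub>M unit_volume. K (fst p) (snd p) = k (fst p) (snd p)"
proof -
  have S: "\<Omega> \<times> \<Omega> \<in> sets borel" by (intro borel_closed closed_Times) auto
  have K: "(\<lambda>(x, y). K x y) \<in> borel_measurable (lebesgue_on (\<Omega> \<times> \<Omega>))"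
    "\<And>x y. x \<in> \<Omega> \<Longrightarrow> y \<in> \<Omega> \<Longrightarrow> K x y = K y x" "\<And>x y. x \<in> \<Omega> \<Longrightarrow> y \<in> \<Omega> \<Longrightarrow> 0 \<le> K x y"
    "bounded ((\<lambda>(x, y). K x y) ` (\<Omega> \<times> \<Omega>))"
    using assms unfolding kernel_def by blast+
  obtain \<kappa>0 where \<kappa>0: "\<And>z. z \<in> (\<lambda>(x, y). K x y) ` (\<Omega> \<times> \<Omega>) \<Longrightarrow> norm z \<le> \<kappa>0"
    using K(4) unfolding bounded_iff by blast
  then have K_le: "\<bar>K x y\<bar> \<le> \<kappa>0" if "x \<in> \<Omega>" "y \<in> \<Omega>" for x y
    using that \<kappa>0[of "K x y"] by (force simp: image_iff)
  define \<kappa> where "\<kappa> = \<bar>\<kappa>0\<bar>"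
  obtain f where f: "f \<in> borel_measurable borel" "AE p in volume_on (\<Omega> \<times> \<Omega>). (\<lambda>(x, y). K x y) p = f p"
    by (rule borel_representative[OF S K(1)])
  define k where "k x y = max 0 (min \<kappa> ((f (x, y) + f (y, x)) / 2))" for x y
  let ?P = "unit_volume \<Otimes>\<^sub>M unit_volume"
  have AE1: "AE p in ?P. K (fst p) (snd p) = f p"
    using f(2) unfolding unit_square_volume by (simp add: split_beta)
  then have "AE p in distr ?P ?P (\<lambda>(x, y). (y, x)). K (fst p) (snd p) = f p"
    by (subst unit.sq.distr_pair_swap[symmetric])
  then have AE2: "AE p in ?P. K (snd p) (fst p) = f (snd p, fst p)"
    by (auto dest!: AE_distrD[OF measurable_pair_swap'] simp: split_beta)
  have AE3: "AE p in ?P. p \<in> \<Omega> \<times> \<Omega>"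
    using AE_volume_on[OF S] unfolding unit_square_volume .
  show ?thesis
  proof (rule that)
    have [measurable]: "f \<in> borel_measurable (borel \<Otimes>\<^sub>M borel)" using f(1) by (simp add: borel_prod)
    have "case_prod k \<in> borel_measurable ?P" unfolding k_def by measurable
    moreover have "k x y = k y x" "0 \<le> k x y" "k x y \<le> \<kappa>" for x y
      by (auto simp: k_def \<kappa>_def add.commute)
    ultimately show "unit.sym_kernel k \<kappa>" unfolding unit.sym_kernel_def by blast
    show "AE p in ?P. K (fst p) (snd p) = k (fst p) (snd p)"
      using AE1 AE2 AE3
    proof eventually_elim
      case (elim p)
      then have "0 \<le> K (fst p) (snd p)" "K (fst p) (snd p) \<le> \<kappa>" "K (fst p) (snd p) = K (snd p) (fst p)"
        using K(2)[of "fst p" "snd p"] K(3)[of "fst p" "snd p"] K_le[of "fst p" "snd p"]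
        by (auto simp: \<kappa>_def mem_Times_iff)
      moreover have "f (fst p, snd p) = K (fst p) (snd p)" "f (snd p, fst p) = K (snd p) (fst p)"
        using elim by simp_all
      ultimately show ?case by (simp add: k_def)
    qed
  qed
qed

section \<open>The truncated p-Laplacian\<close>

definition truncated_power :: "real \<Rightarrow> real \<Rightarrow> real \<Rightarrow> real" where
  "truncated_power p b s = \<bar>clip b s\<bar> powr (p - 2) * clip b s"

text \<open>
  In this form monotonicity and continuity follow from those of the power with the positive exponent \<open>p - 1\<close>.
\<close>

lemma signed_power_split:
  fixes s p :: real
  assumes "1 < p"
  shows "\<bar>s\<bar> powr (p - 2) * s = max s 0 powr (p - 1) - max (- s) 0 powr (p - 1)"
proof -
  have pos: "x powr (p - 2) * x = x powr (p - 1)" if "0 \<le> x" for x :: real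
    using powr_mult_base[OF that, of "p - 2"] by (simp add: mult.commute add.commute)
  show ?thesis
    using pos[of s] pos[of "- s"] by (cases "0 \<le> s") (auto simp: max_def)
qed

lemma signed_power_mono:
  fixes s t p :: real
  assumes "1 < p" "s \<le> t"
  shows "\<bar>s\<bar> powr (p - 2) * s \<le> \<bar>t\<bar> powr (p - 2) * t"
  unfolding signed_power_split[OF assms(1)]
  using assms by (intro diff_mono powr_mono2) auto

lemma truncated_power_eq: "\<bar>s\<bar> \<le> b \<Longrightarrow> truncated_power p b s = \<bar>s\<bar> powr (p - 2) * s"
  by (auto simp: truncated_power_def clip_def)

lemma truncated_power_bound:
  assumes "1 < p" "0 \<le> b"
  shows "\<bar>truncated_power p b s\<bar> \<le> b powr (p - 1)"
proof -
  have "\<bar>truncated_power p b s\<bar> = \<bar>clip b s\<bar> powr (p - 1)"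
    using powr_mult_base[of "\<bar>clip b s\<bar>" "p - 2"] by (simp add: truncated_power_def abs_mult mult.commute add.commute)
  then show ?thesis using assms clip_bound[of b s] by (auto intro!: powr_mono2)
qed

lemma powr_increment:
  fixes x y q :: real
  assumes "0 \<le> y" "y \<le> x" "x \<le> b" "1 \<le> q"
  shows "x powr q - y powr q \<le> q * b powr (q - 1) * (x - y)"
proof (cases "x = 0")
  case True
  then show ?thesis using assms by simp
next
  case False
  have "x powr q - y powr q \<le> q * x powr (q - 1) * (x - y)"
    using powr_tangent[of y x q] False assms by (simp add: algebra_simps)
  also have "\<dots> \<le> q * b powr (q - 1) * (x - y)"
    using assms by (intro mult_right_mono mult_left_mono powr_mono2) auto
  finally show ?thesis .
qed

lemma truncated_power_Lipschitz:
  assumes p: "2 \<le> p" and b: "0 \<le> b"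
  shows "\<bar>truncated_power p b s - truncated_power p b t\<bar> \<le> (p - 1) * b powr (p - 2) * \<bar>s - t\<bar>"
proof -
  define L where "L = (p - 1) * b powr (p - 2)"
  have L0: "0 \<le> L" using p by (simp add: L_def)
  have le: "0 \<le> truncated_power p b t - truncated_power p b s
      \<and> truncated_power p b t - truncated_power p b s \<le> L * (t - s)" if st: "s \<le> t" for s t
  proof -
    define a c where "a = clip b s" and "c = clip b t"
    have ac: "a \<le> c" "c - a \<le> t - s" "\<bar>a\<bar> \<le> b" "\<bar>c\<bar> \<le> b"
      using st b clip_mono clip_Lipschitz clip_bound by (auto simp: a_def c_def)
    have p1: "1 < p" "1 \<le> p - 1" using p by auto
    have "max c 0 powr (p - 1) - max a 0 powr (p - 1) \<le> L * (max c 0 - max a 0)"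
      using powr_increment[of "max a 0" "max c 0" b "p - 1"] ac p1 b
      by (fastforce simp: L_def max_def)
    moreover have "max (- a) 0 powr (p - 1) - max (- c) 0 powr (p - 1) \<le> L * (max (- a) 0 - max (- c) 0)"
      using powr_increment[of "max (- c) 0" "max (- a) 0" b "p - 1"] ac p1 b
      by (fastforce simp: L_def max_def)
    moreover have "L * (max c 0 - max a 0) + L * (max (- a) 0 - max (- c) 0) = L * (c - a)"
      unfolding distrib_left[symmetric] by (simp add: max_def)
    moreover have "L * (c - a) \<le> L * (t - s)" using ac L0 by (intro mult_left_mono) auto
    moreover have "truncated_power p b s \<le> truncated_power p b t"
      unfolding truncated_power_def using signed_power_mono[OF p1(1) ac(1)] by (simp add: a_def c_def)
    ultimately show ?thesis
      unfolding truncated_power_def a_def[symmetric] c_def[symmetric] signed_power_split[OF p1(1)] by linarith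
  qed
  show ?thesis
    using le[of s t] le[of t s] unfolding L_def[symmetric] by (cases "s \<le> t") (auto simp: abs_if)
qed

lemma truncated_power_flux:
  assumes p: "1 < p" and b: "0 < b"
  shows "flux unit_volume (truncated_power p b) (b powr (p - 1))"
proof -
  interpret prob_space unit_volume by (rule prob_space_unit_volume)
  show ?thesis
  proof
    show "\<bar>truncated_power p b s\<bar> \<le> b powr (p - 1)" for s using p b by (intro truncated_power_bound) auto
    show "truncated_power p b (- s) = - truncated_power p b s" for s
      using b by (simp add: truncated_power_def clip_minus)
    show "mono (truncated_power p b)"
      unfolding truncated_power_def using p by (intro monoI signed_power_mono clip_mono)
    have "uniformly_continuous_on {- b..b} (\<lambda>s. \<bar>s\<bar> powr (p - 2) * s)"
      unfolding signed_power_split[OF p]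
      using p by (intro compact_uniformly_continuous continuous_on_powr' continuous_intros) auto
    moreover have "range (clip b) \<subseteq> {- b..b}" using b by (auto simp: clip_def)
    ultimately have u: "uniformly_continuous_on (range (clip b)) (\<lambda>s. \<bar>s\<bar> powr (p - 2) * s)"
      unfolding uniformly_continuous_on_def by (meson subsetD)
    have c: "uniformly_continuous_on UNIV (clip b)"
      by (rule lipschitz_on_uniformly_continuous[where L=1], rule lipschitz_onI)
        (auto simp: dist_real_def clip_def max_def min_def)
    have "uniformly_continuous_on UNIV (\<lambda>s. \<bar>clip b s\<bar> powr (p - 2) * clip b s)"
      by (rule uniformly_continuous_on_compose[OF c u])
    then show "uniformly_continuous_on UNIV (truncated_power p b)"
      by (simp add: truncated_power_def[abs_def])
  qed
qed

text \<open>
  The product of \<open>u\<close> with the test function vanishes at both ends of the interval.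
\<close>

lemma weak_derivative_by_parts:
  assumes \<phi>: "test_function T \<phi>" and T: "0 < T"
    and u: "\<And>t. t \<in> {0..T} \<Longrightarrow> (u has_real_derivative v t) (at t within {0..T})"
    and v: "continuous_on {0..T} v"
  shows "(LINT t|lebesgue_on {0<..<T}. deriv \<phi> t * u t) = - (LINT t|lebesgue_on {0<..<T}. \<phi> t * v t)"
proof -
  have d: "(deriv ^^ i) \<phi> field_differentiable (at t)" for i t
    using \<phi> unfolding test_function_def by blast
  have supp: "closure {t. \<phi> t \<noteq> 0} \<subseteq> {0<..<T}"
    using \<phi> unfolding test_function_def by blast
  have D: "(\<phi> has_real_derivative deriv \<phi> t) (at t within S)" for t S
    using d[of 0 t] by (auto simp: DERIV_deriv_iff_field_differentiable[symmetric] intro: has_field_derivative_at_within)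
  have "continuous_on {0..T} \<phi>" by (rule DERIV_continuous_on[OF D])
  moreover have "continuous_on {0..T} (deriv \<phi>)"
    using d[of 1] by (intro continuous_at_imp_continuous_on ballI field_differentiable_imp_continuous_at) simp
  moreover have "continuous_on {0..T} u" by (rule DERIV_continuous_on[OF u])
  ultimately have cont: "continuous_on {0..T} (\<lambda>t. deriv \<phi> t * u t)" "continuous_on {0..T} (\<lambda>t. \<phi> t * v t)"
    using v by (auto intro: continuous_on_mult)
  have int: "integrable (lebesgue_on {0<..<T}) f \<and> (f has_integral (LINT t|lebesgue_on {0<..<T}. f t)) {0..T}"
    if "continuous_on {0..T} f" for f :: "real \<Rightarrow> real"
  proof -
    have "f absolutely_integrable_on {0<..<T}"
      using absolutely_integrable_continuous_real[OF that] by (rule set_integrable_subset) auto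
    then have "integrable (lebesgue_on {0<..<T}) f"
      by (simp add: set_integrable_def integrable_restrict_space)
    then show ?thesis
      using has_integral_integral_lebesgue_on[of "{0<..<T}" f] by (auto simp: has_integral_Icc_iff_Ioo)
  qed
  have zero: "\<phi> 0 = 0" "\<phi> T = 0"
  proof -
    have "\<phi> s = 0" if "s \<notin> {0<..<T}" for s
      using supp that closure_subset[of "{t. \<phi> t \<noteq> 0}"] by blast
    then show "\<phi> 0 = 0" "\<phi> T = 0" by auto
  qed
  have "((\<lambda>t. deriv \<phi> t * u t + \<phi> t * v t) has_integral \<phi> T * u T - \<phi> 0 * u 0) {0..T}"
    using T by (intro fundamental_theorem_of_calculus)
      (auto simp: has_real_derivative_iff_has_vector_derivative[symmetric] intro!: derivative_eq_intros D u)
  moreover have "((\<lambda>t. deriv \<phi> t * u t + \<phi> t * v t) has_integral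
      (LINT t|lebesgue_on {0<..<T}. deriv \<phi> t * u t) + (LINT t|lebesgue_on {0<..<T}. \<phi> t * v t)) {0..T}"
    using int[OF cont(1)] int[OF cont(2)] by (intro has_integral_add) auto
  ultimately have "\<phi> T * u T - \<phi> 0 * u 0
      = (LINT t|lebesgue_on {0<..<T}. deriv \<phi> t * u t) + (LINT t|lebesgue_on {0<..<T}. \<phi> t * v t)"
    by (rule has_integral_unique)
  then show ?thesis unfolding zero by simp
qed

lemma AE_snd_pair:
  assumes "finite_measure N" "finite_measure M" "AE x in M. P x"
  shows "AE q in N \<Otimes>\<^sub>M M. P (snd q)"
proof -
  interpret N: finite_measure N by fact
  interpret M: finite_measure M by fact
  interpret pair_sigma_finite N M ..
  obtain Z where Z: "Z \<in> null_sets M" "{x \<in> space M. \<not> P x} \<subseteq> Z"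
    using assms(3) by (auto simp: eventually_ae_filter)
  then have Z': "Z \<in> sets M" "AE x in M. x \<notin> Z" by (auto intro: AE_not_in)
  have "AE q in N \<Otimes>\<^sub>M M. snd q \<notin> Z"
    using Z' by (intro AE_pair_measure) auto
  then show ?thesis
    using AE_space
  proof eventually_elim
    case (elim q)
    then have "snd q \<in> space M" by (simp add: space_pair_measure mem_Times_iff)
    then show ?case using Z(2) elim(1) by blast
  qed
qed

text \<open>
  The truncation at \<open>2 * R\<close> does not affect differences of functions bounded by \<open>R\<close>.
\<close>

locale truncated_flux =
  fixes p R :: real
  assumes p: "1 < p" and R: "0 < R"
begin

sublocale flux unit_volume "truncated_power p (2 * R)" "(2 * R) powr (p - 1)"
  using p R by (intro truncated_power_flux) auto

lemma p_laplacian_eq: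
  assumes k: "unit.sym_kernel k \<kappa>" and z: "z \<in> borel_measurable borel" "\<And>y. \<bar>z y\<bar> \<le> R"
    and eq: "AE y in unit_volume. K x y = k x y" "AE y in unit_volume. z' y = z y" "z' x = z x"
  shows "integrable (lebesgue_on \<Omega>) (p_integrand p K z' x)" "p_laplacian p K z' x = - F k z x"
proof -
  define f where "f y = k x y * truncated_power p (2 * R) (z y - z x)" for y
  have z': "z \<in> borel_measurable unit_volume" using z by simp
  have i: "integrable unit_volume f"
    unfolding f_def by (rule flux_integrand_section[OF k z'])
  then have m: "f \<in> borel_measurable borel" by (auto dest: borel_measurable_integrable)
  have S: "\<Omega> \<in> sets borel" by simp
  have "AE y in unit_volume. p_integrand p K z' x y = f y"
    using eq(1,2)
  proof eventually_elim
    case (elim y)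
    have "\<bar>z y - z x\<bar> \<le> 2 * R" using z(2)[of x] z(2)[of y] by linarith
    then show ?case by (simp add: p_integrand_def f_def elim eq truncated_power_eq)
  qed
  note rep = lebesgue_on_representative[OF S m this]
  show "integrable (lebesgue_on \<Omega>) (p_integrand p K z' x)" using rep(2) i by simp
  show "p_laplacian p K z' x = - F k z x"
    unfolding p_laplacian_def rep(3) F_def f_def by simp
qed

text \<open>
  The classical derivative in time is the weak one, the bound on it gives continuity in $L^1$, and the equation
  holds at all times for every \<open>x\<close> at which \<open>K x y = k x y\<close> for almost all \<open>y\<close>.
\<close>

lemma sol_is_solution:
  assumes k: "unit.sym_kernel k \<kappa>" and K: "AE x in unit_volume. AE y in unit_volume. K x y = k x y"
    and g: "g' \<in> borel_measurable borel" "\<And>x. \<bar>g' x\<bar> \<le> R" and geq: "AE x in unit_volume. g x = g' x"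
    and T: "0 < T"
  shows "is_solution p K g T (sol k g')"
proof -
  let ?B = "(2 * R) powr (p - 1)"
  define U V where "U = sol k g'" and "V t = F k (U t)" for t
  have g': "g' \<in> borel_measurable unit_volume" "\<And>x. \<bar>g' x\<bar> \<le> R" using g by auto
  note um = u_meas[OF k g', folded U_def] and ub = u_bound[OF k g', folded U_def]
    and vb = v_bound[OF k g', folded U_def, folded V_def]
  have Om: "\<Omega> \<in> sets borel" by simp
  define S where "S = {0<..<T} \<times> \<Omega>"
  have S: "S \<in> sets borel" unfolding S_def by (simp add: borel_prod[symmetric])
  have finT: "finite_measure (volume_on {0<..<T})"
    using T by (intro finite_measureI) (simp add: volume_on_def emeasure_density)
  have fin1: "finite_measure unit_volume" by (rule prob_space.finite_measure[OF prob_space_unit_volume])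
  have prod: "volume_on S = volume_on {0<..<T} \<Otimes>\<^sub>M unit_volume"
    unfolding S_def by (rule volume_on_Times) (auto intro: fin1)
  interpret pT: finite_measure "volume_on {0<..<T}" by (rule finT)
  interpret p1: finite_measure unit_volume by (rule fin1)
  interpret pp: pair_sigma_finite "volume_on {0<..<T}" unit_volume ..
  have finS: "finite_measure (volume_on S)"
    unfolding prod by (intro finite_measure_pair_measure finT fin1)
  interpret fS: finite_measure "volume_on S" by (rule finS)
  have joint: "(\<lambda>(t, x). U t x) \<in> borel_measurable (borel \<Otimes>\<^sub>M unit_volume)"
    unfolding U_def by (rule sol_joint_meas[OF k g'(1)])
  have V_joint: "(\<lambda>(t, x). V t x) \<in> borel_measurable (borel \<Otimes>\<^sub>M unit_volume)"
  proof -
    have [measurable]: "(\<lambda>q. k (snd (fst q)) (snd q)) \<in> borel_measurable ((borel \<Otimes>\<^sub>M unit_volume) \<Otimes>\<^sub>M unit_volume)"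
      using measurable_compose[of "\<lambda>q. (snd (fst q), snd q)" "(borel \<Otimes>\<^sub>M unit_volume) \<Otimes>\<^sub>M unit_volume", OF _ unit.sym_kernel_meas[OF k]]
      by simp
    have [measurable]: "(\<lambda>q. U (fst (fst q)) (snd q)) \<in> borel_measurable ((borel \<Otimes>\<^sub>M unit_volume) \<Otimes>\<^sub>M unit_volume)"
      using measurable_compose[of "\<lambda>q. (fst (fst q), snd q)" "(borel \<Otimes>\<^sub>M unit_volume) \<Otimes>\<^sub>M unit_volume", OF _ joint]
      by simp
    have [measurable]: "(\<lambda>q. U (fst (fst q)) (snd (fst q))) \<in> borel_measurable ((borel \<Otimes>\<^sub>M unit_volume) \<Otimes>\<^sub>M unit_volume)"
      using measurable_compose[of fst "(borel \<Otimes>\<^sub>M unit_volume) \<Otimes>\<^sub>M unit_volume", OF _ joint]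
      by (simp add: split_beta)
    show ?thesis unfolding V_def F_def split_beta by measurable
  qed
  have setsP: "sets (borel \<Otimes>\<^sub>M unit_volume) = sets (borel :: (real \<times> real) measure)"
    by (subst borel_prod[symmetric]) (intro sets_pair_measure_cong, auto)
  have Um: "(\<lambda>(t, x). U t x) \<in> borel_measurable borel" and Vm: "(\<lambda>(t, x). V t x) \<in> borel_measurable borel"
    using joint V_joint measurable_cong_sets[OF setsP refl] by auto
  have int: "integrable (lebesgue_on S) f" if f: "f \<in> borel_measurable borel" "\<And>q. \<bar>f q\<bar> \<le> (C::real)" for f C
  proof -
    have "integrable (volume_on S) f" using f by (intro fS.integrable_const_bound[where B=C]) auto
    then show ?thesis using lebesgue_on_representative(2)[OF S f(1), of f] by simp
  qed
  have deriv_U: "((\<lambda>t. U t x) has_real_derivative V t x) (at t within {0..T})" if "t \<in> {0..T}" for t x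
    unfolding V_def U_def by (rule DERIV_subset[OF u_deriv[OF k g']]) (use that in auto)
  have V_cont: "continuous_on {0..T} (\<lambda>t. V t x)" for x
  proof (rule continuous_on_sequentiallyI)
    fix s and a assume s: "\<forall>n. s n \<in> {0..T}" "a \<in> {0..T}" "s \<longlonglongrightarrow> a"
    have "(\<lambda>n. U (s n) y) \<longlonglongrightarrow> U a y" for y
      by (rule continuous_on_tendsto_compose[OF DERIV_continuous_on[OF deriv_U] s(3)]) (use s in auto)
    then show "(\<lambda>n. V (s n) x) \<longlonglongrightarrow> V a x"
      unfolding V_def by (intro F_tendsto[OF k] um)
  qed
  have "W11_with_deriv T U V"
    unfolding W11_with_deriv_def S_def[symmetric]
  proof (intro conjI allI impI AE_I2)
    show "integrable (lebesgue_on S) (\<lambda>(t, x). U t x)" by (rule int[OF Um, of R]) (auto simp: ub)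
    show "integrable (lebesgue_on S) (\<lambda>(t, x). V t x)" by (rule int[OF Vm, of "\<kappa> * ?B"]) (auto simp: vb)
    show "(LINT t|lebesgue_on {0<..<T}. deriv \<phi> t * U t x) = - (LINT t|lebesgue_on {0<..<T}. \<phi> t * V t x)"
      if "test_function T \<phi>" for \<phi> x
      by (rule weak_derivative_by_parts[OF that T deriv_U V_cont])
  qed
  moreover have "continuous_in_L1 T U"
    unfolding continuous_in_L1_def
  proof (intro conjI ballI)
    fix t assume t: "t \<in> {0..T}"
    have um': "U s \<in> borel_measurable borel" for s using um[of s] by simp
    show "integrable (lebesgue_on \<Omega>) (U t)"
      using lebesgue_on_representative(2)[OF Om um', of "U t" t] unit.integrable_bounded[OF um ub] by simp
    have Lip: "\<bar>U s x - U t x\<bar> \<le> \<kappa> * ?B * \<bar>s - t\<bar>" if "s \<in> {0..T}" for s x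
      using sol_Lipschitz[OF k g'(1), of s t x] sol_Lipschitz[OF k g'(1), of t s x] that t
      by (cases "s \<le> t") (auto simp: U_def abs_minus_commute)
    have L1: "\<bar>LINT x|lebesgue_on \<Omega>. \<bar>U s x - U t x\<bar>\<bar> \<le> \<kappa> * ?B * \<bar>s - t\<bar>" if "s \<in> {0..T}" for s
    proof -
      have m: "(\<lambda>x. \<bar>U s x - U t x\<bar>) \<in> borel_measurable borel" using um' by measurable
      have "(LINT x|lebesgue_on \<Omega>. \<bar>U s x - U t x\<bar>) = (LINT x|unit_volume. \<bar>U s x - U t x\<bar>)"
        using lebesgue_on_representative(3)[OF Om m, of "\<lambda>x. \<bar>U s x - U t x\<bar>"] by simp
      moreover have "\<bar>LINT x|unit_volume. \<bar>U s x - U t x\<bar>\<bar> \<le> \<kappa> * ?B * \<bar>s - t\<bar>"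
        using m Lip[OF that] by (intro unit.abs_integral_le) auto
      ultimately show ?thesis by simp
    qed
    have "((\<lambda>s. \<kappa> * ?B * \<bar>s - t\<bar>) \<longlongrightarrow> \<kappa> * ?B * \<bar>t - t\<bar>) (at t within {0..T})"
      by (intro tendsto_intros)
    then have lim: "((\<lambda>s. \<kappa> * ?B * \<bar>s - t\<bar>) \<longlongrightarrow> 0) (at t within {0..T})" by simp
    have "\<forall>\<^sub>F s in at t within {0..T}. s \<in> {0..T}" by (auto simp: eventually_at_filter)
    then have "\<forall>\<^sub>F s in at t within {0..T}. norm (LINT x|lebesgue_on \<Omega>. \<bar>U s x - U t x\<bar>) \<le> \<kappa> * ?B * \<bar>s - t\<bar>"
      by eventually_elim (use L1 in simp)
    then show "((\<lambda>s. LINT x|lebesgue_on \<Omega>. \<bar>U s x - U t x\<bar>) \<longlongrightarrow> 0) (at t within {0..T})"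
      using lim by (rule Lim_null_comparison)
  qed
  moreover have "AE x in lebesgue_on \<Omega>. U 0 x = g x"
    unfolding AE_lebesgue_on[OF Om] U_def using geq by (simp add: sol_nonpos eq_commute)
  moreover have "AE (t, x) in lebesgue_on S. integrable (lebesgue_on \<Omega>) (p_integrand p K (U t) x) \<and>
           V t x = - p_laplacian p K (U t) x"
    unfolding AE_lebesgue_on[OF S] unfolding prod
    using AE_snd_pair[OF finT fin1 K]
  proof eventually_elim
    case (elim q)
    have "U (fst q) \<in> borel_measurable borel" using um[of "fst q"] by simp
    note eq = p_laplacian_eq[where k=k and K=K and z="U (fst q)" and z'="U (fst q)" and x="snd q", OF k this ub elim]
    have "V (fst q) (snd q) = - p_laplacian p K (U (fst q)) (snd q)"
      unfolding eq(2)[OF AE_I2[OF refl] refl] V_def by simp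
    with eq(1)[OF AE_I2[OF refl] refl] show ?case unfolding split_beta by (rule conjI)
  qed
  ultimately show ?thesis
    unfolding is_solution_def U_def[symmetric] S_def[symmetric] by (intro exI[of _ V] conjI)
qed

end

section \<open>Convergence of the interpolated scheme\<close>

lemma partition_strict:
  assumes "partition T N th" "i < j" "j \<le> N"
  shows "th i < th j"
proof -
  have "th i < th (Suc (i + d))" if "i + d < N" for d
    using that
  proof (induction d)
    case 0
    then show ?case using assms(1) by (simp add: partition_def)
  next
    case (Suc d)
    then have "th i < th (Suc (i + d))" "th (Suc (i + d)) < th (Suc (i + Suc d))"
      using assms(1) by (auto simp: partition_def)
    then show ?case by simp
  qed
  from this[of "j - Suc i"] show ?thesis using assms by simp
qed

lemma partition_facts:
  assumes part: "partition T N th" and T: "0 < T"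
  shows "th 0 = 0" "th N = T" "0 < max_step N th"
    and "\<And>h. h < N \<Longrightarrow> th h < th (Suc h) \<and> th (Suc h) \<le> th h + max_step N th"
    and "\<And>h. h \<le> N \<Longrightarrow> 0 \<le> th h \<and> th h \<le> T"
proof -
  show th: "th 0 = 0" "th N = T" using part by (auto simp: partition_def)
  have inc: "th h < th (Suc h)" if "h < N" for h using part that by (auto simp: partition_def)
  have step: "th (Suc h) \<le> th h + max_step N th" if "h < N" for h
  proof -
    have "\<bar>th (Suc h) - th (Suc h - 1)\<bar> \<le> max_step N th"
      unfolding max_step_def using that by (intro Max_ge image_eqI[of _ _ "Suc h"]) auto
    then show ?thesis by simp
  qed
  show "th h < th (Suc h) \<and> th (Suc h) \<le> th h + max_step N th" if "h < N" for h
    using inc step that by blast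
  have "0 < N" using th T by (cases N) auto
  then show "0 < max_step N th" using inc[of 0] step[of 0] by simp
  have le: "th i \<le> th j" if "i \<le> j" "j \<le> N" for i j
    using that partition_strict[OF part, of i j] by (cases "i = j") auto
  show "0 \<le> th h \<and> th h \<le> T" if "h \<le> N" for h
    using le[of 0 h] le[of h N] that th by simp
qed

text \<open>
  On a grid interval the interpolant continues the Euler step linearly. The time \<open>0\<close>, which belongs to no half-open
  interval of the partition, fits in with \<open>h = 0\<close>.
\<close>

lemma euler_interp_eq:
  assumes part: "partition T N th" and T: "0 < T" and t: "t \<in> {0..T}"
  obtains h where "h < N" "th h \<le> t" "t \<le> th (Suc h)"
    "\<And>x. euler_interp p K g0 N th t x = euler p K g0 th h x
        - (t - th h) * p_laplacian p K (euler p K g0 th h) x"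
proof (cases "t = 0")
  case True
  have "0 < N" using partition_facts(1,2)[OF part T] T by (cases N) auto
  moreover have "th 0 \<le> th (Suc 0)" using partition_strict[OF part, of 0 "Suc 0"] \<open>0 < N\<close> by simp
  ultimately show ?thesis
    using True partition_facts(1)[OF part T] by (intro that[of 0]) (auto simp: euler_interp_def)
next
  case False
  note pf = partition_facts[OF part T]
  define m where "m = (LEAST m. t \<le> th m)"
  have ex: "t \<le> th N" using t pf by simp
  then have m: "t \<le> th m" "m \<le> N" unfolding m_def by (auto intro: LeastI Least_le)
  have "m \<noteq> 0" using m(1) pf(1) t False by (auto intro: ccontr)
  then obtain h where h: "m = Suc h" by (cases m) auto
  have "\<not> t \<le> th h" unfolding m_def using not_less_Least[of h "\<lambda>m. t \<le> th m"] h m_def by simp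
  then have th: "th h < t" "t \<le> th (Suc h)" "h < N" using m h by auto
  have "(THE h. h \<in> {1..N} \<and> t \<in> {th (h - 1)<..th h}) = Suc h"
  proof (rule the_equality)
    fix j assume j: "j \<in> {1..N} \<and> t \<in> {th (j - 1)<..th j}"
    have "\<not> j < Suc h"
    proof
      assume "j < Suc h"
      then have "th j \<le> th h" using partition_strict[OF part, of j h] th(3) by (cases "j = h") auto
      then show False using j th by simp
    qed
    moreover have "\<not> Suc h < j"
    proof
      assume "Suc h < j"
      then have "th (Suc h) \<le> th (j - 1)"
        using partition_strict[OF part, of "Suc h" "j - 1"] j
        by (cases "j = Suc (Suc h)") (auto intro!: less_imp_le Suc_lessI simp: less_diff_conv)
      then show False using j th by simp
    qed
    ultimately show "j = Suc h" by simp
  qed (use th in auto)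
  then have "euler_interp p K g0 N th t x = euler p K g0 th h x
        - (t - th h) * p_laplacian p K (euler p K g0 th h) x" for x
  proof -
    assume the: "(THE h. h \<in> {1..N} \<and> t \<in> {th (h - 1)<..th h}) = Suc h"
    define d where "d = th (Suc h) - th h"
    have d: "0 < d" using th by (simp add: d_def)
    define e where "e = euler p K g0 th h x"
    define L where "L = p_laplacian p K (euler p K g0 th h) x"
    have "euler_interp p K g0 N th t x = (th (Suc h) - t) / d * e + (t - th h) / d * (e - d * L)"
      unfolding euler_interp_def the Let_def using False d by (simp add: e_def L_def d_def)
    also have "\<dots> = ((th (Suc h) - t) + (t - th h)) / d * e - (t - th h) / d * d * L"
      by (simp add: add_divide_distrib diff_divide_distrib algebra_simps)
    also have "\<dots> = e - (t - th h) * L" using d by (simp add: d_def)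
    finally show ?thesis by (simp add: e_def L_def)
  qed
  then show ?thesis using th by (intro that[of h]) auto
qed

context truncated_flux
begin

context
begin

private abbreviation (input) "B \<equiv> (2 * R) powr (p - 1)"
private abbreviation (input) "steps th \<equiv> (\<lambda>i. th (Suc i) - th i :: real)"

text \<open>
  As long as the iterates are bounded by \<open>R\<close>, the truncation is not felt.
\<close>

lemma euler_eq:
  assumes k: "unit.sym_kernel k \<kappa>" and K: "AE x in unit_volume. AE y in unit_volume. K x y = k x y"
    and g: "g' \<in> borel_measurable borel" and geq: "AE x in unit_volume. g x = g' x"
    and th: "\<And>i. i < N \<Longrightarrow> th i \<le> th (Suc i)"
    and bd: "\<And>i x. i < N \<Longrightarrow> \<bar>eul k g' (steps th) i x\<bar> \<le> R" and h: "h \<le> N"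
  shows "AE x in unit_volume. euler p K g th h x = eul k g' (steps th) h x"
  using h
proof (induction h)
  case 0
  then show ?case using geq by simp
next
  case (Suc h)
  then have IH: "AE x in unit_volume. euler p K g th h x = eul k g' (steps th) h x" and hN: "h < N" by auto
  have m: "eul k g' (steps th) h \<in> borel_measurable borel"
    using eul_meas[OF k, of g' "steps th" h] g by simp
  show ?case
    using IH K
  proof eventually_elim
    case (elim x)
    have "p_laplacian p K (euler p K g th h) x = - F k (eul k g' (steps th) h) x"
      by (rule p_laplacian_eq(2)[where k=k and K=K, OF k m bd[OF hN] elim(2) IH elim(1)])
    then show ?case using th[OF hN] elim(1) by simp
  qed
qed

lemma euler_interp_representative:
  assumes k: "unit.sym_kernel k \<kappa>" and K: "AE x in unit_volume. AE y in unit_volume. K x y = k x y"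
    and g: "g' \<in> borel_measurable borel" and geq: "AE x in unit_volume. g x = g' x"
    and part: "partition T N th" and T: "0 < T" and t: "t \<in> {0..T}"
    and bd: "\<And>i x. i \<le> N \<Longrightarrow> \<bar>eul k g' (steps th) i x\<bar> \<le> R"
  obtains h where "h \<le> N" "th h \<le> t" "t \<le> th h + max_step N th"
    "AE x in unit_volume. euler_interp p K g N th t x = eul k g' (steps th) h x + (t - th h) * F k (eul k g' (steps th) h) x"
proof -
  note pf = partition_facts[OF part T]
  obtain h where h: "h < N" "th h \<le> t" "t \<le> th (Suc h)" and
    eq: "\<And>x. euler_interp p K g N th t x = euler p K g th h x
        - (t - th h) * p_laplacian p K (euler p K g th h) x"
    by (rule euler_interp_eq[OF part T t]) blast
  have hN: "h \<le> N" using h by simp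
  have IH: "AE x in unit_volume. euler p K g th h x = eul k g' (steps th) h x"
    using pf(4) bd hN by (intro euler_eq[OF k K g geq, where N=N]) (auto intro: less_imp_le)
  have m: "eul k g' (steps th) h \<in> borel_measurable borel"
    using eul_meas[OF k, of g' "steps th" h] g by simp
  have "AE x in unit_volume. euler_interp p K g N th t x = eul k g' (steps th) h x + (t - th h) * F k (eul k g' (steps th) h) x"
    using IH K
  proof eventually_elim
    case (elim x)
    have "p_laplacian p K (euler p K g th h) x = - F k (eul k g' (steps th) h) x"
      by (rule p_laplacian_eq(2)[where k=k and K=K, OF k m bd[OF hN] elim(2) IH elim(1)])
    then show ?case using elim(1) by (simp add: eq)
  qed
  then show ?thesis using h pf(4)[OF h(1)] by (intro that[of h]) auto
qed

text \<open>
  The drift allowed by \<open>eul_bound\<close> over the whole interval is \<open>T * \<kappa> * \<delta>\<close>, which is at most \<open>1\<close> for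
  \<open>\<delta> = 1 / (T * \<kappa> + 1)\<close>.
\<close>

lemma eul_stays_bounded:
  assumes k: "unit.sym_kernel k \<kappa>" and g: "g' \<in> borel_measurable borel" "\<And>x. \<bar>g' x\<bar> \<le> G"
    and GR: "G + 1 \<le> R" and T: "0 < T"
  shows "\<exists>\<tau>\<^sub>0>0. \<forall>N th h x. partition T N th \<and> max_step N th \<le> \<tau>\<^sub>0 \<and> h \<le> N \<longrightarrow> \<bar>eul k g' (steps th) h x\<bar> \<le> R"
proof -
  have g': "g' \<in> borel_measurable unit_volume" using g by simp
  have \<kappa>: "0 \<le> \<kappa>" by (rule unit.sym_kernel_const[OF k])
  have B: "0 \<le> B" by simp
  define \<delta> where "\<delta> = 1 / (T * \<kappa> + 1)"
  have pos: "0 < T * \<kappa> + 1" using T \<kappa> by (simp add: add_nonneg_pos)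
  then have \<delta>: "0 < \<delta>" "T * \<kappa> * \<delta> \<le> 1" by (auto simp: \<delta>_def divide_le_eq)
  obtain r where r: "0 < r" "\<And>a b. \<bar>a - b\<bar> < r \<Longrightarrow> \<bar>truncated_power p (2 * R) a - truncated_power p (2 * R) b\<bar> \<le> \<delta>"
    by (rule theta_modulus[OF \<delta>(1)]) blast
  define \<tau>\<^sub>0 where "\<tau>\<^sub>0 = r / (\<kappa> * (2 * B) + 1)"
  have q0: "0 \<le> \<kappa> * (2 * B)" using \<kappa> B by simp
  then have q: "0 < \<kappa> * (2 * B) + 1" by linarith
  have \<tau>0: "0 < \<tau>\<^sub>0" using r q by (simp add: \<tau>\<^sub>0_def)
  have small: "\<tau>\<^sub>0 * (\<kappa> * (2 * B)) \<le> r"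
  proof -
    have "\<tau>\<^sub>0 * (\<kappa> * (2 * B)) \<le> \<tau>\<^sub>0 * (\<kappa> * (2 * B) + 1)" using \<tau>0 by (intro mult_left_mono) auto
    then show ?thesis using q by (simp add: \<tau>\<^sub>0_def)
  qed
  have "\<bar>eul k g' (steps th) h x\<bar> \<le> R" if part: "partition T N th" and ms: "max_step N th \<le> \<tau>\<^sub>0" and h: "h \<le> N" for N th h x
  proof -
    note pf = partition_facts[OF part T]
    have st: "0 \<le> steps th i \<and> steps th i * \<kappa> * (2 * B) \<le> r" if "i < h" for i
    proof -
      have i: "0 \<le> steps th i" "steps th i \<le> \<tau>\<^sub>0" using pf(4)[of i] that h ms by auto
      have "steps th i * (\<kappa> * (2 * B)) \<le> \<tau>\<^sub>0 * (\<kappa> * (2 * B))" using i(2) q0 by (rule mult_right_mono)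
      then show ?thesis using i(1) small unfolding mult.assoc by linarith
    qed
    have sum: "(\<Sum>i<h. steps th i) = th h" using pf(1) by (simp add: sum_lessThan_telescope)
    have "\<bar>eul k g' (steps th) h x\<bar> \<le> G + th h * \<kappa> * \<delta>"
      unfolding sum[symmetric] by (rule eul_bound[OF k g' g(2) r(2) less_imp_le[OF \<delta>(1)] st])
    moreover have "th h * \<kappa> * \<delta> \<le> T * \<kappa> * \<delta>"
      using pf(5)[OF h] \<kappa> \<delta> by (intro mult_right_mono) auto
    ultimately show ?thesis using \<delta>(2) GR by linarith
  qed
  then show ?thesis using \<tau>0 by blast
qed

text \<open>
  The two regimes of \<open>p\<close> combined. The factor of \<open>D\<close> does not contain \<open>R\<close>, which depends on the datum of the scheme.
\<close>

lemma grid_error: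
  assumes k: "unit.sym_kernel k \<kappa>" and k': "unit.sym_kernel k' \<kappa>'"
    and g: "g \<in> borel_measurable borel" "\<And>x. \<bar>g x\<bar> \<le> G" and g0: "g0 \<in> borel_measurable borel" "\<And>x. \<bar>g0 x\<bar> \<le> G0"
    and GR: "G \<le> R" and T: "0 < T"
  defines "B' \<equiv> (2 * G) powr (p - 1)"
    and "D \<equiv> lpn (unit_volume \<Otimes>\<^sub>M unit_volume) p (\<lambda>q. k (fst q) (snd q) - k' (fst q) (snd q))"
  shows "\<exists>A\<ge>0. \<exists>\<tau>\<^sub>0>0. \<forall>N th h. partition T N th \<and> max_step N th \<le> \<tau>\<^sub>0 \<and> h \<le> N \<longrightarrow>
    lpn unit_volume p (\<lambda>x. sol k g (th h) x - eul k' g0 (steps th) h x)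
      \<le> lpn unit_volume p (\<lambda>x. g x - g0 x) + T * (12 * \<kappa> * B'\<^sup>2 + B') * D + A * max_step N th"
proof -
  have gm: "g \<in> borel_measurable unit_volume" "g0 \<in> borel_measurable unit_volume" using g g0 by auto
  have \<kappa>: "0 \<le> \<kappa>" "0 \<le> \<kappa>'" using unit.sym_kernel_const[OF k] unit.sym_kernel_const[OF k'] by auto
  have D: "0 \<le> D" unfolding D_def by (rule lpn_nonneg)
  have B': "\<bar>truncated_power p (2 * R) (sol k g r y - sol k g r x)\<bar> \<le> B'" for r x y
  proof -
    define s where "s = sol k g r y - sol k g r x"
    have s: "\<bar>s\<bar> \<le> 2 * G"
      using sol_bound[OF k gm(1) g(2), of r x] sol_bound[OF k gm(1) g(2), of r y] by (simp add: s_def)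
    then have "truncated_power p (2 * R) s = truncated_power p (2 * G) s"
      using GR by (simp add: truncated_power_eq)
    then show ?thesis
      unfolding B'_def s_def[symmetric] using truncated_power_bound[OF p, of "2 * G" s] s by simp
  qed
  have B'0: "0 \<le> B'" by (simp add: B'_def)
  define C where "C = 12 * \<kappa> * B'\<^sup>2 + B'"
  have C: "0 \<le> C" "B' \<le> C" using \<kappa> B'0 by (auto simp: C_def)
  have part_steps: "\<And>i. i < N \<Longrightarrow> th i \<le> th (Suc i) \<and> th (Suc i) \<le> th i + max_step N th"
    if "partition T N th" for N th
    using partition_facts(4)[OF that T] by (auto intro: less_imp_le)
  show ?thesis
  proof (cases "p \<le> 2")
    case True
    define A where "A = 2 + 6 * square_norm (F k (sol k g 0)) + 4 * \<kappa>' * B"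
    have A: "0 \<le> A" using \<kappa> square_norm_nonneg[of "F k (sol k g 0)"] by (simp add: A_def)
    have "lpn unit_volume p (\<lambda>x. sol k g (th h) x - eul k' g0 (steps th) h x)
        \<le> lpn unit_volume p (\<lambda>x. g x - g0 x) + T * C * D + A * max_step N th"
      if part: "partition T N th" and h: "h \<le> N" for N th h
    proof -
      note pf = partition_facts[OF part T]
      have "lpn unit_volume p (\<lambda>x. sol k g (th h) x - eul k' g0 (steps th) h x)
        \<le> lpn unit_volume p (\<lambda>x. g x - g0 x) + th h * C * D + A * max_step N th"
        unfolding C_def D_def A_def
        by (rule chatter_error[OF k k' gm(1) g(2) B' p True pf(3) pf(1) part_steps[OF part] h gm(2) g0(2)])
      moreover have "th h * C * D \<le> T * C * D" using pf(5)[OF h] C D by (intro mult_right_mono) auto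
      ultimately show ?thesis by linarith
    qed
    then show ?thesis unfolding C_def using A by (intro exI[of _ A] conjI exI[of _ 1]) auto
  next
    case False
    define L where "L = (p - 1) * (2 * R) powr (p - 2)"
    have L0: "0 \<le> L" using p by (simp add: L_def)
    have L: "\<bar>truncated_power p (2 * R) a - truncated_power p (2 * R) c\<bar> \<le> L * \<bar>a - c\<bar>" for a c
      unfolding L_def using False R by (intro truncated_power_Lipschitz) auto
    define A where "A = T * (2 * \<kappa>' * L * \<kappa> * B')"
    have A: "0 \<le> A" using \<kappa> L0 B'0 T by (simp add: A_def)
    define \<tau>\<^sub>0 where "\<tau>\<^sub>0 = 1 / (\<kappa>' * L + 1)"
    have kL: "0 \<le> \<kappa>' * L" using \<kappa> L0 by simp
    then have \<tau>0: "0 < \<tau>\<^sub>0" by (simp add: \<tau>\<^sub>0_def add_nonneg_pos)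
    have "lpn unit_volume p (\<lambda>x. sol k g (th h) x - eul k' g0 (steps th) h x)
        \<le> lpn unit_volume p (\<lambda>x. g x - g0 x) + T * C * D + A * max_step N th"
      if part: "partition T N th" and ms: "max_step N th \<le> \<tau>\<^sub>0" and h: "h \<le> N" for N th h
    proof -
      note pf = partition_facts[OF part T]
      define m where "m = max_step N th"
      have "\<kappa>' * L * m \<le> \<kappa>' * L * \<tau>\<^sub>0" using ms kL unfolding m_def by (rule mult_left_mono)
      also have "\<dots> \<le> 1" using kL by (simp add: \<tau>\<^sub>0_def divide_le_eq)
      finally have small: "\<kappa>' * L * max_step N th \<le> 1" by (simp add: m_def)
      have "lpn unit_volume p (\<lambda>x. sol k g (th h) x - eul k' g0 (steps th) h x)
        \<le> lpn unit_volume p (\<lambda>x. g x - g0 x) + th h * (B' * D + 2 * \<kappa>' * L * \<kappa> * B' * m)"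
        unfolding D_def m_def
        by (rule Lipschitz_error[OF k k' gm(1) g(2) B' less_imp_le[OF p] L small pf(1) part_steps[OF part] h gm(2) g0(2)])
      also have "th h * (B' * D + 2 * \<kappa>' * L * \<kappa> * B' * m) \<le> T * (C * D + 2 * \<kappa>' * L * \<kappa> * B' * m)"
        using pf(5)[OF h] C D T \<kappa> L0 B'0 pf(3) by (intro mult_mono add_mono) (auto simp: m_def)
      finally show ?thesis by (simp add: A_def m_def algebra_simps)
    qed
    then show ?thesis unfolding C_def using A \<tau>0 by (intro exI[of _ A] conjI exI[of _ \<tau>\<^sub>0]) auto
  qed
qed

text \<open>
  Between grid points both functions are Lipschitz in time.
\<close>

lemma interpolation_error:
  assumes k: "unit.sym_kernel k \<kappa>" and k': "unit.sym_kernel k' \<kappa>'"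
    and g: "g \<in> borel_measurable borel" "\<And>x. \<bar>g x\<bar> \<le> G" and W: "W \<in> borel_measurable borel" "\<And>x. \<bar>W x\<bar> \<le> R"
    and s: "0 \<le> s" "s \<le> t" "t \<le> s + \<tau>"
  defines "f \<equiv> \<lambda>x. sol k g t x - (W x + (t - s) * F k' W x)"
  shows "f \<in> borel_measurable borel" "\<exists>C. \<forall>x. \<bar>f x\<bar> \<le> C"
    "lpn unit_volume p f \<le> lpn unit_volume p (\<lambda>x. sol k g s x - W x) + (\<kappa> + \<kappa>') * B * \<tau>"
proof -
  have gm: "g \<in> borel_measurable unit_volume" and Wm: "W \<in> borel_measurable unit_volume" using g W by auto
  have um: "sol k g r \<in> borel_measurable unit_volume" for r by (rule sol_meas[OF k gm])
  note Fm = F_meas[OF k' Wm] and Fb = F_bound[OF k' Wm]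
  define d where "d x = (sol k g t x - sol k g s x) - (t - s) * F k' W x" for x
  have f: "f = (\<lambda>x. (sol k g s x - W x) + d x)" by (auto simp: f_def d_def)
  have em: "(\<lambda>x. sol k g s x - W x) \<in> borel_measurable unit_volume" using um Wm by measurable
  have dm: "d \<in> borel_measurable unit_volume" unfolding d_def using um Fm by measurable
  have eb: "\<bar>sol k g s x - W x\<bar> \<le> G + R" for x
    using sol_bound[OF k gm g(2), of s x] W(2)[of x] by linarith
  have db: "\<bar>d x\<bar> \<le> (\<kappa> + \<kappa>') * B * \<tau>" for x
  proof -
    have "\<bar>sol k g t x - sol k g s x\<bar> \<le> \<kappa> * B * (t - s)" by (rule sol_Lipschitz[OF k gm s(1,2)])
    moreover have "\<bar>(t - s) * F k' W x\<bar> \<le> (t - s) * (\<kappa>' * B)"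
      unfolding abs_mult using s Fb[of x] by (intro mult_mono) auto
    ultimately have "\<bar>d x\<bar> \<le> (\<kappa> + \<kappa>') * B * (t - s)" by (simp add: d_def algebra_simps)
    also have "\<dots> \<le> (\<kappa> + \<kappa>') * B * \<tau>"
      using s unit.sym_kernel_const[OF k] unit.sym_kernel_const[OF k'] by (intro mult_left_mono) auto
    finally show ?thesis .
  qed
  show "f \<in> borel_measurable borel" using em dm unfolding f by simp
  show "\<exists>C. \<forall>x. \<bar>f x\<bar> \<le> C"
  proof (intro exI allI)
    show "\<bar>f x\<bar> \<le> (G + R) + (\<kappa> + \<kappa>') * B * \<tau>" for x
      unfolding f using eb[of x] db[of x] abs_triangle_ineq[of "sol k g s x - W x" "d x"] by linarith
  qed
  have "lpn unit_volume p f \<le> lpn unit_volume p (\<lambda>x. sol k g s x - W x) + lpn unit_volume p d"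
    unfolding f using p by (intro unit.lpn_triangle[OF em eb dm db]) simp
  also have "lpn unit_volume p d \<le> (\<kappa> + \<kappa>') * B * \<tau>"
    using p by (intro unit.lpn_const_bound[OF dm db]) simp
  finally show "lpn unit_volume p f \<le> lpn unit_volume p (\<lambda>x. sol k g s x - W x) + (\<kappa> + \<kappa>') * B * \<tau>" by simp
qed

end

end

theorem theorem5p4:
  fixes T p :: real
    and g :: "real \<Rightarrow> real"
    and gn gn0 :: "nat \<Rightarrow> real \<Rightarrow> real"
    and K :: "real \<Rightarrow> real \<Rightarrow> real"
    and Kn :: "nat \<Rightarrow> real \<Rightarrow> real \<Rightarrow> real"
    and u :: "real \<Rightarrow> real \<Rightarrow> real"
  assumes "T > 0" and "p > 1"
    and "Linfty \<Omega> g" and "\<And>n. Linfty \<Omega> (gn n)" and "\<And>n. Linfty \<Omega> (gn0 n)"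
    and "kernel K" and "\<And>n. kernel (Kn n)"
    and "is_unique_solution p K g T u"
  shows "\<exists>C\<ge>0. \<forall>n. \<exists>D\<ge>0. \<exists>\<tau>\<^sub>0>0. \<forall>N \<theta>. partition T N \<theta> \<and> max_step N \<theta> \<le> \<tau>\<^sub>0 \<longrightarrow>
    C_Lp_norm p T (\<lambda>t x. u t x - euler_interp p (Kn n) (gn0 n) N \<theta> t x)
    \<le> ennreal C * (Lp_norm p \<Omega> (\<lambda>x. gn n x - gn0 n x) + Lp_norm p \<Omega> (\<lambda>x. g x - gn n x)
                   + Lp_norm p (\<Omega> \<times> \<Omega>) (\<lambda>(x, y). K x y - Kn n x y))
      + ennreal (D * max_step N \<theta>)"
proof -
  have Om: "\<Omega> \<in> sets borel" by simp
  have Om2: "\<Omega> \<times> \<Omega> \<in> sets borel" by (intro borel_closed closed_Times) auto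
  note T = \<open>T > 0\<close> and p = \<open>p > 1\<close>
  have p0: "0 < p" using p by simp
  obtain g' G where g': "g' \<in> borel_measurable borel" "\<And>x. \<bar>g' x\<bar> \<le> G" "0 < G" "AE x in unit_volume. g x = g' x"
    by (rule Linfty_representative[OF assms(3)]) blast
  obtain k \<kappa> where k: "unit.sym_kernel k \<kappa>" "AE q in unit_volume \<Otimes>\<^sub>M unit_volume. K (fst q) (snd q) = k (fst q) (snd q)"
    by (rule kernel_representative[OF assms(6)])
  define B' where "B' = (2 * G) powr (p - 1)"
  define C1 where "C1 = T * (12 * \<kappa> * B'\<^sup>2 + B')"
  have C1: "0 \<le> C1" using T unit.sym_kernel_const[OF k(1)] by (simp add: C1_def B'_def)
  show ?thesis
  proof (rule exI[of _ "1 + C1"], intro conjI allI)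
    show "0 \<le> 1 + C1" using C1 by simp
  next
    fix n
    obtain a Ga where a: "a \<in> borel_measurable borel" "\<And>x. \<bar>a x\<bar> \<le> Ga" "0 < Ga" "AE x in unit_volume. gn n x = a x"
      by (rule Linfty_representative[OF assms(4)]) blast
    obtain b G0 where b: "b \<in> borel_measurable borel" "\<And>x. \<bar>b x\<bar> \<le> G0" "0 < G0" "AE x in unit_volume. gn0 n x = b x"
      by (rule Linfty_representative[OF assms(5)]) blast
    obtain k' \<kappa>' where k': "unit.sym_kernel k' \<kappa>'" "AE q in unit_volume \<Otimes>\<^sub>M unit_volume. Kn n (fst q) (snd q) = k' (fst q) (snd q)"
      by (rule kernel_representative[OF assms(7)])
    have K: "AE x in unit_volume. AE y in unit_volume. K x y = k x y"
      using unit.sq.AE_pair[OF k(2)] by simp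
    have Kn: "AE x in unit_volume. AE y in unit_volume. Kn n x y = k' x y"
      using unit.sq.AE_pair[OF k'(2)] by simp
    \<comment> \<open>This level suits the solution and the iterates, so it depends on \<open>n\<close>, and with it the truncated flow; uniqueness identifies all of these flows with \<open>u\<close>.\<close>
    define R where "R = G + G0 + 1"
    interpret truncated_flux p R
      using p g'(3) b(3) by unfold_locales (auto simp: R_def)
    have GR: "G \<le> R" "G0 + 1 \<le> R" using g'(3) b(3) by (auto simp: R_def)
    have g'R: "\<bar>g' x\<bar> \<le> R" for x using g'(2)[of x] GR by linarith
    have "is_solution p K g T (sol k g')"
      by (rule sol_is_solution[OF k(1) K g'(1) g'R g'(4) T])
    then have u: "AE x in unit_volume. sol k g' t x = u t x" if "t \<in> {0..T}" for t
      using assms(8) that unfolding is_unique_solution_def AE_lebesgue_on[OF Om] by blast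
    define d where "d = lpn (unit_volume \<Otimes>\<^sub>M unit_volume) p (\<lambda>q. k (fst q) (snd q) - k' (fst q) (snd q))"
    define e1 where "e1 = lpn unit_volume p (\<lambda>x. a x - b x)"
    define e2 where "e2 = lpn unit_volume p (\<lambda>x. g' x - a x)"
    have nonneg: "0 \<le> d" "0 \<le> e1" "0 \<le> e2" by (auto simp: d_def e1_def e2_def lpn_nonneg)
    have N1: "Lp_norm p \<Omega> (\<lambda>x. gn n x - gn0 n x) = ennreal e1"
      unfolding e1_def
    proof (rule Lp_norm_representative[OF Om _ _ _ p0 prob_space_unit_volume])
      show "(\<lambda>x. a x - b x) \<in> borel_measurable borel" using a(1) b(1) by measurable
      show "\<bar>a x - b x\<bar> \<le> Ga + G0" for x using a(2)[of x] b(2)[of x] by linarith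
      show "AE x in unit_volume. gn n x - gn0 n x = a x - b x" using a(4) b(4) by eventually_elim simp
    qed
    have N2: "Lp_norm p \<Omega> (\<lambda>x. g x - gn n x) = ennreal e2"
      unfolding e2_def
    proof (rule Lp_norm_representative[OF Om _ _ _ p0 prob_space_unit_volume])
      show "(\<lambda>x. g' x - a x) \<in> borel_measurable borel" using a(1) g'(1) by measurable
      show "\<bar>g' x - a x\<bar> \<le> G + Ga" for x using a(2)[of x] g'(2)[of x] by linarith
      show "AE x in unit_volume. g x - gn n x = g' x - a x" using a(4) g'(4) by eventually_elim simp
    qed
    have N3: "Lp_norm p (\<Omega> \<times> \<Omega>) (\<lambda>(x, y). K x y - Kn n x y) = ennreal d"
      unfolding d_def unit_square_volume[symmetric]
    proof (rule Lp_norm_representative[OF Om2 _ _ _ p0])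
      have "(\<lambda>q. k (fst q) (snd q) - k' (fst q) (snd q)) \<in> borel_measurable (volume_on (\<Omega> \<times> \<Omega>))"
        unfolding unit_square_volume using kernel_pair_meas[OF k(1)] kernel_pair_meas[OF k'(1)] by measurable
      then show "(\<lambda>q. k (fst q) (snd q) - k' (fst q) (snd q)) \<in> borel_measurable borel" by simp
      show "\<bar>k (fst q) (snd q) - k' (fst q) (snd q)\<bar> \<le> \<kappa> + \<kappa>'" for q
        using unit.sym_kernel_bounds[OF k(1), of "fst q" "snd q"] unit.sym_kernel_bounds[OF k'(1), of "fst q" "snd q"] by linarith
      show "AE q in volume_on (\<Omega> \<times> \<Omega>). (case q of (x, y) \<Rightarrow> K x y - Kn n x y) = k (fst q) (snd q) - k' (fst q) (snd q)"
        unfolding unit_square_volume using k(2) k'(2) by eventually_elim (simp add: split_beta)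
      show "prob_space (volume_on (\<Omega> \<times> \<Omega>))"
        unfolding unit_square_volume by (rule unit.sq.prob_space_axioms)
    qed
    have e_tri: "lpn unit_volume p (\<lambda>x. g' x - b x) \<le> e1 + e2"
    proof -
      have "lpn unit_volume p (\<lambda>x. (a x - b x) + (g' x - a x)) \<le> e1 + e2"
        unfolding e1_def e2_def
      proof (rule unit.lpn_triangle)
        show "(\<lambda>x. a x - b x) \<in> borel_measurable unit_volume" "(\<lambda>x. g' x - a x) \<in> borel_measurable unit_volume"
          using a(1) b(1) g'(1) by auto
        show "\<bar>a x - b x\<bar> \<le> Ga + G0" for x using a(2)[of x] b(2)[of x] by linarith
        show "\<bar>g' x - a x\<bar> \<le> G + Ga" for x using a(2)[of x] g'(2)[of x] by linarith
      qed (use p in simp)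
      then show ?thesis by simp
    qed
    obtain A \<tau>1 where A: "0 \<le> A" "0 < \<tau>1" and grid: "\<And>N th h. partition T N th \<Longrightarrow> max_step N th \<le> \<tau>1 \<Longrightarrow> h \<le> N \<Longrightarrow>
        lpn unit_volume p (\<lambda>x. sol k g' (th h) x - eul k' b (\<lambda>i. th (Suc i) - th i) h x)
          \<le> lpn unit_volume p (\<lambda>x. g' x - b x) + C1 * d + A * max_step N th"
      using grid_error[OF k(1) k'(1) g'(1,2) b(1,2) GR(1) T] unfolding C1_def B'_def d_def by blast
    obtain \<tau>2 where \<tau>2: "0 < \<tau>2" and stays: "\<And>N th h x. partition T N th \<Longrightarrow> max_step N th \<le> \<tau>2 \<Longrightarrow> h \<le> N \<Longrightarrow>
        \<bar>eul k' b (\<lambda>i. th (Suc i) - th i) h x\<bar> \<le> R"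
      using eul_stays_bounded[OF k'(1) b(1,2) GR(2) T] by blast
    define D where "D = A + (\<kappa> + \<kappa>') * (2 * R) powr (p - 1)"
    have D: "0 \<le> D" using A unit.sym_kernel_const[OF k(1)] unit.sym_kernel_const[OF k'(1)] by (simp add: D_def)
    have main: "Lp_norm p \<Omega> (\<lambda>x. u t x - euler_interp p (Kn n) (gn0 n) N \<theta> t x)
        \<le> ennreal (1 + C1) * (ennreal e1 + ennreal e2 + ennreal d) + ennreal (D * max_step N \<theta>)"
      if part: "partition T N \<theta>" and ms: "max_step N \<theta> \<le> min \<tau>1 \<tau>2" and t: "t \<in> {0..T}" for N \<theta> t
    proof -
      let ?W = "eul k' b (\<lambda>i. \<theta> (Suc i) - \<theta> i)"
      have W_bd: "\<bar>?W i x\<bar> \<le> R" if "i \<le> N" for i x using ms that by (intro stays[OF part]) auto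
      obtain h where h: "h \<le> N" "\<theta> h \<le> t" "t \<le> \<theta> h + max_step N \<theta>" and
        eq: "AE x in unit_volume. euler_interp p (Kn n) (gn0 n) N \<theta> t x = ?W h x + (t - \<theta> h) * F k' (?W h) x"
        by (rule euler_interp_representative[OF k'(1) Kn b(1,4) part T t W_bd])
      have Wm: "?W h \<in> borel_measurable borel" using eul_meas[OF k'(1), of b "\<lambda>i. \<theta> (Suc i) - \<theta> i" h] b(1) by simp
      have th0: "0 \<le> \<theta> h" using partition_facts(5)[OF part T h(1)] by simp
      define f where "f x = sol k g' t x - (?W h x + (t - \<theta> h) * F k' (?W h) x)" for x
      note ie = interpolation_error[OF k(1) k'(1) g'(1,2) Wm W_bd[OF h(1)] th0 h(2,3), folded f_def]
      obtain Cf where Cf: "\<And>x. \<bar>f x\<bar> \<le> Cf" using ie(2) by blast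
      have "Lp_norm p \<Omega> (\<lambda>x. u t x - euler_interp p (Kn n) (gn0 n) N \<theta> t x) = ennreal (lpn unit_volume p f)"
      proof (rule Lp_norm_representative[OF Om ie(1) Cf _ p0 prob_space_unit_volume])
        show "AE x in unit_volume. u t x - euler_interp p (Kn n) (gn0 n) N \<theta> t x = f x"
          using u[OF t] eq by eventually_elim (simp add: f_def)
      qed
      also have "\<dots> \<le> ennreal ((1 + C1) * (e1 + e2 + d) + D * max_step N \<theta>)"
      proof (rule ennreal_leI)
        have "lpn unit_volume p f \<le> e1 + e2 + C1 * d + A * max_step N \<theta> + (\<kappa> + \<kappa>') * (2 * R) powr (p - 1) * max_step N \<theta>"
          using ie(3) grid[OF part _ h(1)] ms e_tri by simp
        moreover have "e1 + e2 + C1 * d \<le> (1 + C1) * (e1 + e2 + d)"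
          using nonneg C1 by (simp add: algebra_simps)
        moreover have "D * max_step N \<theta> = A * max_step N \<theta> + (\<kappa> + \<kappa>') * (2 * R) powr (p - 1) * max_step N \<theta>"
          by (simp add: D_def algebra_simps)
        ultimately show "lpn unit_volume p f \<le> (1 + C1) * (e1 + e2 + d) + D * max_step N \<theta>" by linarith
      qed
      also have "\<dots> = ennreal (1 + C1) * (ennreal e1 + ennreal e2 + ennreal d) + ennreal (D * max_step N \<theta>)"
        using nonneg C1 D partition_facts(3)[OF part T] by (simp add: ennreal_mult add_nonneg_nonneg)
      finally show ?thesis .
    qed
    have "C_Lp_norm p T (\<lambda>t x. u t x - euler_interp p (Kn n) (gn0 n) N \<theta> t x)
        \<le> ennreal (1 + C1) * (Lp_norm p \<Omega> (\<lambda>x. gn n x - gn0 n x) + Lp_norm p \<Omega> (\<lambda>x. g x - gn n x)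
             + Lp_norm p (\<Omega> \<times> \<Omega>) (\<lambda>(x, y). K x y - Kn n x y)) + ennreal (D * max_step N \<theta>)"
      if "partition T N \<theta> \<and> max_step N \<theta> \<le> min \<tau>1 \<tau>2" for N \<theta>
      unfolding C_Lp_norm_def N1 N2 N3 using main that by (intro SUP_least) blast
    then show "\<exists>D\<ge>0. \<exists>\<tau>\<^sub>0>0. \<forall>N \<theta>. partition T N \<theta> \<and> max_step N \<theta> \<le> \<tau>\<^sub>0 \<longrightarrow>
        C_Lp_norm p T (\<lambda>t x. u t x - euler_interp p (Kn n) (gn0 n) N \<theta> t x)
        \<le> ennreal (1 + C1) * (Lp_norm p \<Omega> (\<lambda>x. gn n x - gn0 n x) + Lp_norm p \<Omega> (\<lambda>x. g x - gn n x)
                   + Lp_norm p (\<Omega> \<times> \<Omega>) (\<lambda>(x, y). K x y - Kn n x y)) + ennreal (D * max_step N \<theta>)"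
      using D A(2) \<tau>2 by (intro exI[of _ D] conjI exI[of _ "min \<tau>1 \<tau>2"] allI impI) auto
  qed
qed

end
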